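(* Let $\mathcal{Q}=\mathcal{Q}_3$ or $\mathcal{Q}=\mathcal{Q}_4$. Assume $Y\in\mathrm{Ind}\text{-}(\mathrm{Vect}^{\mathrm{op}})$ is $\mathcal{Q}$-free. Then $\mathrm{Hom}(X,Y)$ is $\mathcal{Q}$-free for every $X\in\mathrm{Ind}\text{-}(\mathrm{Vect}^{\mathrm{op}})$.
   Context: Fix a field $\mathbf{k}$ and a (non-trivial) Grothendieck universe; sets in it are small. $\mathrm{Vect}$ is the category of small $\mathbf{k}$-vector spaces, $[\mathrm{Vect},\mathrm{Vect}]$ the category of $\mathbf{k}$-additive functors (acting $\mathbf{k}$-linearly on hom-spaces) and natural transformations, $\mathbb{Y}V:=\mathrm{Vect}(V,-)$. $\mathrm{Ind}\text{-}(\mathrm{Vect}^{\mathrm{op}})$ is the full subcategory of $[\mathrm{Vect},\mathrm{Vect}]$ on the small functors, i.e. those isomorphic to a colimit, over a small directed poset, of representables. $\mathcal{Q}_3$ is the class of cokernels of the canonical inclusions $(\mathbb{Y}\mathbf{k})^{\oplus\kappa}\to(\mathbb{Y}\mathbf{k})^\kappa$, $\kappa$ a small cardinal. $\mathcal{Q}_4$ is the class of all quotients $\mathbb{Y}V/\bigcup_{H\in\mathcal{F}}\mathbb{Y}(V/H)$ with $V\in\mathrm{Vect}$ and $\mathcal{F}$ a filter of linear subspaces of $V$ (nonempty, closed under finite intersections and larger subspaces) with $\bigcap\mathcal{F}=0$, where $\mathbb{Y}(V/H)\subseteq\mathbb{Y}V$ consists of the linear maps vanishing on $H$. An object $X$ is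 $\mathcal{Q}$-free if there is no nonzero natural transformation $Q\to X$ with $Q\in\mathcal{Q}$. (The $\mathcal{Q}_3$-free objects are exactly the strong $\mathbf{k}$-vector spaces.) $\mathrm{Hom}(X,-)$ is the right adjoint of $X\hat\otimes-$ on $\mathrm{Ind}\text{-}(\mathrm{Vect}^{\mathrm{op}})$, where $(X\hat\otimes Y)(V)\cong\int^{H_0}\int^{H_1}X(H_0)\otimes Y(H_1)\otimes\mathrm{Vect}(H_0\otimes H_1,V)$. Concretely $\mathrm{Hom}(X,Y)(V)$ is the space of natural transformations from $X$ to $Y(-\otimes V)$. *)

theory Defs
  imports "HOL-Algebra.Module" "HOL-Algebra.AbelCoset" "HOL-Library.FuncSet"
begin

section \<open>Grothendieck universes\<close>

text \<open>
  The type \<open>'u\<close> plays the role of a Grothendieck universe: its inhabitants are the sets belonging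
  to the universe, and \<open>elts x\<close> is the set of members of \<open>x\<close> (transitivity of the universe is built
  into the type of \<open>elts\<close>). The axiom \<open>elts_Pow\<close> says that the power set of \<open>x\<close> belongs to the
  universe; by transitivity so do all subsets of \<open>x\<close>. Well-foundedness is the axiom of foundation
  of the ambient set theory. Non-triviality is the existence of an infinite member.
\<close>

class grothendieck_universe =
  fixes elts :: "'a \<Rightarrow> 'a set"
  assumes elts_inject: "elts x = elts y \<Longrightarrow> x = y"
    and elts_wf: "wf {(x, y). x \<in> elts y}"
    and elts_pair: "\<exists>z. elts z = {x, y}"
    and elts_Pow: "\<exists>p. elts ` elts p = Pow (elts x)"
    and elts_UNION: "\<exists>u. elts u = (\<Union>i\<in>elts x. elts (f i))"
    and elts_infinite: "\<exists>x. infinite (elts x)"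

definition small :: "'u::grothendieck_universe set \<Rightarrow> bool" where
  "small A \<longleftrightarrow> A \<in> range elts"


section \<open>Vector spaces and linear maps\<close>

text \<open>
  Only the additive part of the ring record underlying a module is meaningful; the multiplicative
  fields are filled with a dummy value.
\<close>

definition mk_module ::
    "'b set \<Rightarrow> ('b \<Rightarrow> 'b \<Rightarrow> 'b) \<Rightarrow> 'b \<Rightarrow> ('a \<Rightarrow> 'b \<Rightarrow> 'b) \<Rightarrow> ('a, 'b) module" where
  "mk_module C a z s =
     \<lparr>carrier = C, mult = undefined, one = undefined, zero = z, add = a, smult = s\<rparr>"

definition linear_map ::
    "'u ring \<Rightarrow> ('u, 'a) module \<Rightarrow> ('u, 'b) module \<Rightarrow> ('a \<Rightarrow> 'b) \<Rightarrow> bool" where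
  "linear_map k M N f \<longleftrightarrow>
     f \<in> carrier M \<rightarrow> carrier N \<and>
     (\<forall>x\<in>carrier M. \<forall>y\<in>carrier M. f (x \<oplus>\<^bsub>M\<^esub> y) = f x \<oplus>\<^bsub>N\<^esub> f y) \<and>
     (\<forall>a\<in>carrier k. \<forall>x\<in>carrier M. f (a \<odot>\<^bsub>M\<^esub> x) = a \<odot>\<^bsub>N\<^esub> f x)"

text \<open>Morphisms are taken to be extensional, so that equality of morphisms is equality in HOL.\<close>

definition lin_maps ::
    "'u ring \<Rightarrow> ('u, 'a) module \<Rightarrow> ('u, 'b) module \<Rightarrow> ('a \<Rightarrow> 'b) set" where
  "lin_maps k M N = {f \<in> extensional (carrier M). linear_map k M N f}"

definition id_map :: "('u, 'a) module \<Rightarrow> 'a \<Rightarrow> 'a" where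
  "id_map M = (\<lambda>x\<in>carrier M. x)"

definition hom_module ::
    "'u ring \<Rightarrow> ('u, 'a) module \<Rightarrow> ('u, 'b) module \<Rightarrow> ('u, 'a \<Rightarrow> 'b) module" where
  "hom_module k M N = mk_module (lin_maps k M N)
     (\<lambda>f g. \<lambda>x\<in>carrier M. f x \<oplus>\<^bsub>N\<^esub> g x)
     (\<lambda>x\<in>carrier M. \<zero>\<^bsub>N\<^esub>)
     (\<lambda>a f. \<lambda>x\<in>carrier M. a \<odot>\<^bsub>N\<^esub> f x)"

definition quotient_module ::
    "'u ring \<Rightarrow> ('u, 'a) module \<Rightarrow> 'a set \<Rightarrow> ('u, 'a set) module" where
  "quotient_module k M S = mk_module (a_rcosets\<^bsub>M\<^esub> S)
     (\<lambda>C D. C <+>\<^bsub>M\<^esub> D)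
     S
     (\<lambda>a C. \<Union>x\<in>C. S +>\<^bsub>M\<^esub> (a \<odot>\<^bsub>M\<^esub> x))"

definition power_module :: "'i set \<Rightarrow> ('u, 'a) module \<Rightarrow> ('u, 'i \<Rightarrow> 'a) module" where
  "power_module I M = mk_module (I \<rightarrow>\<^sub>E carrier M)
     (\<lambda>x y. \<lambda>i\<in>I. x i \<oplus>\<^bsub>M\<^esub> y i)
     (\<lambda>i\<in>I. \<zero>\<^bsub>M\<^esub>)
     (\<lambda>a x. \<lambda>i\<in>I. a \<odot>\<^bsub>M\<^esub> x i)"

definition direct_sum :: "'i set \<Rightarrow> ('u, 'a) module \<Rightarrow> ('i \<Rightarrow> 'a) set" where
  "direct_sum I M = {x \<in> I \<rightarrow>\<^sub>E carrier M. finite {i\<in>I. x i \<noteq> \<zero>\<^bsub>M\<^esub>}}"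

definition self_module :: "'u ring \<Rightarrow> ('u, 'u) module" where
  "self_module k = mk_module (carrier k) (add k) (zero k) (mult k)"

definition vect :: "'u::grothendieck_universe ring \<Rightarrow> ('u, 'u) module set" where
  "vect k = {V. module k V \<and> small (carrier V)}"


section \<open>Tensor products\<close>

definition bilinear_map ::
    "'u ring \<Rightarrow> ('u, 'a) module \<Rightarrow> ('u, 'b) module \<Rightarrow> ('u, 'c) module \<Rightarrow> ('a \<Rightarrow> 'b \<Rightarrow> 'c) \<Rightarrow> bool" where
  "bilinear_map k V W Z b \<longleftrightarrow>
     (\<forall>v\<in>carrier V. linear_map k W Z (b v)) \<and>
     (\<forall>w\<in>carrier W. linear_map k V Z (\<lambda>v. b v w))"

definition is_tensor ::
    "'u::grothendieck_universe ring \<Rightarrow> ('u, 'u) module \<Rightarrow> ('u, 'u) module \<Rightarrow>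
     ('u, 'u) module \<Rightarrow> ('u \<Rightarrow> 'u \<Rightarrow> 'u) \<Rightarrow> bool" where
  "is_tensor k V W T b \<longleftrightarrow>
     T \<in> vect k \<and> bilinear_map k V W T b \<and>
     (\<forall>Z\<in>vect k. \<forall>\<beta>. bilinear_map k V W Z \<beta> \<longrightarrow>
        (\<exists>!h. h \<in> lin_maps k T Z \<and>
              (\<forall>v\<in>carrier V. \<forall>w\<in>carrier W. h (b v w) = \<beta> v w)))"

text \<open>
  A fixed choice of tensor product in the category of small vector spaces, with its universal
  bilinear map.
\<close>

definition tensor_choice ::
    "'u::grothendieck_universe ring \<Rightarrow> ('u, 'u) module \<Rightarrow> ('u, 'u) module \<Rightarrow>
     ('u, 'u) module \<times> ('u \<Rightarrow> 'u \<Rightarrow> 'u)" where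
  "tensor_choice k V W = (SOME (T, b). is_tensor k V W T b)"

definition tensor ::
    "'u::grothendieck_universe ring \<Rightarrow> ('u, 'u) module \<Rightarrow> ('u, 'u) module \<Rightarrow> ('u, 'u) module" where
  "tensor k V W = fst (tensor_choice k V W)"

definition tens ::
    "'u::grothendieck_universe ring \<Rightarrow> ('u, 'u) module \<Rightarrow> ('u, 'u) module \<Rightarrow> 'u \<Rightarrow> 'u \<Rightarrow> 'u" where
  "tens k V W = snd (tensor_choice k V W)"

definition tensor_map ::
    "'u::grothendieck_universe ring \<Rightarrow> ('u, 'u) module \<Rightarrow> ('u, 'u) module \<Rightarrow>
     ('u, 'u) module \<Rightarrow> ('u, 'u) module \<Rightarrow> ('u \<Rightarrow> 'u) \<Rightarrow> ('u \<Rightarrow> 'u) \<Rightarrow> 'u \<Rightarrow> 'u" where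
  "tensor_map k V V' W W' f g =
     (THE h. h \<in> lin_maps k (tensor k V W) (tensor k V' W') \<and>
        (\<forall>v\<in>carrier V. \<forall>w\<in>carrier W. h (tens k V W v w) = tens k V' W' (f v) (g w)))"


section \<open>Additive functors and natural transformations\<close>

text \<open>
  Functors from small vector spaces to vector spaces with carrier in an arbitrary type. \<open>Map F V W\<close>
  is the action on morphisms from \<open>V\<close> to \<open>W\<close>. Allowing values in other types than \<open>'u\<close> makes it
  possible to use the literal constructions of representables, quotients and spaces of natural
  transformations; the notion of natural transformation does not depend on these types.
\<close>

record ('u, 'a) vfunctor =
  Ob :: "('u, 'u) module \<Rightarrow> ('u, 'a) module"
  Map :: "('u, 'u) module \<Rightarrow> ('u, 'u) module \<Rightarrow> ('u \<Rightarrow> 'u) \<Rightarrow> 'a \<Rightarrow> 'a"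

definition additive_functor ::
    "'u::grothendieck_universe ring \<Rightarrow> ('u, 'a) vfunctor \<Rightarrow> bool" where
  "additive_functor k F \<longleftrightarrow>
     (\<forall>V\<in>vect k. module k (Ob F V)) \<and>
     (\<forall>V\<in>vect k. \<forall>W\<in>vect k.
        linear_map k (hom_module k V W) (hom_module k (Ob F V) (Ob F W)) (Map F V W)) \<and>
     (\<forall>V\<in>vect k. Map F V V (id_map V) = id_map (Ob F V)) \<and>
     (\<forall>V\<in>vect k. \<forall>W\<in>vect k. \<forall>Z\<in>vect k. \<forall>f\<in>lin_maps k V W. \<forall>g\<in>lin_maps k W Z.
        Map F V Z (compose (carrier V) g f) =
        compose (carrier (Ob F V)) (Map F W Z g) (Map F V W f))"

definition vect_endofunctors :: "'u::grothendieck_universe ring \<Rightarrow> ('u, 'u) vfunctor set" where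
  "vect_endofunctors k = {F. additive_functor k F \<and> (\<forall>V\<in>vect k. Ob F V \<in> vect k)}"

definition nat_transfs ::
    "'u::grothendieck_universe ring \<Rightarrow> ('u, 'a) vfunctor \<Rightarrow> ('u, 'b) vfunctor \<Rightarrow>
     (('u, 'u) module \<Rightarrow> 'a \<Rightarrow> 'b) set" where
  "nat_transfs k F G =
     {\<eta> \<in> extensional (vect k).
        (\<forall>V\<in>vect k. \<eta> V \<in> lin_maps k (Ob F V) (Ob G V)) \<and>
        (\<forall>V\<in>vect k. \<forall>W\<in>vect k. \<forall>f\<in>lin_maps k V W. \<forall>x\<in>carrier (Ob F V).
           \<eta> W (Map F V W f x) = Map G V W f (\<eta> V x))}"

definition nat_id ::
    "'u::grothendieck_universe ring \<Rightarrow> ('u, 'a) vfunctor \<Rightarrow> ('u, 'u) module \<Rightarrow> 'a \<Rightarrow> 'a" where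
  "nat_id k F = (\<lambda>V\<in>vect k. id_map (Ob F V))"

text \<open>The composite of \<open>\<theta>\<close>, with domain \<open>F\<close>, followed by \<open>\<eta>\<close>.\<close>

definition nat_comp ::
    "'u::grothendieck_universe ring \<Rightarrow> ('u, 'a) vfunctor \<Rightarrow> (('u, 'u) module \<Rightarrow> 'b \<Rightarrow> 'c) \<Rightarrow>
     (('u, 'u) module \<Rightarrow> 'a \<Rightarrow> 'b) \<Rightarrow> ('u, 'u) module \<Rightarrow> 'a \<Rightarrow> 'c" where
  "nat_comp k F \<eta> \<theta> = (\<lambda>V\<in>vect k. compose (carrier (Ob F V)) (\<eta> V) (\<theta> V))"

definition nat_module ::
    "'u::grothendieck_universe ring \<Rightarrow> ('u, 'a) vfunctor \<Rightarrow> ('u, 'b) vfunctor \<Rightarrow>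
     ('u, ('u, 'u) module \<Rightarrow> 'a \<Rightarrow> 'b) module" where
  "nat_module k F G = mk_module (nat_transfs k F G)
     (\<lambda>\<eta> \<theta>. \<lambda>V\<in>vect k. \<lambda>x\<in>carrier (Ob F V). \<eta> V x \<oplus>\<^bsub>Ob G V\<^esub> \<theta> V x)
     (\<lambda>V\<in>vect k. \<lambda>x\<in>carrier (Ob F V). \<zero>\<^bsub>Ob G V\<^esub>)
     (\<lambda>a \<eta>. \<lambda>V\<in>vect k. \<lambda>x\<in>carrier (Ob F V). a \<odot>\<^bsub>Ob G V\<^esub> \<eta> V x)"

definition yoneda ::
    "'u::grothendieck_universe ring \<Rightarrow> ('u, 'u) module \<Rightarrow> ('u, 'u \<Rightarrow> 'u) vfunctor" where
  "yoneda k V = \<lparr>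
     Ob = (\<lambda>W. hom_module k V W),
     Map = (\<lambda>W W' g. \<lambda>f\<in>lin_maps k V W. compose (carrier V) g f)\<rparr>"

definition power_functor :: "'i set \<Rightarrow> ('u, 'a) vfunctor \<Rightarrow> ('u, 'i \<Rightarrow> 'a) vfunctor" where
  "power_functor I F = \<lparr>
     Ob = (\<lambda>V. power_module I (Ob F V)),
     Map = (\<lambda>V W f. \<lambda>x\<in>carrier (power_module I (Ob F V)). \<lambda>i\<in>I. Map F V W f (x i))\<rparr>"

text \<open>
  The cokernel of the inclusion into \<open>F\<close> of a subfunctor, given by its values \<open>S V\<close>: cokernels of
  additive functors are formed pointwise.
\<close>

definition quotient_functor ::
    "'u ring \<Rightarrow> ('u, 'a) vfunctor \<Rightarrow> (('u, 'u) module \<Rightarrow> 'a set) \<Rightarrow> ('u, 'a set) vfunctor" where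
  "quotient_functor k F S = \<lparr>
     Ob = (\<lambda>V. quotient_module k (Ob F V) (S V)),
     Map = (\<lambda>V W f. \<lambda>C\<in>carrier (quotient_module k (Ob F V) (S V)).
              \<Union>x\<in>C. S W +>\<^bsub>Ob F W\<^esub> Map F V W f x)\<rparr>"


section \<open>The category of small functors\<close>

text \<open>
  A small directed poset \<open>(I, r)\<close>, where \<open>(i, j) \<in> r\<close> means that \<open>i\<close> is below \<open>j\<close>, and a diagram of
  representables indexed by it. Since every small set is isomorphic to a subset of \<open>'u\<close> which is a
  member of the universe, it suffices to consider such index sets.
\<close>

definition small_directed_poset :: "'u::grothendieck_universe set \<Rightarrow> ('u \<times> 'u) set \<Rightarrow> bool" where
  "small_directed_poset I r \<longleftrightarrow>
     small I \<and> partial_order_on I r \<and> I \<noteq> {} \<and>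
     (\<forall>i\<in>I. \<forall>j\<in>I. \<exists>l\<in>I. (i, l) \<in> r \<and> (j, l) \<in> r)"

definition representable_diagram ::
    "'u::grothendieck_universe ring \<Rightarrow> 'u set \<Rightarrow> ('u \<times> 'u) set \<Rightarrow> ('u \<Rightarrow> ('u, 'u) module) \<Rightarrow>
     ('u \<Rightarrow> 'u \<Rightarrow> ('u, 'u) module \<Rightarrow> ('u \<Rightarrow> 'u) \<Rightarrow> ('u \<Rightarrow> 'u)) \<Rightarrow> bool" where
  "representable_diagram k I r H t \<longleftrightarrow>
     (\<forall>i\<in>I. H i \<in> vect k) \<and>
     (\<forall>(i, j)\<in>r. t i j \<in> nat_transfs k (yoneda k (H i)) (yoneda k (H j))) \<and>
     (\<forall>i\<in>I. t i i = nat_id k (yoneda k (H i))) \<and>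
     (\<forall>i j l. (i, j) \<in> r \<and> (j, l) \<in> r \<longrightarrow> t i l = nat_comp k (yoneda k (H i)) (t j l) (t i j))"

definition representable_cocone ::
    "'u::grothendieck_universe ring \<Rightarrow> 'u set \<Rightarrow> ('u \<times> 'u) set \<Rightarrow> ('u \<Rightarrow> ('u, 'u) module) \<Rightarrow>
     ('u \<Rightarrow> 'u \<Rightarrow> ('u, 'u) module \<Rightarrow> ('u \<Rightarrow> 'u) \<Rightarrow> ('u \<Rightarrow> 'u)) \<Rightarrow>
     ('u, 'u) vfunctor \<Rightarrow> ('u \<Rightarrow> ('u, 'u) module \<Rightarrow> ('u \<Rightarrow> 'u) \<Rightarrow> 'u) \<Rightarrow> bool" where
  "representable_cocone k I r H t F c \<longleftrightarrow>
     (\<forall>i\<in>I. c i \<in> nat_transfs k (yoneda k (H i)) F) \<and>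
     (\<forall>(i, j)\<in>r. nat_comp k (yoneda k (H i)) (c j) (t i j) = c i)"

definition is_representable_colimit ::
    "'u::grothendieck_universe ring \<Rightarrow> 'u set \<Rightarrow> ('u \<times> 'u) set \<Rightarrow> ('u \<Rightarrow> ('u, 'u) module) \<Rightarrow>
     ('u \<Rightarrow> 'u \<Rightarrow> ('u, 'u) module \<Rightarrow> ('u \<Rightarrow> 'u) \<Rightarrow> ('u \<Rightarrow> 'u)) \<Rightarrow>
     ('u, 'u) vfunctor \<Rightarrow> ('u \<Rightarrow> ('u, 'u) module \<Rightarrow> ('u \<Rightarrow> 'u) \<Rightarrow> 'u) \<Rightarrow> bool" where
  "is_representable_colimit k I r H t F c \<longleftrightarrow>
     representable_cocone k I r H t F c \<and>
     (\<forall>G\<in>vect_endofunctors k. \<forall>d. representable_cocone k I r H t G d \<longrightarrow>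
        (\<exists>!u. u \<in> nat_transfs k F G \<and>
              (\<forall>i\<in>I. nat_comp k (yoneda k (H i)) u (c i) = d i)))"

definition ind_vect_op :: "'u::grothendieck_universe ring \<Rightarrow> ('u, 'u) vfunctor set" where
  "ind_vect_op k = {F \<in> vect_endofunctors k.
     \<exists>I r H t c. small_directed_poset I r \<and> representable_diagram k I r H t \<and>
                 is_representable_colimit k I r H t F c}"


section \<open>The classes of cokernels and freeness\<close>

text \<open>
  Small cardinals are represented by small index sets \<open>I\<close>. The direct sum of copies of a
  representable is, pointwise, the subfunctor of finitely supported families in the power.
\<close>

definition Q3 ::
    "'u::grothendieck_universe ring \<Rightarrow> ('u, ('u \<Rightarrow> 'u \<Rightarrow> 'u) set) vfunctor set" where
  "Q3 k = {quotient_functor k (power_functor I (yoneda k (self_module k)))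
             (\<lambda>V. direct_sum I (Ob (yoneda k (self_module k)) V)) | I :: 'u set. small I}"

definition subspace_filter :: "'u ring \<Rightarrow> ('u, 'a) module \<Rightarrow> 'a set set \<Rightarrow> bool" where
  "subspace_filter k V \<F> \<longleftrightarrow>
     \<F> \<subseteq> {H. submodule H k V} \<and> \<F> \<noteq> {} \<and>
     (\<forall>H\<in>\<F>. \<forall>H'\<in>\<F>. H \<inter> H' \<in> \<F>) \<and>
     (\<forall>H\<in>\<F>. \<forall>H'. submodule H' k V \<and> H \<subseteq> H' \<longrightarrow> H' \<in> \<F>)"

definition yoneda_vanishing ::
    "'u ring \<Rightarrow> ('u, 'u) module \<Rightarrow> 'u set \<Rightarrow> ('u, 'u) module \<Rightarrow> ('u \<Rightarrow> 'u) set" where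
  "yoneda_vanishing k V H W = {f \<in> lin_maps k V W. \<forall>h\<in>H. f h = \<zero>\<^bsub>W\<^esub>}"

definition Q4 :: "'u::grothendieck_universe ring \<Rightarrow> ('u, ('u \<Rightarrow> 'u) set) vfunctor set" where
  "Q4 k = {quotient_functor k (yoneda k V) (\<lambda>W. \<Union>H\<in>\<F>. yoneda_vanishing k V H W) | V \<F>.
             V \<in> vect k \<and> subspace_filter k V \<F> \<and> \<Inter>\<F> = {\<zero>\<^bsub>V\<^esub>}}"

definition Q_free ::
    "'u::grothendieck_universe ring \<Rightarrow> ('u, 'q) vfunctor set \<Rightarrow> ('u, 'a) vfunctor \<Rightarrow> bool" where
  "Q_free k \<Q> X \<longleftrightarrow> (\<forall>Q\<in>\<Q>. nat_transfs k Q X \<subseteq> {\<zero>\<^bsub>nat_module k Q X\<^esub>})"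


section \<open>The internal hom\<close>

text \<open>
  The right adjoint of the tensor product with \<open>X\<close>, in its concrete form: the value at \<open>V\<close> is the
  space of natural transformations from \<open>X\<close> to the functor sending \<open>H\<close> to the value of \<open>Y\<close> at the
  tensor product of \<open>H\<close> and \<open>V\<close>.
\<close>

definition tensor_precomp ::
    "'u::grothendieck_universe ring \<Rightarrow> ('u, 'a) vfunctor \<Rightarrow> ('u, 'u) module \<Rightarrow> ('u, 'a) vfunctor" where
  "tensor_precomp k Y V = \<lparr>
     Ob = (\<lambda>H. Ob Y (tensor k H V)),
     Map = (\<lambda>H H' g. Map Y (tensor k H V) (tensor k H' V) (tensor_map k H H' V V g (id_map V)))\<rparr>"

definition inner_hom ::
    "'u::grothendieck_universe ring \<Rightarrow> ('u, 'a) vfunctor \<Rightarrow> ('u, 'b) vfunctor \<Rightarrow>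
     ('u, ('u, 'u) module \<Rightarrow> 'a \<Rightarrow> 'b) vfunctor" where
  "inner_hom k X Y = \<lparr>
     Ob = (\<lambda>V. nat_module k X (tensor_precomp k Y V)),
     Map = (\<lambda>V W f. \<lambda>\<eta>\<in>nat_transfs k X (tensor_precomp k Y V).
              \<lambda>H\<in>vect k. \<lambda>x\<in>carrier (Ob X H).
                Map Y (tensor k H V) (tensor k H W) (tensor_map k H H V W (id_map H) f) (\<eta> H x))\<rparr>"

end

theory Submission
  imports Defs
begin

text \<open>
  Evaluating a transformation from \<open>Q\<close> to the internal hom at a vector space \<open>H\<close> and an
  element of \<open>X H\<close> gives a transformation from \<open>Q\<close> to \<open>V \<mapsto> Y (H \<otimes> V)\<close>, so it suffices to show that
  the latter functor is free whenever \<open>Y\<close> is. By the Yoneda lemma, freeness of \<open>Y\<close>, for either class,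
  forces an element of \<open>Y V\<close> to vanish as soon as it is killed by all coordinate functions of a basis
  of \<open>V\<close>. A transformation from \<open>Q\<close> to \<open>Y (H \<otimes> -)\<close> composed with the contraction
  \<open>h \<otimes> v \<mapsto> \<phi> h v\<close> is a transformation from \<open>Q\<close> to \<open>Y\<close>, hence zero. As the coordinate functions
  of a product basis of \<open>H \<otimes> V\<close> factor through such contractions, the transformation was zero already.
\<close>

section \<open>Small sets\<close>

text \<open>The coordinate criterion is where the two classes meet. If the coordinates kill
  \<open>y\<close>, the transformation from \<open>yoneda k V\<close> to \<open>Y\<close> given by
  \<open>y\<close> is zero on every map that is nonzero on only finitely many basis vectors, since
  such a map is a finite sum of maps through coordinates. The quotient of \<open>yoneda k V\<close>
  by these maps is isomorphic to the member of \<open>Q3\<close> indexed by the basis, and it is the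
  member of \<open>Q4\<close> for the filter of subspaces containing all but finitely many basis
  vectors. Freeness thus sends the identity of \<open>V\<close> to zero, and its image is
  \<open>y\<close>.

  Contraction happens only on the side of \<open>H\<close> because it must be natural in
  \<open>V\<close>: a fixed functional on \<open>V\<close> does not give a transformation. The
  functional on \<open>V\<close> is applied afterwards, to an element already known to be zero.

  The tensor product is a Hilbert choice, so its existence has to be proved. Bases come from Zorn's
  lemma, and the free space on pairs of basis vectors is coded into \<open>'u\<close>, with codes of
  pairs as indices, because carriers in \<open>vect k\<close> and index sets both live in that
  type.\<close>

lemma small_elts [simp]: "small (elts x)"
  by (simp add: small_def)

lemma smallE:
  assumes "small A" obtains x where "A = elts x"
  using assms by (auto simp: small_def)

lemma small_UN:
  fixes A :: "'u::grothendieck_universe set"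
  assumes "small A" "\<And>i. i \<in> A \<Longrightarrow> small (B i :: 'u set)"
  shows "small (\<Union>i\<in>A. B i)"
proof -
  obtain x where x: "A = elts x" using assms(1) by (rule smallE)
  obtain f where f: "\<And>i. i \<in> A \<Longrightarrow> B i = elts (f i)"
    using assms(2) unfolding small_def image_iff by metis
  obtain u where "elts u = (\<Union>i\<in>elts x. elts (f i))"
    using elts_UNION by blast
  then have "(\<Union>i\<in>A. B i) = elts u" using f x by auto
  then show ?thesis by simp
qed

lemma small_pair: "small {x, y :: 'u::grothendieck_universe}"
proof -
  obtain z where "elts z = {x, y}" using elts_pair by blast
  then show ?thesis by (metis small_elts)
qed

lemma small_image:
  fixes f :: "'u::grothendieck_universe \<Rightarrow> 'u"
  assumes "small A"
  shows "small (f ` A)"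
proof -
  have sing: "small {x}" for x :: 'u using small_pair[of x x] by simp
  have "small (\<Union>i\<in>A. {f i})"
    using assms by (rule small_UN) (simp add: sing)
  moreover have "(\<Union>i\<in>A. {f i}) = f ` A" by auto
  ultimately show ?thesis by simp
qed

text \<open>A set of subsets is not a set of elements of \<open>'u\<close>, so smallness of the
  power set speaks of a set \<open>P\<close> of codes whose extensions are exactly the
  subsets.\<close>

lemma small_Pow:
  fixes A :: "'u::grothendieck_universe set"
  assumes "small A"
  obtains P where "small P" "elts ` P = Pow A"
proof -
  obtain x where x: "A = elts x" using assms by (rule smallE)
  then show thesis using elts_Pow[of x] that small_elts by metis
qed

lemma small_subset:
  fixes A :: "'u::grothendieck_universe set"
  assumes "small A" "B \<subseteq> A"
  shows "small B"
proof -
  obtain P where "small P" "elts ` P = Pow A" using assms(1) by (rule small_Pow)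
  then have "B \<in> elts ` P" using assms(2) by auto
  then show ?thesis by auto
qed

section \<open>Codes in the universe for pairs and functions\<close>

lemma ex_pairing:
  "\<exists>p :: 'u::grothendieck_universe \<Rightarrow> 'u \<Rightarrow> 'u.
     (\<forall>a b c d. p a b = p c d \<longrightarrow> a = c \<and> b = d) \<and>
     (\<forall>A B. small A \<longrightarrow> small B \<longrightarrow> small {p a b | a b. a \<in> A \<and> b \<in> B})"
proof -
  obtain q :: "'u \<Rightarrow> 'u \<Rightarrow> 'u" where q: "\<And>x y. elts (q x y) = {x, y}"
    using elts_pair by metis
  \<comment> \<open>Kuratowski's pair: \<open>q\<close> codes unordered pairs, so
    \<open>p a b\<close> stands for {{a}, {a, b}}.\<close>
  define p where "p = (\<lambda>a b. q (q a a) (q a b))"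
  have qq: "q a b = q c d \<Longrightarrow> {a, b} = {c, d}" for a b c d using q by metis
  have inj: "a = c \<and> b = d" if "p a b = p c d" for a b c d
  proof -
    have "{q a a, q a b} = {q c c, q c d}" using that unfolding p_def by (rule qq)
    then have "q a a = q c c \<and> q a b = q c d \<or> q a a = q c d \<and> q a b = q c c"
      by (simp add: doubleton_eq_iff)
    then have "{a, a} = {c, c} \<and> {a, b} = {c, d} \<or> {a, a} = {c, d} \<and> {a, b} = {c, c}"
      using qq by blast
    then show ?thesis by (smt (verit) insert_iff singletonD)
  qed
  have "small {p a b | a b. a \<in> A \<and> b \<in> B}" if "small A" "small B" for A B
  proof -
    have "small (\<Union>a\<in>A. p a ` B)" using that small_image by (intro small_UN)
    moreover have "(\<Union>a\<in>A. p a ` B) = {p a b | a b. a \<in> A \<and> b \<in> B}" by auto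
    ultimately show ?thesis by simp
  qed
  then show ?thesis using inj by blast
qed

text \<open>A function is coded by its graph, which is a subset of the small set of coded pairs and
  hence has a code in \<open>P\<close>. Members of \<open>A \<rightarrow>\<^sub>E B\<close> agree
  outside \<open>A\<close>, so the graph determines them.\<close>

lemma ex_function_code:
  fixes A B :: "'u::grothendieck_universe set"
  assumes "small A" "small B"
  obtains e :: "('u \<Rightarrow> 'u) \<Rightarrow> 'u" where "inj_on e (A \<rightarrow>\<^sub>E B)" "small (e ` (A \<rightarrow>\<^sub>E B))"
proof -
  obtain p :: "'u \<Rightarrow> 'u \<Rightarrow> 'u"
    where p: "\<And>a b c d. p a b = p c d \<Longrightarrow> a = c \<and> b = d"
      and sp: "\<And>A B. small A \<Longrightarrow> small B \<Longrightarrow> small {p a b | a b. a \<in> A \<and> b \<in> B}"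
    using ex_pairing[where 'u = 'u] by blast
  obtain P where P: "small P" "elts ` P = Pow {p a b | a b. a \<in> A \<and> b \<in> B}"
    using small_Pow[OF sp[OF assms]] by blast
  define G where "G = (\<lambda>f. {p a (f a) | a. a \<in> A})"
  have "\<exists>u\<in>P. elts u = G f" if "f \<in> A \<rightarrow>\<^sub>E B" for f
  proof -
    have "G f \<in> elts ` P" unfolding P(2) G_def using that by auto
    then show ?thesis by auto
  qed
  then obtain e where e: "\<And>f. f \<in> A \<rightarrow>\<^sub>E B \<Longrightarrow> e f \<in> P" "\<And>f. f \<in> A \<rightarrow>\<^sub>E B \<Longrightarrow> elts (e f) = G f"
    by metis
  have "inj_on e (A \<rightarrow>\<^sub>E B)"
  proof (rule inj_onI)
    fix f g assume fg: "f \<in> A \<rightarrow>\<^sub>E B" "g \<in> A \<rightarrow>\<^sub>E B" "e f = e g"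
    then have eq: "G f = G g" using e by metis
    show "f = g"
    proof (rule PiE_ext[OF fg(1,2)])
      fix a assume "a \<in> A"
      then have "p a (f a) \<in> G g" unfolding eq[symmetric] by (auto simp: G_def)
      then show "f a = g a" unfolding G_def using p by blast
    qed
  qed
  moreover have "small (e ` (A \<rightarrow>\<^sub>E B))"
    using P(1) e(1) by (auto intro: small_subset)
  ultimately show thesis by (rule that)
qed


section \<open>Modules and linear maps\<close>

lemma mk_module_simps [simp]:
  "carrier (mk_module C a z s) = C" "add (mk_module C a z s) = a"
  "zero (mk_module C a z s) = z" "smult (mk_module C a z s) = s"
  by (simp_all add: mk_module_def)

lemma linear_mapI:
  assumes "\<And>x. x \<in> carrier M \<Longrightarrow> f x \<in> carrier N"
    and "\<And>x y. x \<in> carrier M \<Longrightarrow> y \<in> carrier M \<Longrightarrow> f (x \<oplus>\<^bsub>M\<^esub> y) = f x \<oplus>\<^bsub>N\<^esub> f y"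
    and "\<And>a x. a \<in> carrier k \<Longrightarrow> x \<in> carrier M \<Longrightarrow> f (a \<odot>\<^bsub>M\<^esub> x) = a \<odot>\<^bsub>N\<^esub> f x"
  shows "linear_map k M N f"
  using assms by (auto simp: linear_map_def)

lemma linear_mapD:
  assumes "linear_map k M N f"
  shows "x \<in> carrier M \<Longrightarrow> f x \<in> carrier N"
    and "x \<in> carrier M \<Longrightarrow> y \<in> carrier M \<Longrightarrow> f (x \<oplus>\<^bsub>M\<^esub> y) = f x \<oplus>\<^bsub>N\<^esub> f y"
    and "a \<in> carrier k \<Longrightarrow> x \<in> carrier M \<Longrightarrow> f (a \<odot>\<^bsub>M\<^esub> x) = a \<odot>\<^bsub>N\<^esub> f x"
  using assms by (auto simp: linear_map_def)

lemma linear_map_zero: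
  assumes "module k M" "module k N" "linear_map k M N f"
  shows "f \<zero>\<^bsub>M\<^esub> = \<zero>\<^bsub>N\<^esub>"
proof -
  interpret M: module k M by fact
  interpret N: module k N by fact
  have "f (\<zero>\<^bsub>k\<^esub> \<odot>\<^bsub>M\<^esub> \<zero>\<^bsub>M\<^esub>) = \<zero>\<^bsub>k\<^esub> \<odot>\<^bsub>N\<^esub> f \<zero>\<^bsub>M\<^esub>"
    by (rule linear_mapD(3)[OF assms(3)]) auto
  then show ?thesis using linear_mapD(1)[OF assms(3)] by simp
qed

lemma linear_map_compose:
  assumes "linear_map k M N f" "linear_map k N P g"
  shows "linear_map k M P (\<lambda>x. g (f x))"
  using linear_mapD[OF assms(1)] linear_mapD[OF assms(2)] by (auto intro!: linear_mapI)

lemma linear_map_cong: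
  assumes "module k M" "\<And>x. x \<in> carrier M \<Longrightarrow> f x = g x"
  shows "linear_map k M N f = linear_map k M N g"
proof -
  interpret M: module k M by fact
  have "linear_map k M N f" if "linear_map k M N g" "\<And>x. x \<in> carrier M \<Longrightarrow> f x = g x" for f g
    using linear_mapD[OF that(1)] that(2) by (auto intro!: linear_mapI)
  then show ?thesis using assms(2) by metis
qed

lemma lin_mapsI:
  assumes "module k M" "linear_map k M N f"
  shows "(\<lambda>x\<in>carrier M. f x) \<in> lin_maps k M N"
  using assms linear_map_cong[OF assms(1), of "\<lambda>x\<in>carrier M. f x" f] by (simp add: lin_maps_def)

lemma lin_mapsD:
  assumes "f \<in> lin_maps k M N"
  shows "linear_map k M N f" "f \<in> extensional (carrier M)"
  using assms by (auto simp: lin_maps_def)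

lemma lin_maps_eqI:
  assumes "f \<in> lin_maps k M N" "g \<in> lin_maps k M N" "\<And>x. x \<in> carrier M \<Longrightarrow> f x = g x"
  shows "f = g"
  using assms by (auto simp: lin_maps_def intro: extensionalityI)

lemma lin_maps_compose:
  assumes "module k M" "f \<in> lin_maps k M N" "g \<in> lin_maps k N P"
  shows "compose (carrier M) g f \<in> lin_maps k M P"
  unfolding compose_def
  by (rule lin_mapsI[OF assms(1)]) (use assms linear_map_compose in \<open>blast dest: lin_mapsD\<close>)

lemma id_map_lin: "module k M \<Longrightarrow> id_map M \<in> lin_maps k M M"
  unfolding id_map_def by (rule lin_mapsI) (auto intro: linear_mapI)

lemma submodule_closed:
  assumes "module k M" "submodule S k M"
  shows "S \<subseteq> carrier M" "\<zero>\<^bsub>M\<^esub> \<in> S"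
    "x \<in> S \<Longrightarrow> y \<in> S \<Longrightarrow> x \<oplus>\<^bsub>M\<^esub> y \<in> S" "x \<in> S \<Longrightarrow> y \<in> S \<Longrightarrow> x \<ominus>\<^bsub>M\<^esub> y \<in> S"
    "a \<in> carrier k \<Longrightarrow> x \<in> S \<Longrightarrow> a \<odot>\<^bsub>M\<^esub> x \<in> S"
proof -
  interpret M: module k M by fact
  show "S \<subseteq> carrier M" using M.submoduleE(1)[OF assms(2)] .
  show "\<zero>\<^bsub>M\<^esub> \<in> S" using subgroup.one_closed[OF submodule.axioms(1)[OF assms(2)]] by simp
  show "x \<in> S \<Longrightarrow> y \<in> S \<Longrightarrow> x \<oplus>\<^bsub>M\<^esub> y \<in> S" using M.submoduleE(5)[OF assms(2)] .
  show "x \<in> S \<Longrightarrow> y \<in> S \<Longrightarrow> x \<ominus>\<^bsub>M\<^esub> y \<in> S"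
    using M.submoduleE(5,6)[OF assms(2)] by (simp add: a_minus_def)
  show "a \<in> carrier k \<Longrightarrow> x \<in> S \<Longrightarrow> a \<odot>\<^bsub>M\<^esub> x \<in> S" using M.submoduleE(4)[OF assms(2)] .
qed

text \<open>Closure under negatives is derived, the negative of \<open>x\<close> being (-1) times
  \<open>x\<close>.\<close>

lemma submodule_intro:
  assumes "module k M" "S \<subseteq> carrier M" "\<zero>\<^bsub>M\<^esub> \<in> S"
    "\<And>x y. x \<in> S \<Longrightarrow> y \<in> S \<Longrightarrow> x \<oplus>\<^bsub>M\<^esub> y \<in> S"
    "\<And>a x. a \<in> carrier k \<Longrightarrow> x \<in> S \<Longrightarrow> a \<odot>\<^bsub>M\<^esub> x \<in> S"
  shows "submodule S k M"
proof -
  interpret M: module k M by fact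
  have "\<ominus>\<^bsub>M\<^esub> x \<in> S" if "x \<in> S" for x
  proof -
    have x: "x \<in> carrier M" using that assms(2) by auto
    have "\<ominus>\<^bsub>M\<^esub> x = (\<ominus>\<^bsub>k\<^esub> \<one>\<^bsub>k\<^esub>) \<odot>\<^bsub>M\<^esub> x" using M.smult_l_minus[OF _ x, of "\<one>\<^bsub>k\<^esub>"] x by simp
    then show ?thesis using assms(5)[OF _ that] by simp
  qed
  then show ?thesis using assms by (intro M.submoduleI)
qed

section \<open>Modules assembled from explicit operations, and spaces of linear maps\<close>

text \<open>Additive inverses are replaced by the law that zero times \<open>x\<close> is
  \<open>z\<close>: distributivity then makes (-1) times \<open>x\<close> an inverse. This suits
  pointwise operations, where each listed law reduces to a law of the target.\<close>

lemma mk_module_module: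
  assumes "cring k"
    and "\<And>x y. x \<in> C \<Longrightarrow> y \<in> C \<Longrightarrow> pl x y \<in> C" "z \<in> C"
    and "\<And>a x. a \<in> carrier k \<Longrightarrow> x \<in> C \<Longrightarrow> sm a x \<in> C"
    and "\<And>x y w. x \<in> C \<Longrightarrow> y \<in> C \<Longrightarrow> w \<in> C \<Longrightarrow> pl (pl x y) w = pl x (pl y w)"
    and "\<And>x y. x \<in> C \<Longrightarrow> y \<in> C \<Longrightarrow> pl x y = pl y x"
    and "\<And>x. x \<in> C \<Longrightarrow> pl z x = x"
    and "\<And>x. x \<in> C \<Longrightarrow> sm \<zero>\<^bsub>k\<^esub> x = z"
    and l: "\<And>a b x. a \<in> carrier k \<Longrightarrow> b \<in> carrier k \<Longrightarrow> x \<in> C \<Longrightarrow>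
        sm (a \<oplus>\<^bsub>k\<^esub> b) x = pl (sm a x) (sm b x)"
    and "\<And>a x y. a \<in> carrier k \<Longrightarrow> x \<in> C \<Longrightarrow> y \<in> C \<Longrightarrow> sm a (pl x y) = pl (sm a x) (sm a y)"
    and "\<And>a b x. a \<in> carrier k \<Longrightarrow> b \<in> carrier k \<Longrightarrow> x \<in> C \<Longrightarrow> sm (a \<otimes>\<^bsub>k\<^esub> b) x = sm a (sm b x)"
    and one: "\<And>x. x \<in> C \<Longrightarrow> sm \<one>\<^bsub>k\<^esub> x = x"
  shows "module k (mk_module C pl z sm)"
proof -
  interpret k: cring k by fact
  have inv: "\<exists>y\<in>C. pl y x = z" if "x \<in> C" for x
  proof (rule bexI)
    have "pl (sm (\<ominus>\<^bsub>k\<^esub> \<one>\<^bsub>k\<^esub>) x) (sm \<one>\<^bsub>k\<^esub> x) = sm \<zero>\<^bsub>k\<^esub> x"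
      using l[of "\<ominus>\<^bsub>k\<^esub> \<one>\<^bsub>k\<^esub>" "\<one>\<^bsub>k\<^esub>" x] that k.l_neg by simp
    then show "pl (sm (\<ominus>\<^bsub>k\<^esub> \<one>\<^bsub>k\<^esub>) x) x = z" using that one assms(8) by simp
    show "sm (\<ominus>\<^bsub>k\<^esub> \<one>\<^bsub>k\<^esub>) x \<in> C" using that assms(4) by simp
  qed
  show ?thesis
    by (intro moduleI abelian_groupI) (use assms inv in simp_all)
qed

lemma hom_module_simps [simp]:
  "carrier (hom_module k M N) = lin_maps k M N"
  "f \<oplus>\<^bsub>hom_module k M N\<^esub> g = (\<lambda>x\<in>carrier M. f x \<oplus>\<^bsub>N\<^esub> g x)"
  "\<zero>\<^bsub>hom_module k M N\<^esub> = (\<lambda>x\<in>carrier M. \<zero>\<^bsub>N\<^esub>)"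
  "a \<odot>\<^bsub>hom_module k M N\<^esub> f = (\<lambda>x\<in>carrier M. a \<odot>\<^bsub>N\<^esub> f x)"
  by (simp_all add: hom_module_def)

lemma linear_map_add:
  assumes "module k N" "linear_map k M N f" "linear_map k M N g"
  shows "linear_map k M N (\<lambda>x. f x \<oplus>\<^bsub>N\<^esub> g x)"
proof -
  interpret N: module k N by fact
  note f = linear_mapD[OF assms(2)] and g = linear_mapD[OF assms(3)]
  show ?thesis
    by (rule linear_mapI) (use f g in \<open>auto simp: N.smult_r_distr N.a_ac\<close>)
qed

lemma linear_map_smult:
  assumes "module k N" "linear_map k M N f" "a \<in> carrier k"
  shows "linear_map k M N (\<lambda>x. a \<odot>\<^bsub>N\<^esub> f x)"
proof -
  interpret N: module k N by fact
  note f = linear_mapD[OF assms(2)]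
  have "a \<odot>\<^bsub>N\<^esub> (b \<odot>\<^bsub>N\<^esub> f x) = b \<odot>\<^bsub>N\<^esub> (a \<odot>\<^bsub>N\<^esub> f x)" if "b \<in> carrier k" "x \<in> carrier M" for b x
    using that f assms(3) N.smult_assoc1[symmetric] by (simp add: N.R.m_comm)
  then show ?thesis
    by (intro linear_mapI) (use f assms(3) in \<open>auto simp: N.smult_r_distr\<close>)
qed

lemma linear_map_const_zero: "module k N \<Longrightarrow> linear_map k M N (\<lambda>x. \<zero>\<^bsub>N\<^esub>)"
proof -
  assume "module k N"
  then interpret N: module k N .
  show ?thesis by (rule linear_mapI) auto
qed

lemma hom_module_module:
  assumes "module k M" "module k N"
  shows "module k (hom_module k M N)"
proof -
  interpret M: module k M by fact
  interpret N: module k N by fact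
  have D: "f x \<in> carrier N" if "f \<in> lin_maps k M N" "x \<in> carrier M" for f x
    using that linear_mapD(1)[OF lin_mapsD(1)] by fast
  have U: "f x = undefined" if "f \<in> lin_maps k M N" "x \<notin> carrier M" for f x
    using that by (auto simp: lin_maps_def extensional_def)
  show ?thesis
    unfolding hom_module_def
    apply (rule mk_module_module)
    subgoal using module.axioms(1)[OF assms(1)] .
    subgoal by (intro lin_mapsI linear_map_add assms lin_mapsD)
    subgoal by (intro lin_mapsI linear_map_const_zero assms)
    subgoal by (intro lin_mapsI linear_map_smult assms lin_mapsD)
    by (simp_all add: fun_eq_iff D U N.a_ac N.smult_r_distr N.smult_l_distr N.smult_assoc1)
qed

lemma lin_maps_add:
  assumes "module k M" "module k N" "f \<in> lin_maps k M N" "g \<in> lin_maps k M N"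
  shows "(\<lambda>x\<in>carrier M. f x \<oplus>\<^bsub>N\<^esub> g x) \<in> lin_maps k M N"
  by (intro lin_mapsI linear_map_add lin_mapsD assms)

lemma lin_maps_smult:
  assumes "module k M" "module k N" "f \<in> lin_maps k M N" "a \<in> carrier k"
  shows "(\<lambda>x\<in>carrier M. a \<odot>\<^bsub>N\<^esub> f x) \<in> lin_maps k M N"
  by (intro lin_mapsI linear_map_smult lin_mapsD assms)


section \<open>Bases\<close>

lemma self_module_simps [simp]:
  "carrier (self_module k) = carrier k" "add (self_module k) = add k"
  "zero (self_module k) = zero k" "smult (self_module k) = mult k"
  by (simp_all add: self_module_def)

lemma self_module_module: "cring k \<Longrightarrow> module k (self_module k)"
proof -
  assume "cring k"
  then interpret k: cring k .
  show ?thesis unfolding self_module_def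
    by (rule mk_module_module)
      (simp_all add: k.is_cring k.a_ac k.m_assoc k.l_distr k.r_distr)
qed

text \<open>A basis is recorded together with its dual family. Finite supports and separation of
  points stand in for the spanning condition, so that linear extension is a finite sum over nonzero
  coordinates; spanning is recovered in \<open>vbasis_induct\<close>. The index type is left free
  because indices will be vectors, codes and pairs.\<close>

definition vbasis ::
    "'u ring \<Rightarrow> ('u, 'a) module \<Rightarrow> 'i set \<Rightarrow> ('i \<Rightarrow> 'a) \<Rightarrow> ('i \<Rightarrow> 'a \<Rightarrow> 'u) \<Rightarrow> bool" where
  "vbasis k V I g \<chi> \<longleftrightarrow>
     g \<in> I \<rightarrow> carrier V \<and>
     (\<forall>i\<in>I. \<chi> i \<in> lin_maps k V (self_module k)) \<and>
     (\<forall>i\<in>I. \<forall>j\<in>I. \<chi> i (g j) = (if i = j then \<one>\<^bsub>k\<^esub> else \<zero>\<^bsub>k\<^esub>)) \<and>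
     (\<forall>v\<in>carrier V. finite {i\<in>I. \<chi> i v \<noteq> \<zero>\<^bsub>k\<^esub>}) \<and>
     (\<forall>v\<in>carrier V. (\<forall>i\<in>I. \<chi> i v = \<zero>\<^bsub>k\<^esub>) \<longrightarrow> v = \<zero>\<^bsub>V\<^esub>)"

lemma vbasisD:
  assumes "vbasis k V I g \<chi>"
  shows "i \<in> I \<Longrightarrow> g i \<in> carrier V"
    and "i \<in> I \<Longrightarrow> \<chi> i \<in> lin_maps k V (self_module k)"
    and "i \<in> I \<Longrightarrow> linear_map k V (self_module k) (\<chi> i)"
    and "i \<in> I \<Longrightarrow> v \<in> carrier V \<Longrightarrow> \<chi> i v \<in> carrier k"
    and "i \<in> I \<Longrightarrow> j \<in> I \<Longrightarrow> \<chi> i (g j) = (if i = j then \<one>\<^bsub>k\<^esub> else \<zero>\<^bsub>k\<^esub>)"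
    and "v \<in> carrier V \<Longrightarrow> finite {i\<in>I. \<chi> i v \<noteq> \<zero>\<^bsub>k\<^esub>}"
    and "v \<in> carrier V \<Longrightarrow> (\<And>i. i \<in> I \<Longrightarrow> \<chi> i v = \<zero>\<^bsub>k\<^esub>) \<Longrightarrow> v = \<zero>\<^bsub>V\<^esub>"
proof -
  show l: "linear_map k V (self_module k) (\<chi> i)" if "i \<in> I" for i
    using assms that by (auto simp: vbasis_def intro: lin_mapsD)
  show "i \<in> I \<Longrightarrow> v \<in> carrier V \<Longrightarrow> \<chi> i v \<in> carrier k"
    using linear_mapD(1)[OF l] by simp
qed (use assms in \<open>auto simp: vbasis_def\<close>)

text \<open>Turns agreement of two linear maps on generators into agreement everywhere: a submodule
  containing the generators is the whole space.\<close>

lemma equalizer_submodule: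
  assumes "module k V" "module k Z" "linear_map k V Z f" "linear_map k V Z f'"
  shows "submodule {v \<in> carrier V. f v = f' v} k V"
proof -
  interpret V: module k V by fact
  show ?thesis
    by (rule submodule_intro)
      (use assms linear_mapD[OF assms(3)] linear_mapD[OF assms(4)] in \<open>auto simp: linear_map_zero\<close>)
qed

text \<open>Two summands lie in a common member, so their sum does too. This serves for spans along
  a chain and for maps vanishing on some member of a filter.\<close>

lemma directed_Union_submodule:
  assumes "module k V" "\<S> \<noteq> {}" "\<And>S. S \<in> \<S> \<Longrightarrow> submodule S k V"
    and "\<And>S T. S \<in> \<S> \<Longrightarrow> T \<in> \<S> \<Longrightarrow> \<exists>U\<in>\<S>. S \<subseteq> U \<and> T \<subseteq> U"
  shows "submodule (\<Union>\<S>) k V"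
proof (rule submodule_intro)
  fix x y assume "x \<in> \<Union>\<S>" "y \<in> \<Union>\<S>"
  then obtain S T where "S \<in> \<S>" "T \<in> \<S>" "x \<in> S" "y \<in> T" by auto
  moreover then obtain U where "U \<in> \<S>" "S \<subseteq> U" "T \<subseteq> U" using assms(4) by meson
  ultimately show "x \<oplus>\<^bsub>V\<^esub> y \<in> \<Union>\<S>"
    using submodule_closed(3)[OF assms(1) assms(3)] by blast
qed (use assms submodule_closed in \<open>fast+\<close>)

text \<open>
  Linear extension is stated without assuming that the coordinates separate points, since that
  property is derived from it below.
\<close>

lemma combination_linear:
  assumes "module k V" "module k Z" "w \<in> I \<rightarrow> carrier Z"
    and lin: "\<And>i. i \<in> I \<Longrightarrow> linear_map k V (self_module k) (\<chi> i)"
    and fin: "\<And>v. v \<in> carrier V \<Longrightarrow> finite {i\<in>I. \<chi> i v \<noteq> \<zero>\<^bsub>k\<^esub>}"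
  shows "linear_map k V Z (\<lambda>v. \<Oplus>\<^bsub>Z\<^esub>i\<in>{i\<in>I. \<chi> i v \<noteq> \<zero>\<^bsub>k\<^esub>}. \<chi> i v \<odot>\<^bsub>Z\<^esub> w i)"
    (is "linear_map k V Z ?f")
proof -
  interpret V: module k V by fact
  interpret Z: module k Z by fact
  have kc: "\<chi> i v \<in> carrier k" if "i \<in> I" "v \<in> carrier V" for i v
    using linear_mapD(1)[OF lin[OF that(1)] that(2)] by simp
  have wc: "w i \<in> carrier Z" if "i \<in> I" for i using that assms(3) by auto
  \<comment> \<open>The index set of the sum depends on \<open>v\<close>. Any finite set containing
    the support gives the same sum, so different arguments can be compared over a common
    \<open>J\<close>.\<close>
  have eq: "?f v = (\<Oplus>\<^bsub>Z\<^esub>i\<in>J. \<chi> i v \<odot>\<^bsub>Z\<^esub> w i)"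
    if "v \<in> carrier V" "finite J" "J \<subseteq> I" "{i\<in>I. \<chi> i v \<noteq> \<zero>\<^bsub>k\<^esub>} \<subseteq> J" for v J
    using that by (intro Z.add.finprod_mono_neutral_cong_left) (auto simp: kc wc subset_iff)
  show ?thesis
  proof (rule linear_mapI)
    show "?f v \<in> carrier Z" if "v \<in> carrier V" for v
      using that by (intro Z.finsum_closed) (auto simp: kc wc)
  next
    fix x y assume xy: "x \<in> carrier V" "y \<in> carrier V"
    let ?S = "\<lambda>v. {i\<in>I. \<chi> i v \<noteq> \<zero>\<^bsub>k\<^esub>}"
    let ?J = "?S x \<union> ?S y \<union> ?S (x \<oplus>\<^bsub>V\<^esub> y)"
    have J: "finite ?J" "?J \<subseteq> I" using fin xy by auto
    have "?f (x \<oplus>\<^bsub>V\<^esub> y) = (\<Oplus>\<^bsub>Z\<^esub>i\<in>?J. \<chi> i (x \<oplus>\<^bsub>V\<^esub> y) \<odot>\<^bsub>Z\<^esub> w i)"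
      using xy J by (intro eq) auto
    also have "\<dots> = (\<Oplus>\<^bsub>Z\<^esub>i\<in>?J. \<chi> i x \<odot>\<^bsub>Z\<^esub> w i \<oplus>\<^bsub>Z\<^esub> \<chi> i y \<odot>\<^bsub>Z\<^esub> w i)"
    proof (intro Z.finsum_cong' refl)
      fix i assume "i \<in> ?J"
      then have i: "i \<in> I" by auto
      show "\<chi> i (x \<oplus>\<^bsub>V\<^esub> y) \<odot>\<^bsub>Z\<^esub> w i = \<chi> i x \<odot>\<^bsub>Z\<^esub> w i \<oplus>\<^bsub>Z\<^esub> \<chi> i y \<odot>\<^bsub>Z\<^esub> w i"
        using linear_mapD(2)[OF lin[OF i] xy] kc[OF i] wc[OF i] xy by (simp add: Z.smult_l_distr)
    qed (auto simp: kc wc xy)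
    also have "\<dots> = (\<Oplus>\<^bsub>Z\<^esub>i\<in>?J. \<chi> i x \<odot>\<^bsub>Z\<^esub> w i) \<oplus>\<^bsub>Z\<^esub> (\<Oplus>\<^bsub>Z\<^esub>i\<in>?J. \<chi> i y \<odot>\<^bsub>Z\<^esub> w i)"
      by (intro Z.finsum_addf) (auto simp: kc wc xy)
    also have "\<dots> = ?f x \<oplus>\<^bsub>Z\<^esub> ?f y"
    proof -
      have "?S x \<subseteq> ?J" "?S y \<subseteq> ?J" by auto
      then show ?thesis by (simp only: eq[OF xy(1) J] eq[OF xy(2) J])
    qed
    finally show "?f (x \<oplus>\<^bsub>V\<^esub> y) = ?f x \<oplus>\<^bsub>Z\<^esub> ?f y" .
  next
    fix a x assume a: "a \<in> carrier k" and x: "x \<in> carrier V"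
    let ?S = "\<lambda>v. {i\<in>I. \<chi> i v \<noteq> \<zero>\<^bsub>k\<^esub>}"
    let ?J = "?S x \<union> ?S (a \<odot>\<^bsub>V\<^esub> x)"
    have J: "finite ?J" "?J \<subseteq> I" using fin x a by auto
    have "?f (a \<odot>\<^bsub>V\<^esub> x) = (\<Oplus>\<^bsub>Z\<^esub>i\<in>?J. \<chi> i (a \<odot>\<^bsub>V\<^esub> x) \<odot>\<^bsub>Z\<^esub> w i)"
      using x a J by (intro eq) auto
    also have "\<dots> = (\<Oplus>\<^bsub>Z\<^esub>i\<in>?J. a \<odot>\<^bsub>Z\<^esub> (\<chi> i x \<odot>\<^bsub>Z\<^esub> w i))"
    proof (intro Z.finsum_cong' refl)
      fix i assume "i \<in> ?J"
      then have i: "i \<in> I" by auto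
      show "\<chi> i (a \<odot>\<^bsub>V\<^esub> x) \<odot>\<^bsub>Z\<^esub> w i = a \<odot>\<^bsub>Z\<^esub> (\<chi> i x \<odot>\<^bsub>Z\<^esub> w i)"
        using linear_mapD(3)[OF lin[OF i] a x] kc[OF i] wc[OF i] x a by (simp add: Z.smult_assoc1)
    qed (auto simp: kc wc x a)
    also have "\<dots> = a \<odot>\<^bsub>Z\<^esub> (\<Oplus>\<^bsub>Z\<^esub>i\<in>?J. \<chi> i x \<odot>\<^bsub>Z\<^esub> w i)"
      using J a by (intro Z.finsum_smult_ldistr[symmetric]) (auto simp: kc wc x)
    also have "\<dots> = a \<odot>\<^bsub>Z\<^esub> ?f x"
    proof -
      have "?S x \<subseteq> ?J" by auto
      then show ?thesis by (simp only: eq[OF x J])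
    qed
    finally show "?f (a \<odot>\<^bsub>V\<^esub> x) = a \<odot>\<^bsub>Z\<^esub> ?f x" .
  qed
qed

lemma combination_basis:
  assumes "module k Z" "w \<in> I \<rightarrow> carrier Z" "j \<in> I"
    and "\<And>i. i \<in> I \<Longrightarrow> \<chi> i v = (if i = j then \<one>\<^bsub>k\<^esub> else \<zero>\<^bsub>k\<^esub>)"
  shows "(\<Oplus>\<^bsub>Z\<^esub>i\<in>{i\<in>I. \<chi> i v \<noteq> \<zero>\<^bsub>k\<^esub>}. \<chi> i v \<odot>\<^bsub>Z\<^esub> w i) = w j"
proof -
  interpret Z: module k Z by fact
  have wj: "w j \<in> carrier Z" using assms(2,3) by auto
  \<comment> \<open>If one equals zero in \<open>k\<close>, the support of \<open>v\<close> is empty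
    and misses \<open>j\<close>; the equation survives because \<open>w j\<close> is then
    zero.\<close>
  have triv: "w j = \<zero>\<^bsub>Z\<^esub>" if "\<one>\<^bsub>k\<^esub> = \<zero>\<^bsub>k\<^esub>"
    using that Z.smult_one[OF wj] Z.smult_l_null[OF wj] by simp
  have "(\<Oplus>\<^bsub>Z\<^esub>i\<in>{i\<in>I. \<chi> i v \<noteq> \<zero>\<^bsub>k\<^esub>}. \<chi> i v \<odot>\<^bsub>Z\<^esub> w i) = (\<Oplus>\<^bsub>Z\<^esub>i\<in>{j}. \<chi> i v \<odot>\<^bsub>Z\<^esub> w i)"
    using assms(3,4) wj triv by (intro Z.add.finprod_mono_neutral_cong_left) (auto split: if_splits)
  also have "\<dots> = w j" using assms(3,4) wj by simp
  finally show ?thesis .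
qed

text \<open>The spanning property. Subtracting \<chi>_j(v) times \<open>g j\<close> from
  \<open>v\<close> clears coordinate \<open>j\<close> and leaves the others unchanged, so after
  finitely many steps all coordinates vanish, and separation of points says that what remains is
  zero.\<close>

lemma vbasis_induct:
  assumes V: "module k V" and b: "vbasis k V I g \<chi>" and P: "submodule P k V"
    and gP: "\<And>i. i \<in> I \<Longrightarrow> g i \<in> P"
  shows "carrier V \<subseteq> P"
proof -
  interpret V: module k V by fact
  note D = vbasisD[OF b] and PC = submodule_closed[OF V P]
  have "v \<in> P" if "finite J" "v \<in> carrier V" "{i\<in>I. \<chi> i v \<noteq> \<zero>\<^bsub>k\<^esub>} \<subseteq> J" for J v
    using that
  proof (induction J arbitrary: v rule: finite_induct)
    case empty
    then have "v = \<zero>\<^bsub>V\<^esub>" using D(7) by auto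
    then show ?case using PC by simp
  next
    case (insert j J)
    show ?case
    proof (cases "j \<in> I")
      case False
      then have "{i \<in> I. \<chi> i v \<noteq> \<zero>\<^bsub>k\<^esub>} \<subseteq> J" using insert.prems by auto
      then show ?thesis using insert by blast
    next
      case j: True
      define u where "u = \<chi> j v \<odot>\<^bsub>V\<^esub> g j"
      have c: "\<chi> j v \<in> carrier k" "u \<in> carrier V" "u \<in> P"
        using D(1,4)[OF j] insert.prems PC(5) gP[OF j] by (auto simp: u_def)
      have mu: "\<ominus>\<^bsub>V\<^esub> u = (\<ominus>\<^bsub>k\<^esub> \<chi> j v) \<odot>\<^bsub>V\<^esub> g j"
        using V.smult_l_minus[OF c(1) D(1)[OF j]] by (simp add: u_def)
      have "\<chi> i (v \<ominus>\<^bsub>V\<^esub> u) = \<chi> i v \<oplus>\<^bsub>k\<^esub> (\<ominus>\<^bsub>k\<^esub> \<chi> j v) \<otimes>\<^bsub>k\<^esub> \<chi> i (g j)" if "i \<in> I" for i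
        unfolding a_minus_def mu
        using linear_mapD(2,3)[OF D(3)[OF that]] c D(1)[OF j] insert.prems by simp
      then have "\<chi> i (v \<ominus>\<^bsub>V\<^esub> u) = (if i = j then \<zero>\<^bsub>k\<^esub> else \<chi> i v)" if "i \<in> I" for i
        using that D(4)[OF that insert.prems(1)] D(5)[OF that j] V.R.r_neg c(1) by simp
      then have "{i\<in>I. \<chi> i (v \<ominus>\<^bsub>V\<^esub> u) \<noteq> \<zero>\<^bsub>k\<^esub>} \<subseteq> J" using insert.prems(2) by (auto split: if_splits)
      then have "v \<ominus>\<^bsub>V\<^esub> u \<in> P" using insert.prems(1) c by (intro insert.IH) auto
      then have "(v \<ominus>\<^bsub>V\<^esub> u) \<oplus>\<^bsub>V\<^esub> u \<in> P" using c PC(3) by blast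
      moreover have "(v \<ominus>\<^bsub>V\<^esub> u) \<oplus>\<^bsub>V\<^esub> u = v"
        using insert.prems(1) c by (simp add: a_minus_def V.a_assoc V.l_neg)
      ultimately show ?thesis by simp
    qed
  qed
  then show ?thesis using D(6) by blast
qed

lemma vbasis_unique:
  assumes "module k V" "module k Z" "vbasis k V I g \<chi>" "linear_map k V Z f" "linear_map k V Z f'"
    and "\<And>i. i \<in> I \<Longrightarrow> f (g i) = f' (g i)" and "v \<in> carrier V"
  shows "f v = f' v"
  using vbasis_induct[OF assms(1,3) equalizer_submodule[OF assms(1,2,4,5)]] assms(6,7)
    vbasisD(1)[OF assms(3)] by blast

lemma vbasis_extend:
  assumes "module k V" "module k Z" "vbasis k V I g \<chi>" "\<And>i. i \<in> I \<Longrightarrow> w i \<in> carrier Z"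
  shows "\<exists>f\<in>lin_maps k V Z. \<forall>i\<in>I. f (g i) = w i"
proof -
  note D = vbasisD[OF assms(3)]
  let ?f = "\<lambda>v. \<Oplus>\<^bsub>Z\<^esub>i\<in>{i\<in>I. \<chi> i v \<noteq> \<zero>\<^bsub>k\<^esub>}. \<chi> i v \<odot>\<^bsub>Z\<^esub> w i"
  have w: "w \<in> I \<rightarrow> carrier Z" using assms(4) by auto
  have "(\<lambda>v\<in>carrier V. ?f v) \<in> lin_maps k V Z"
    using D by (intro lin_mapsI combination_linear assms(1,2) w) auto
  moreover have "?f (g j) = w j" if "j \<in> I" for j
    using D(5)[OF _ that] by (intro combination_basis[OF assms(2) w that]) auto
  ultimately show ?thesis using D(1) by (intro bexI[of _ "\<lambda>v\<in>carrier V. ?f v"]) auto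
qed

text \<open>Carries a basis indexed by codes of pairs over to the pairs themselves.\<close>

lemma vbasis_reindex:
  assumes h: "bij_betw h J I" and b: "vbasis k V I g \<chi>"
  shows "vbasis k V J (\<lambda>j. g (h j)) (\<lambda>j. \<chi> (h j))"
proof -
  note D = vbasisD[OF b]
  have hI: "h j \<in> I" if "j \<in> J" for j using h that by (auto simp: bij_betw_def)
  have inj: "inj_on h J" and I: "h ` J = I" using h by (auto simp: bij_betw_def)
  have "finite {j\<in>J. \<chi> (h j) v \<noteq> \<zero>\<^bsub>k\<^esub>}" if "v \<in> carrier V" for v
  proof (rule finite_imageD[of h])
    show "finite (h ` {j\<in>J. \<chi> (h j) v \<noteq> \<zero>\<^bsub>k\<^esub>})"
      using hI by (intro finite_subset[OF _ D(6)[OF that]]) auto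
    show "inj_on h {j\<in>J. \<chi> (h j) v \<noteq> \<zero>\<^bsub>k\<^esub>}" using inj by (rule inj_on_subset) auto
  qed
  moreover have "v = \<zero>\<^bsub>V\<^esub>" if "v \<in> carrier V" "\<forall>j\<in>J. \<chi> (h j) v = \<zero>\<^bsub>k\<^esub>" for v
    using D(7)[OF that(1)] that(2) I by auto
  ultimately show ?thesis
    using D(1,2,5) hI inj by (auto simp: vbasis_def inj_on_eq_iff)
qed

section \<open>Spans, independence and the existence of bases\<close>

definition vspan :: "'u ring \<Rightarrow> ('u, 'a) module \<Rightarrow> 'a set \<Rightarrow> 'a set" where
  "vspan k V B = \<Inter>{P. submodule P k V \<and> B \<subseteq> P}"

lemma vspan_superset: "B \<subseteq> vspan k V B"
  by (auto simp: vspan_def)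

lemma vspan_minimal: "submodule P k V \<Longrightarrow> B \<subseteq> P \<Longrightarrow> vspan k V B \<subseteq> P"
  by (auto simp: vspan_def)

lemma vspan_mono: "B \<subseteq> B' \<Longrightarrow> vspan k V B \<subseteq> vspan k V B'"
  by (auto simp: vspan_def)

lemma vspan_submodule:
  assumes "module k V" "B \<subseteq> carrier V"
  shows "submodule (vspan k V B) k V"
proof (rule submodule_intro[OF assms(1)])
  have "submodule (carrier V) k V" using module.carrier_is_submodule[OF assms(1)] .
  then show "vspan k V B \<subseteq> carrier V" using assms(2) by (rule vspan_minimal)
qed (use submodule_closed[OF assms(1)] in \<open>auto simp: vspan_def\<close>)

text \<open>The span is an intersection rather than a set of combinations, so the decomposition
  comes from minimality: the sums of an element of the old span and a multiple of \<open>v\<close>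
  already form a submodule containing \<open>v\<close> and \<open>B\<close>.\<close>

lemma vspan_insert:
  assumes V: "module k V" "B \<subseteq> carrier V" "v \<in> carrier V" and x: "x \<in> vspan k V (insert v B)"
  obtains p c where "p \<in> vspan k V B" "c \<in> carrier k" "x = p \<oplus>\<^bsub>V\<^esub> c \<odot>\<^bsub>V\<^esub> v"
proof -
  interpret V: module k V by fact
  let ?P = "{p \<oplus>\<^bsub>V\<^esub> c \<odot>\<^bsub>V\<^esub> v | p c. p \<in> vspan k V B \<and> c \<in> carrier k}"
  note S = submodule_closed[OF V(1) vspan_submodule[OF V(1,2)]]
  have Sc: "\<And>p. p \<in> vspan k V B \<Longrightarrow> p \<in> carrier V" using S(1) by auto
  have I: "p \<oplus>\<^bsub>V\<^esub> c \<odot>\<^bsub>V\<^esub> v \<in> ?P" if "p \<in> vspan k V B" "c \<in> carrier k" for p c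
    using that by blast
  have "submodule ?P k V"
  proof (rule submodule_intro[OF V(1)])
    show "?P \<subseteq> carrier V" using Sc V(3) by auto
    show "\<zero>\<^bsub>V\<^esub> \<in> ?P" using I[OF S(2), of "\<zero>\<^bsub>k\<^esub>"] V(3) by simp
  next
    fix x y assume "x \<in> ?P" "y \<in> ?P"
    then obtain p c q d where *: "x = p \<oplus>\<^bsub>V\<^esub> c \<odot>\<^bsub>V\<^esub> v" "y = q \<oplus>\<^bsub>V\<^esub> d \<odot>\<^bsub>V\<^esub> v"
      "p \<in> vspan k V B" "c \<in> carrier k" "q \<in> vspan k V B" "d \<in> carrier k" by blast
    have "x \<oplus>\<^bsub>V\<^esub> y = (p \<oplus>\<^bsub>V\<^esub> q) \<oplus>\<^bsub>V\<^esub> (c \<oplus>\<^bsub>k\<^esub> d) \<odot>\<^bsub>V\<^esub> v"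
      using * Sc V(3) by (simp add: V.smult_l_distr V.a_ac)
    then show "x \<oplus>\<^bsub>V\<^esub> y \<in> ?P" using I[of "p \<oplus>\<^bsub>V\<^esub> q" "c \<oplus>\<^bsub>k\<^esub> d"] * S(3) by simp
  next
    fix a x assume a: "a \<in> carrier k" and "x \<in> ?P"
    then obtain p c where *: "x = p \<oplus>\<^bsub>V\<^esub> c \<odot>\<^bsub>V\<^esub> v" "p \<in> vspan k V B" "c \<in> carrier k" by blast
    have "a \<odot>\<^bsub>V\<^esub> x = a \<odot>\<^bsub>V\<^esub> p \<oplus>\<^bsub>V\<^esub> (a \<otimes>\<^bsub>k\<^esub> c) \<odot>\<^bsub>V\<^esub> v"
      using * a Sc V(3) by (simp add: V.smult_r_distr V.smult_assoc1)
    then show "a \<odot>\<^bsub>V\<^esub> x \<in> ?P" using I[of "a \<odot>\<^bsub>V\<^esub> p" "a \<otimes>\<^bsub>k\<^esub> c"] * a S(5) by simp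
  qed
  moreover have "insert v B \<subseteq> ?P"
  proof -
    have "v \<in> ?P" using I[OF S(2), of "\<one>\<^bsub>k\<^esub>"] V(3) by simp
    moreover have "b \<in> ?P" if "b \<in> B" for b
      using I[of b "\<zero>\<^bsub>k\<^esub>"] vspan_superset[of B k V] that V(2,3) by (auto simp: subset_iff)
    ultimately show ?thesis by auto
  qed
  ultimately have "vspan k V (insert v B) \<subseteq> ?P" by (rule vspan_minimal)
  then show thesis using x that by blast
qed

text \<open>Phrased through the spans of \<open>B - {b}\<close> because, for a spanning
  \<open>B\<close>, these are the hyperplanes on which the coordinate of \<open>b\<close> will
  vanish.\<close>

definition vindep :: "'u ring \<Rightarrow> ('u, 'a) module \<Rightarrow> 'a set \<Rightarrow> bool" where
  "vindep k V B \<longleftrightarrow> B \<subseteq> carrier V \<and> (\<forall>b\<in>B. b \<notin> vspan k V (B - {b}))"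

text \<open>A dependence of \<open>b\<close> on the rest of the union already occurs in one member
  of the chain: the spans of the sets \<open>D - {b}\<close> form a chain, so their union is a
  submodule and contains the span of the whole. The member with the dependence and the member
  containing \<open>b\<close> are comparable, and the larger one contradicts independence.\<close>

lemma vindep_Union_chain:
  assumes V: "module k V" and ne: "\<C> \<noteq> {}" and ch: "subset.chain {B. vindep k V B} \<C>"
  shows "vindep k V (\<Union>\<C>)"
proof -
  have ind: "vindep k V D" if "D \<in> \<C>" for D using ch that by (auto simp: subset.chain_def)
  have tot: "D \<subseteq> E \<or> E \<subseteq> D" if "D \<in> \<C>" "E \<in> \<C>" for D E
    using ch that by (auto simp: subset.chain_def)
  have car: "\<Union>\<C> \<subseteq> carrier V" using ind by (auto simp: vindep_def)
  have False if b: "b \<in> \<Union>\<C>" "b \<in> vspan k V (\<Union>\<C> - {b})" for b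
  proof -
    let ?S = "(\<lambda>D. vspan k V (D - {b})) ` \<C>"
    have sub: "submodule (\<Union>?S) k V"
    proof (rule directed_Union_submodule[OF V])
      show "?S \<noteq> {}" using ne by auto
      show "submodule S k V" if "S \<in> ?S" for S
        using that car by (auto intro!: vspan_submodule[OF V])
      fix S T assume "S \<in> ?S" "T \<in> ?S"
      then obtain D E where *: "D \<in> \<C>" "E \<in> \<C>" "S = vspan k V (D - {b})" "T = vspan k V (E - {b})"
        by auto
      have "D - {b} \<subseteq> E - {b} \<or> E - {b} \<subseteq> D - {b}" using tot[OF *(1,2)] by auto
      then have "S \<subseteq> T \<or> T \<subseteq> S" unfolding *(3,4) by (auto dest: vspan_mono[of _ _ k V])
      then show "\<exists>U\<in>?S. S \<subseteq> U \<and> T \<subseteq> U" using \<open>S \<in> ?S\<close> \<open>T \<in> ?S\<close> by auto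
    qed
    have "\<Union>\<C> - {b} \<subseteq> \<Union>?S" using vspan_superset by fast
    then have "b \<in> \<Union>?S" using vspan_minimal[OF sub] b(2) by blast
    then obtain D where D: "D \<in> \<C>" "b \<in> vspan k V (D - {b})" by auto
    obtain E where E: "E \<in> \<C>" "b \<in> E" using b(1) by auto
    define M where "M = (if D \<subseteq> E then E else D)"
    have M: "M \<in> \<C>" "b \<in> M" "D - {b} \<subseteq> M - {b}" using D E tot[OF D(1) E(1)] by (auto simp: M_def)
    then have "b \<in> vspan k V (M - {b})" using D(2) vspan_mono by blast
    then show False using ind[OF M(1)] M(2) by (auto simp: vindep_def)
  qed
  then show ?thesis using car by (auto simp: vindep_def)
qed

text \<open>The exchange argument. If an old \<open>b\<close> depended on \<open>v\<close> and the
  other vectors, the coefficient of \<open>v\<close> would be nonzero by independence of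
  \<open>B\<close>, and dividing by it would put \<open>v\<close> into the span of
  \<open>B\<close>.\<close>

lemma vindep_insert:
  assumes k: "field k" and V: "module k V" and B: "vindep k V B"
    and v: "v \<in> carrier V" "v \<notin> vspan k V B"
  shows "vindep k V (insert v B)"
proof -
  interpret k: field k by fact
  interpret V: module k V by fact
  have Bc: "B \<subseteq> carrier V" using B by (auto simp: vindep_def)
  have vB: "v \<notin> B" using v(2) vspan_superset by fast
  have "b \<notin> vspan k V (insert v B - {b})" if b: "b \<in> insert v B" for b
  proof (cases "b = v")
    case True
    then show ?thesis using v(2) vB by simp
  next
    case False
    then have b: "b \<in> B" and e: "insert v B - {b} = insert v (B - {b})" using b by auto
    have B': "B - {b} \<subseteq> carrier V" using Bc by auto
    show ?thesis
    proof
      assume "b \<in> vspan k V (insert v B - {b})"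
      then obtain p c where pc: "p \<in> vspan k V (B - {b})" "c \<in> carrier k" "b = p \<oplus>\<^bsub>V\<^esub> c \<odot>\<^bsub>V\<^esub> v"
        unfolding e using vspan_insert[OF V B' v(1)] by metis
      note S = submodule_closed[OF V vspan_submodule[OF V Bc]]
      have pS: "p \<in> vspan k V B" "b \<in> vspan k V B"
        using pc(1) vspan_mono[of "B - {b}" B] b vspan_superset[of B] by blast+
      have pcar: "p \<in> carrier V" "b \<in> carrier V" using pS S(1) by auto
      have "c \<noteq> \<zero>\<^bsub>k\<^esub>"
      proof
        assume "c = \<zero>\<^bsub>k\<^esub>"
        then have "b = p" using pc(3) v(1) pcar by simp
        then show False using pc(1) B b by (auto simp: vindep_def)
      qed
      then have ci: "inv\<^bsub>k\<^esub> c \<in> carrier k" "inv\<^bsub>k\<^esub> c \<otimes>\<^bsub>k\<^esub> c = \<one>\<^bsub>k\<^esub>"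
        using pc(2) k.field_Units by auto
      have "b \<ominus>\<^bsub>V\<^esub> p = c \<odot>\<^bsub>V\<^esub> v"
        using pc v(1) pcar(1) V.a_comm[of p "c \<odot>\<^bsub>V\<^esub> v"]
        by (simp add: a_minus_def V.a_assoc V.r_neg)
      then have "c \<odot>\<^bsub>V\<^esub> v \<in> vspan k V B" using S(4) pS by metis
      then have "inv\<^bsub>k\<^esub> c \<odot>\<^bsub>V\<^esub> (c \<odot>\<^bsub>V\<^esub> v) \<in> vspan k V B" using S(5) ci by blast
      then show False
        using v ci pc(2) V.smult_assoc1[OF ci(1) pc(2) v(1), symmetric] by simp
    qed
  qed
  then show ?thesis using Bc v(1) by (auto simp: vindep_def)
qed

text \<open>A vector outside the span of a maximal independent set could be added to it.\<close>

lemma ex_spanning_vindep: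
  assumes k: "field k" and V: "module k V"
  obtains B where "vindep k V B" "carrier V \<subseteq> vspan k V B"
proof -
  have "\<exists>M\<in>{B. vindep k V B}. \<forall>X\<in>{B. vindep k V B}. M \<subseteq> X \<longrightarrow> X = M"
  proof (rule subset_Zorn_nonempty)
    have "vindep k V {}" by (simp add: vindep_def)
    then show "{B. vindep k V B} \<noteq> {}" by auto
  qed (use vindep_Union_chain[OF V] in auto)
  then obtain B where B: "vindep k V B" "\<And>X. vindep k V X \<Longrightarrow> B \<subseteq> X \<Longrightarrow> X = B" by auto
  have "v \<in> vspan k V B" if "v \<in> carrier V" for v
  proof (rule ccontr)
    assume v: "v \<notin> vspan k V B"
    then have "insert v B = B" using vindep_insert[OF k V B(1) that] B(2) by blast
    then show False using v vspan_superset by fast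
  qed
  then show thesis using that B(1) by blast
qed

text \<open>The coefficient of \<open>b\<close> is unique: two different ones would put a nonzero
  multiple of \<open>b\<close>, hence \<open>b\<close> itself, into \<open>P\<close>. Uniqueness
  makes an arbitrarily chosen coefficient function linear, because sums and multiples of
  decompositions are decompositions.\<close>

lemma hyperplane_coordinate:
  assumes k: "field k" and V: "module k V" and P: "submodule P k V"
    and b: "b \<in> carrier V" "b \<notin> P"
    and ex: "\<And>v. v \<in> carrier V \<Longrightarrow> \<exists>p\<in>P. \<exists>c\<in>carrier k. v = p \<oplus>\<^bsub>V\<^esub> c \<odot>\<^bsub>V\<^esub> b"
  obtains \<chi> where "\<chi> \<in> lin_maps k V (self_module k)" "\<chi> b = \<one>\<^bsub>k\<^esub>" "\<And>p. p \<in> P \<Longrightarrow> \<chi> p = \<zero>\<^bsub>k\<^esub>"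
proof -
  interpret k: field k by fact
  interpret V: module k V by fact
  note S = submodule_closed[OF V P]
  have Pc: "\<And>p. p \<in> P \<Longrightarrow> p \<in> carrier V" using S(1) by auto
  have uniq: "c = d" if h: "p \<in> P" "q \<in> P" "c \<in> carrier k" "d \<in> carrier k"
    "p \<oplus>\<^bsub>V\<^esub> c \<odot>\<^bsub>V\<^esub> b = q \<oplus>\<^bsub>V\<^esub> d \<odot>\<^bsub>V\<^esub> b" for p q c d
  proof (rule ccontr)
    assume "c \<noteq> d"
    define e where "e = c \<ominus>\<^bsub>k\<^esub> d"
    have ed: "(c \<ominus>\<^bsub>k\<^esub> d) \<oplus>\<^bsub>k\<^esub> d = c" using h by (simp add: a_minus_def k.a_assoc k.l_neg)
    have e: "e \<in> carrier k" "e \<noteq> \<zero>\<^bsub>k\<^esub>" using \<open>c \<noteq> d\<close> h ed by (auto simp: e_def)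
    then have ei: "inv\<^bsub>k\<^esub> e \<in> carrier k" "inv\<^bsub>k\<^esub> e \<otimes>\<^bsub>k\<^esub> e = \<one>\<^bsub>k\<^esub>"
      using k.field_Units by auto
    let ?c = "c \<odot>\<^bsub>V\<^esub> b" and ?d = "d \<odot>\<^bsub>V\<^esub> b"
    have cl: "p \<in> carrier V" "q \<in> carrier V" "?c \<in> carrier V" "?d \<in> carrier V"
      using h b Pc by auto
    have "e \<odot>\<^bsub>V\<^esub> b = ?c \<ominus>\<^bsub>V\<^esub> ?d"
      using h b by (simp add: e_def a_minus_def V.smult_l_distr V.smult_l_minus)
    also have "\<dots> = q \<ominus>\<^bsub>V\<^esub> p"
    proof -
      have "?c \<ominus>\<^bsub>V\<^esub> ?d = (\<ominus>\<^bsub>V\<^esub> p \<oplus>\<^bsub>V\<^esub> (p \<oplus>\<^bsub>V\<^esub> ?c)) \<ominus>\<^bsub>V\<^esub> ?d"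
        using cl by (simp add: V.r_neg1)
      also have "\<dots> = (\<ominus>\<^bsub>V\<^esub> p \<oplus>\<^bsub>V\<^esub> (q \<oplus>\<^bsub>V\<^esub> ?d)) \<ominus>\<^bsub>V\<^esub> ?d" using h(5) by simp
      also have "\<dots> = \<ominus>\<^bsub>V\<^esub> p \<oplus>\<^bsub>V\<^esub> q"
        using cl by (simp add: a_minus_def V.a_assoc V.r_neg)
      also have "\<dots> = q \<ominus>\<^bsub>V\<^esub> p"
        using cl by (simp add: a_minus_def V.a_comm)
      finally show ?thesis .
    qed
    finally have "e \<odot>\<^bsub>V\<^esub> b \<in> P" using S(4) h by simp
    then have "inv\<^bsub>k\<^esub> e \<odot>\<^bsub>V\<^esub> (e \<odot>\<^bsub>V\<^esub> b) \<in> P" using S(5) ei by blast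
    then show False using b ei V.smult_assoc1[OF ei(1) e(1) b(1), symmetric] by simp
  qed
  obtain \<pi> \<chi> where pc: "\<And>v. v \<in> carrier V \<Longrightarrow>
      \<pi> v \<in> P \<and> \<chi> v \<in> carrier k \<and> v = \<pi> v \<oplus>\<^bsub>V\<^esub> \<chi> v \<odot>\<^bsub>V\<^esub> b"
    using ex by metis
  have pcl: "\<pi> v \<in> carrier V" "\<chi> v \<in> carrier k" "\<pi> v \<in> P" if "v \<in> carrier V" for v
    using pc[OF that] Pc by auto
  have eq: "\<chi> v = c" if "p \<in> P" "c \<in> carrier k" "v = p \<oplus>\<^bsub>V\<^esub> c \<odot>\<^bsub>V\<^esub> b" for v p c
    using pc[of v] that uniq[of "\<pi> v" p "\<chi> v" c] Pc b by auto
  have "linear_map k V (self_module k) \<chi>"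
  proof (rule linear_mapI)
    show "\<chi> x \<in> carrier (self_module k)" if "x \<in> carrier V" for x using pcl that by simp
  next
    fix x y assume xy: "x \<in> carrier V" "y \<in> carrier V"
    have "x \<oplus>\<^bsub>V\<^esub> y = (\<pi> x \<oplus>\<^bsub>V\<^esub> \<chi> x \<odot>\<^bsub>V\<^esub> b) \<oplus>\<^bsub>V\<^esub> (\<pi> y \<oplus>\<^bsub>V\<^esub> \<chi> y \<odot>\<^bsub>V\<^esub> b)"
      by (rule arg_cong2[where f = "add V"]) (use pc xy in blast)+
    also have "\<dots> = (\<pi> x \<oplus>\<^bsub>V\<^esub> \<pi> y) \<oplus>\<^bsub>V\<^esub> (\<chi> x \<oplus>\<^bsub>k\<^esub> \<chi> y) \<odot>\<^bsub>V\<^esub> b"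
      using pcl[OF xy(1)] pcl[OF xy(2)] b by (simp add: V.smult_l_distr V.a_ac)
    finally have e: "x \<oplus>\<^bsub>V\<^esub> y = (\<pi> x \<oplus>\<^bsub>V\<^esub> \<pi> y) \<oplus>\<^bsub>V\<^esub> (\<chi> x \<oplus>\<^bsub>k\<^esub> \<chi> y) \<odot>\<^bsub>V\<^esub> b" .
    show "\<chi> (x \<oplus>\<^bsub>V\<^esub> y) = \<chi> x \<oplus>\<^bsub>self_module k\<^esub> \<chi> y"
      unfolding self_module_simps by (rule eq[OF _ _ e]) (auto intro: S(3) pcl xy)
  next
    fix a x assume a: "a \<in> carrier k" and x: "x \<in> carrier V"
    have "a \<odot>\<^bsub>V\<^esub> x = a \<odot>\<^bsub>V\<^esub> (\<pi> x \<oplus>\<^bsub>V\<^esub> \<chi> x \<odot>\<^bsub>V\<^esub> b)"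
      by (rule arg_cong[where f = "smult V a"]) (use pc x in blast)
    also have "\<dots> = a \<odot>\<^bsub>V\<^esub> \<pi> x \<oplus>\<^bsub>V\<^esub> (a \<otimes>\<^bsub>k\<^esub> \<chi> x) \<odot>\<^bsub>V\<^esub> b"
      using pcl[OF x] b a by (simp add: V.smult_r_distr V.smult_assoc1)
    finally have e: "a \<odot>\<^bsub>V\<^esub> x = a \<odot>\<^bsub>V\<^esub> \<pi> x \<oplus>\<^bsub>V\<^esub> (a \<otimes>\<^bsub>k\<^esub> \<chi> x) \<odot>\<^bsub>V\<^esub> b" .
    show "\<chi> (a \<odot>\<^bsub>V\<^esub> x) = a \<odot>\<^bsub>self_module k\<^esub> \<chi> x"
      unfolding self_module_simps by (rule eq[OF _ _ e]) (auto intro: S(5) pcl x a)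
  qed
  then have "(\<lambda>v\<in>carrier V. \<chi> v) \<in> lin_maps k V (self_module k)" by (rule lin_mapsI[OF V])
  moreover have "\<chi> b = \<one>\<^bsub>k\<^esub>" using eq[of "\<zero>\<^bsub>V\<^esub>" "\<one>\<^bsub>k\<^esub>" b] S(2) b by simp
  moreover have "\<chi> p = \<zero>\<^bsub>k\<^esub>" if "p \<in> P" for p using eq[of p "\<zero>\<^bsub>k\<^esub>" p] that Pc b by simp
  ultimately show thesis using b Pc by (intro that[of "\<lambda>v\<in>carrier V. \<chi> v"]) auto
qed

theorem ex_vbasis:
  assumes k: "field k" and V: "module k V"
  obtains B \<chi> where "B \<subseteq> carrier V" "vbasis k V B (\<lambda>b. b) \<chi>"
proof -
  interpret k: field k by fact
  interpret V: module k V by fact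
  obtain B where B: "vindep k V B" "carrier V \<subseteq> vspan k V B" by (rule ex_spanning_vindep[OF k V])
  have Bc: "B \<subseteq> carrier V" using B(1) by (auto simp: vindep_def)
  have "\<exists>\<chi>. \<chi> \<in> lin_maps k V (self_module k) \<and> \<chi> b = \<one>\<^bsub>k\<^esub> \<and> (\<forall>p\<in>vspan k V (B - {b}). \<chi> p = \<zero>\<^bsub>k\<^esub>)"
    if b: "b \<in> B" for b
  proof -
    have B': "B - {b} \<subseteq> carrier V" and bc: "b \<in> carrier V" using Bc b by auto
    have sub: "submodule (vspan k V (B - {b})) k V" by (rule vspan_submodule[OF V B'])
    have nb: "b \<notin> vspan k V (B - {b})" using B(1) b by (auto simp: vindep_def)
    have ex: "\<exists>p\<in>vspan k V (B - {b}). \<exists>c\<in>carrier k. v = p \<oplus>\<^bsub>V\<^esub> c \<odot>\<^bsub>V\<^esub> b" if "v \<in> carrier V" for v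
    proof -
      have "v \<in> vspan k V (insert b (B - {b}))" using that B(2) b by (auto simp: insert_absorb)
      then show ?thesis using vspan_insert[OF V B' bc] by metis
    qed
    show ?thesis using hyperplane_coordinate[OF k V sub bc nb ex] by metis
  qed
  then obtain \<chi> where chi: "\<And>b. b \<in> B \<Longrightarrow> \<chi> b \<in> lin_maps k V (self_module k)"
      "\<And>b. b \<in> B \<Longrightarrow> \<chi> b b = \<one>\<^bsub>k\<^esub>" "\<And>b p. b \<in> B \<Longrightarrow> p \<in> vspan k V (B - {b}) \<Longrightarrow> \<chi> b p = \<zero>\<^bsub>k\<^esub>"
    by metis
  have lin: "linear_map k V (self_module k) (\<chi> b)" if "b \<in> B" for b
    using lin_mapsD(1)[OF chi(1)[OF that]] .
  have delta: "\<chi> b c = (if b = c then \<one>\<^bsub>k\<^esub> else \<zero>\<^bsub>k\<^esub>)" if "b \<in> B" "c \<in> B" for b c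
    using that chi(2,3) vspan_superset[of "B - {b}" k V] by auto
  \<comment> \<open>Finiteness of supports by minimality of the span: vectors of finite support form
    a submodule, and members of \<open>B\<close> have one-point support.\<close>
  let ?F = "{v \<in> carrier V. finite {b\<in>B. \<chi> b v \<noteq> \<zero>\<^bsub>k\<^esub>}}"
  have "submodule ?F k V"
  proof (rule submodule_intro[OF V])
    have "\<chi> b \<zero>\<^bsub>V\<^esub> = \<zero>\<^bsub>k\<^esub>" if "b \<in> B" for b
      using linear_map_zero[OF V self_module_module[OF k.is_cring] lin[OF that]] by simp
    then have "{b \<in> B. \<chi> b \<zero>\<^bsub>V\<^esub> \<noteq> \<zero>\<^bsub>k\<^esub>} = {}" by auto
    then have "finite {b \<in> B. \<chi> b \<zero>\<^bsub>V\<^esub> \<noteq> \<zero>\<^bsub>k\<^esub>}" by (simp only: finite.emptyI)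
    then show "\<zero>\<^bsub>V\<^esub> \<in> ?F" by (intro CollectI conjI V.zero_closed)
  next
    fix x y assume xy: "x \<in> ?F" "y \<in> ?F"
    have "{b \<in> B. \<chi> b (x \<oplus>\<^bsub>V\<^esub> y) \<noteq> \<zero>\<^bsub>k\<^esub>} \<subseteq> {b\<in>B. \<chi> b x \<noteq> \<zero>\<^bsub>k\<^esub>} \<union> {b\<in>B. \<chi> b y \<noteq> \<zero>\<^bsub>k\<^esub>}"
      using linear_mapD(2)[OF lin] xy by auto
    then show "x \<oplus>\<^bsub>V\<^esub> y \<in> ?F" using xy by (auto intro: finite_subset)
  next
    fix a x assume a: "a \<in> carrier k" and x: "x \<in> ?F"
    have "{b \<in> B. \<chi> b (a \<odot>\<^bsub>V\<^esub> x) \<noteq> \<zero>\<^bsub>k\<^esub>} \<subseteq> {b\<in>B. \<chi> b x \<noteq> \<zero>\<^bsub>k\<^esub>}"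
      using linear_mapD(3)[OF lin] x a by auto
    then show "a \<odot>\<^bsub>V\<^esub> x \<in> ?F" using x a by (auto intro: finite_subset)
  qed auto
  moreover have "B \<subseteq> ?F"
  proof
    fix c assume c: "c \<in> B"
    then have "{b \<in> B. \<chi> b c \<noteq> \<zero>\<^bsub>k\<^esub>} \<subseteq> {c}" using delta by (auto split: if_splits)
    then have "finite {b \<in> B. \<chi> b c \<noteq> \<zero>\<^bsub>k\<^esub>}" by (rule finite_subset) simp
    then show "c \<in> ?F" using c Bc by auto
  qed
  ultimately have "vspan k V B \<subseteq> ?F" by (rule vspan_minimal)
  then have fin: "finite {b\<in>B. \<chi> b v \<noteq> \<zero>\<^bsub>k\<^esub>}" if "v \<in> carrier V" for v using that B(2) by auto
  \<comment> \<open>Separation of points: the expansion map is linear and fixes \<open>B\<close>,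
    hence is the identity, and a vector with zero coordinates expands to the empty sum.\<close>
  let ?E = "\<lambda>v. \<Oplus>\<^bsub>V\<^esub>b\<in>{b\<in>B. \<chi> b v \<noteq> \<zero>\<^bsub>k\<^esub>}. \<chi> b v \<odot>\<^bsub>V\<^esub> b"
  have wB: "(\<lambda>b. b) \<in> B \<rightarrow> carrier V" using Bc by auto
  have "linear_map k V V ?E" by (rule combination_linear[OF V V wB lin fin])
  then have sub: "submodule {v \<in> carrier V. ?E v = v} k V"
    by (rule equalizer_submodule[OF V V]) (rule linear_mapI, auto)
  have "?E c = c" if "c \<in> B" for c
    using delta that by (intro combination_basis[OF V wB that]) auto
  then have "B \<subseteq> {v \<in> carrier V. ?E v = v}" using Bc by auto
  then have "vspan k V B \<subseteq> {v \<in> carrier V. ?E v = v}" by (rule vspan_minimal[OF sub])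
  then have id: "?E v = v" if "v \<in> carrier V" for v using that B(2) by auto
  have "v = \<zero>\<^bsub>V\<^esub>" if "v \<in> carrier V" "\<forall>b\<in>B. \<chi> b v = \<zero>\<^bsub>k\<^esub>" for v
  proof -
    have "{b\<in>B. \<chi> b v \<noteq> \<zero>\<^bsub>k\<^esub>} = {}" using that by auto
    then have "?E v = \<zero>\<^bsub>V\<^esub>" by (metis V.finsum_empty)
    then show ?thesis using id that by simp
  qed
  then have "vbasis k V B (\<lambda>b. b) \<chi>"
    unfolding vbasis_def using wB chi(1) delta fin by blast
  then show thesis using that Bc by blast
qed


section \<open>Free small vector spaces\<close>

lemma power_module_simps [simp]:
  "carrier (power_module I M) = (I \<rightarrow>\<^sub>E carrier M)"
  "x \<oplus>\<^bsub>power_module I M\<^esub> y = (\<lambda>i\<in>I. x i \<oplus>\<^bsub>M\<^esub> y i)"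
  "\<zero>\<^bsub>power_module I M\<^esub> = (\<lambda>i\<in>I. \<zero>\<^bsub>M\<^esub>)"
  "a \<odot>\<^bsub>power_module I M\<^esub> x = (\<lambda>i\<in>I. a \<odot>\<^bsub>M\<^esub> x i)"
  by (simp_all add: power_module_def)

lemma power_module_module:
  assumes "module k M"
  shows "module k (power_module I M)"
proof -
  interpret M: module k M by fact
  have D: "x i \<in> carrier M" if "x \<in> I \<rightarrow>\<^sub>E carrier M" "i \<in> I" for x i
    using that by auto
  have U: "x i = undefined" if "x \<in> I \<rightarrow>\<^sub>E carrier M" "i \<notin> I" for x i
    using that by auto
  show ?thesis
    unfolding power_module_def
    apply (rule mk_module_module)
    subgoal using module.axioms(1)[OF assms] .
    subgoal by auto
    subgoal by auto
    subgoal by auto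
    by (simp_all add: fun_eq_iff D U M.a_ac M.smult_r_distr M.smult_l_distr M.smult_assoc1)
qed

lemma direct_sum_submodule:
  assumes "module k M"
  shows "submodule (direct_sum I M) k (power_module I M)"
proof -
  interpret M: module k M by fact
  show ?thesis
  proof (rule submodule_intro[OF power_module_module[OF assms]])
    have "{i \<in> I. (\<lambda>i\<in>I. \<zero>\<^bsub>M\<^esub>) i \<noteq> \<zero>\<^bsub>M\<^esub>} = {}" by auto
    then have "finite {i \<in> I. (\<lambda>i\<in>I. \<zero>\<^bsub>M\<^esub>) i \<noteq> \<zero>\<^bsub>M\<^esub>}" by (simp only: finite.emptyI)
    then show "\<zero>\<^bsub>power_module I M\<^esub> \<in> direct_sum I M" by (auto simp: direct_sum_def)
  next
    fix x y assume xy: "x \<in> direct_sum I M" "y \<in> direct_sum I M"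
    have "{i \<in> I. (\<lambda>i\<in>I. x i \<oplus>\<^bsub>M\<^esub> y i) i \<noteq> \<zero>\<^bsub>M\<^esub>}
        \<subseteq> {i \<in> I. x i \<noteq> \<zero>\<^bsub>M\<^esub>} \<union> {i \<in> I. y i \<noteq> \<zero>\<^bsub>M\<^esub>}" by auto
    moreover have "finite ({i \<in> I. x i \<noteq> \<zero>\<^bsub>M\<^esub>} \<union> {i \<in> I. y i \<noteq> \<zero>\<^bsub>M\<^esub>})"
      using xy by (auto simp: direct_sum_def)
    ultimately have "finite {i \<in> I. (\<lambda>i\<in>I. x i \<oplus>\<^bsub>M\<^esub> y i) i \<noteq> \<zero>\<^bsub>M\<^esub>}" by (rule finite_subset)
    moreover have "(\<lambda>i\<in>I. x i \<oplus>\<^bsub>M\<^esub> y i) \<in> I \<rightarrow>\<^sub>E carrier M" using xy by (auto simp: direct_sum_def)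
    ultimately show "x \<oplus>\<^bsub>power_module I M\<^esub> y \<in> direct_sum I M"
      unfolding direct_sum_def power_module_simps by blast
  next
    fix a x assume a: "a \<in> carrier k" and x: "x \<in> direct_sum I M"
    have "{i \<in> I. (\<lambda>i\<in>I. a \<odot>\<^bsub>M\<^esub> x i) i \<noteq> \<zero>\<^bsub>M\<^esub>} \<subseteq> {i \<in> I. x i \<noteq> \<zero>\<^bsub>M\<^esub>}" using a by auto
    moreover have "finite {i \<in> I. x i \<noteq> \<zero>\<^bsub>M\<^esub>}" using x by (auto simp: direct_sum_def)
    ultimately have "finite {i \<in> I. (\<lambda>i\<in>I. a \<odot>\<^bsub>M\<^esub> x i) i \<noteq> \<zero>\<^bsub>M\<^esub>}" by (rule finite_subset)
    moreover have "(\<lambda>i\<in>I. a \<odot>\<^bsub>M\<^esub> x i) \<in> I \<rightarrow>\<^sub>E carrier M" using x a by (auto simp: direct_sum_def)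
    ultimately show "a \<odot>\<^bsub>power_module I M\<^esub> x \<in> direct_sum I M"
      unfolding direct_sum_def power_module_simps by blast
  qed (auto simp: direct_sum_def)
qed

text \<open>Objects of \<open>vect k\<close> need a carrier inside \<open>'u\<close>, while natural
  constructions produce functions. Transporting the operations along an injective coding
  \<open>e\<close> makes \<open>e\<close> an isomorphism onto its image.\<close>

lemma transport_module:
  assumes M: "module k M" and inj: "inj_on e (carrier M)"
  defines "V \<equiv> mk_module (e ` carrier M)
      (\<lambda>x y. e (inv_into (carrier M) e x \<oplus>\<^bsub>M\<^esub> inv_into (carrier M) e y)) (e \<zero>\<^bsub>M\<^esub>)
      (\<lambda>a x. e (a \<odot>\<^bsub>M\<^esub> inv_into (carrier M) e x))"
  shows "module k V" "linear_map k M V e" "linear_map k V M (inv_into (carrier M) e)"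
proof -
  interpret M: module k M by fact
  have d: "inv_into (carrier M) e (e x) = x" if "x \<in> carrier M" for x
    using inv_into_f_f[OF inj that] .
  show "module k V"
    unfolding V_def
    apply (rule mk_module_module)
    subgoal using module.axioms(1)[OF M] .
    by (auto simp: d M.a_ac M.smult_r_distr M.smult_l_distr M.smult_assoc1)
  show "linear_map k M V e" "linear_map k V M (inv_into (carrier M) e)"
    by (rule linear_mapI; auto simp: V_def d)+
qed

text \<open>The space of finitely supported functions from \<open>I\<close> to \<open>k\<close>,
  transported into \<open>'u\<close> along the code of functions. The basis vectors are the codes of
  the Kronecker deltas and the coordinates are evaluations of the decoded function.\<close>

lemma ex_free_vect:
  fixes k :: "'u::grothendieck_universe ring"
  assumes k: "cring k" "small (carrier k)" and I: "small (I :: 'u set)"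
  obtains V g \<chi> where "V \<in> vect k" "vbasis k V I g \<chi>"
proof -
  interpret k: cring k by fact
  let ?S = "direct_sum I (self_module k)"
  define M where "M = (power_module I (self_module k))\<lparr>carrier := ?S\<rparr>"
  note sm = self_module_module[OF k(1)]
  have M: "module k M" unfolding M_def
    by (rule submodule.submodule_is_module[OF direct_sum_submodule[OF sm] power_module_module[OF sm]])
  have Mc: "carrier M = ?S" by (simp add: M_def)
  have sub: "?S \<subseteq> I \<rightarrow>\<^sub>E carrier k" by (auto simp: direct_sum_def)
  obtain e :: "('u \<Rightarrow> 'u) \<Rightarrow> 'u" where e: "inj_on e (I \<rightarrow>\<^sub>E carrier k)" "small (e ` (I \<rightarrow>\<^sub>E carrier k))"
    by (rule ex_function_code[OF I k(2)])
  have inj: "inj_on e (carrier M)" unfolding Mc by (rule inj_on_subset[OF e(1) sub])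
  have sme: "small (e ` carrier M)" unfolding Mc
    by (rule small_subset[OF e(2)]) (use sub in auto)
  let ?d = "inv_into (carrier M) e"
  define V where "V = mk_module (e ` carrier M) (\<lambda>x y. e (?d x \<oplus>\<^bsub>M\<^esub> ?d y)) (e \<zero>\<^bsub>M\<^esub>)
      (\<lambda>a x. e (a \<odot>\<^bsub>M\<^esub> ?d x))"
  note T = transport_module[OF M inj, folded V_def]
  have Vc: "carrier V = e ` carrier M" by (simp add: V_def)
  have de: "?d (e x) = x" if "x \<in> ?S" for x using inv_into_f_f[OF inj] that Mc by auto
  have ed: "e (?d v) = v" "?d v \<in> ?S" if "v \<in> carrier V" for v
    using that Vc f_inv_into_f[of v e "carrier M"] inv_into_into[of v e "carrier M"] Mc by auto
  have V: "V \<in> vect k" using T(1) sme by (simp add: vect_def Vc)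
  define \<delta> where "\<delta> = (\<lambda>i. \<lambda>j\<in>I. if i = j then \<one>\<^bsub>k\<^esub> else \<zero>\<^bsub>k\<^esub>)"
  have dS: "\<delta> i \<in> ?S" if "i \<in> I" for i
  proof -
    have "finite {j \<in> I. \<delta> i j \<noteq> \<zero>\<^bsub>k\<^esub>}"
      by (rule finite_subset[of _ "{i}"]) (auto simp: \<delta>_def split: if_splits)
    then show ?thesis by (auto simp: direct_sum_def \<delta>_def)
  qed
  have "linear_map k V (self_module k) (\<lambda>v. ?d v i)" if "i \<in> I" for i
  proof (rule linear_map_compose[OF T(3)])
    show "linear_map k M (self_module k) (\<lambda>x. x i)"
      using that sub by (intro linear_mapI) (auto simp: Mc, auto simp: M_def)
  qed
  then have lin: "(\<lambda>v\<in>carrier V. ?d v i) \<in> lin_maps k V (self_module k)" if "i \<in> I" for i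
    using that by (intro lin_mapsI T(1))
  have "vbasis k V I (\<lambda>i. e (\<delta> i)) (\<lambda>i. \<lambda>v\<in>carrier V. ?d v i)"
    unfolding vbasis_def
  proof (intro conjI ballI impI)
    show "(\<lambda>i. e (\<delta> i)) \<in> I \<rightarrow> carrier V" using dS by (auto simp: Vc Mc)
    show "(\<lambda>v\<in>carrier V. ?d v i) \<in> lin_maps k V (self_module k)" if "i \<in> I" for i
      using lin that .
    show "(\<lambda>v\<in>carrier V. ?d v i) (e (\<delta> j)) = (if i = j then \<one>\<^bsub>k\<^esub> else \<zero>\<^bsub>k\<^esub>)"
      if "i \<in> I" "j \<in> I" for i j
      using that dS[OF that(2)] de by (auto simp: Vc Mc \<delta>_def)
    show "finite {i \<in> I. (\<lambda>v\<in>carrier V. ?d v i) v \<noteq> \<zero>\<^bsub>k\<^esub>}" if "v \<in> carrier V" for v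
      using ed(2)[OF that] that by (simp add: direct_sum_def)
    fix v assume v: "v \<in> carrier V" "\<forall>i\<in>I. (\<lambda>v\<in>carrier V. ?d v i) v = \<zero>\<^bsub>k\<^esub>"
    have "?d v = (\<lambda>i\<in>I. \<zero>\<^bsub>k\<^esub>)"
      using v ed(2)[OF v(1)] sub by (intro extensionalityI[of _ I]) (auto simp: PiE_def)
    then have "?d v = \<zero>\<^bsub>M\<^esub>" by (simp add: M_def)
    then show "v = \<zero>\<^bsub>V\<^esub>" using ed(1)[OF v(1)] by (simp add: V_def)
  qed
  then show thesis using that V by blast
qed


section \<open>Tensor products\<close>

lemma bilinear_mapD:
  assumes "bilinear_map k V W Z \<beta>"
  shows "v \<in> carrier V \<Longrightarrow> linear_map k W Z (\<beta> v)"
    "w \<in> carrier W \<Longrightarrow> linear_map k V Z (\<lambda>v. \<beta> v w)"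
  using assms by (auto simp: bilinear_map_def)

lemma bilinear_map_closed:
  assumes "bilinear_map k V W Z \<beta>" "v \<in> carrier V" "w \<in> carrier W"
  shows "\<beta> v w \<in> carrier Z"
  using linear_mapD(1)[OF bilinear_mapD(1)[OF assms(1,2)] assms(3)] .

lemma bilinear_compose:
  assumes "bilinear_map k V W Z \<beta>" "linear_map k Z Z' f"
  shows "bilinear_map k V W Z' (\<lambda>v w. f (\<beta> v w))"
  unfolding bilinear_map_def
  by (intro conjI ballI linear_map_compose[OF _ assms(2)] bilinear_mapD[OF assms(1)])

lemma bilinear_precompose:
  assumes "bilinear_map k V' W' Z \<beta>" "linear_map k V V' f" "linear_map k W W' g"
  shows "bilinear_map k V W Z (\<lambda>v w. \<beta> (f v) (g w))"
  unfolding bilinear_map_def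
proof (intro conjI ballI)
  show "linear_map k W Z (\<lambda>w. \<beta> (f v) (g w))" if "v \<in> carrier V" for v
    using linear_map_compose[OF assms(3) bilinear_mapD(1)[OF assms(1)]] linear_mapD(1)[OF assms(2) that]
    by blast
  show "linear_map k V Z (\<lambda>v. \<beta> (f v) (g w))" if "w \<in> carrier W" for w
    using linear_map_compose[OF assms(2) bilinear_mapD(2)[OF assms(1)]] linear_mapD(1)[OF assms(3) that]
    by blast
qed

lemma bilinear_unique:
  assumes "module k V" "module k W" "module k Z"
    and b: "vbasis k V B g \<phi>" "vbasis k W C g' \<psi>"
    and bil: "bilinear_map k V W Z \<beta>" "bilinear_map k V W Z \<beta>'"
    and eq: "\<And>b c. b \<in> B \<Longrightarrow> c \<in> C \<Longrightarrow> \<beta> (g b) (g' c) = \<beta>' (g b) (g' c)"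
    and v: "v \<in> carrier V" and w: "w \<in> carrier W"
  shows "\<beta> v w = \<beta>' v w"
proof (rule vbasis_unique[OF assms(2,3) b(2)])
  show "linear_map k W Z (\<beta> v)" using bilinear_mapD(1)[OF bil(1) v] .
  show "linear_map k W Z (\<beta>' v)" using bilinear_mapD(1)[OF bil(2) v] .
  show "w \<in> carrier W" by fact
  fix c assume c: "c \<in> C"
  have gc: "g' c \<in> carrier W" using vbasisD(1)[OF b(2) c] .
  show "\<beta> v (g' c) = \<beta>' v (g' c)"
    by (rule vbasis_unique[OF assms(1,3) b(1) bilinear_mapD(2)[OF bil(1) gc] bilinear_mapD(2)[OF bil(2) gc]])
      (use eq[OF _ c] v in blast)+
qed

lemma bilinear_extend:
  assumes V: "module k V" and W: "module k W" and Z: "module k Z"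
    and b: "vbasis k V B g \<phi>" "vbasis k W C g' \<psi>"
    and w: "\<And>b c. b \<in> B \<Longrightarrow> c \<in> C \<Longrightarrow> w b c \<in> carrier Z"
  shows "\<exists>\<beta>. bilinear_map k V W Z \<beta> \<and> (\<forall>b\<in>B. \<forall>c\<in>C. \<beta> (g b) (g' c) = w b c)"
proof -
  interpret V: module k V by fact
  interpret W: module k W by fact
  interpret Z: module k Z by fact
  have "\<exists>f\<in>lin_maps k V Z. \<forall>b\<in>B. f (g b) = w b c" if "c \<in> C" for c
    using w that by (intro vbasis_extend[OF V Z b(1)]) auto
  then obtain F where F: "\<And>c. c \<in> C \<Longrightarrow> F c \<in> lin_maps k V Z"
      "\<And>b c. b \<in> B \<Longrightarrow> c \<in> C \<Longrightarrow> F c (g b) = w b c" by metis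
  have Fl: "linear_map k V Z (F c)" if "c \<in> C" for c using F(1) that lin_mapsD(1) by blast
  have "\<exists>f\<in>lin_maps k W Z. \<forall>c\<in>C. f (g' c) = F c v" if "v \<in> carrier V" for v
    using linear_mapD(1)[OF Fl] that by (intro vbasis_extend[OF W Z b(2)]) auto
  then obtain G where G: "\<And>v. v \<in> carrier V \<Longrightarrow> G v \<in> lin_maps k W Z"
      "\<And>v c. v \<in> carrier V \<Longrightarrow> c \<in> C \<Longrightarrow> G v (g' c) = F c v" by metis
  have Gl: "linear_map k W Z (G v)" if "v \<in> carrier V" for v using G(1) that lin_mapsD(1) by blast
  \<comment> \<open>\<open>G\<close> was built by extending first over \<open>V\<close> for each
    \<open>c\<close>, then over \<open>W\<close> for each \<open>v\<close>. Linearity in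
    \<open>v\<close> is not part of the second choice; it follows from uniqueness on the basis of
    \<open>W\<close>, where \<open>G v\<close> takes the values of the linear maps
    \<open>F c\<close>.\<close>
  have "linear_map k V Z (\<lambda>v. G v u)" if u: "u \<in> carrier W" for u
  proof (rule linear_mapI)
    show "G v u \<in> carrier Z" if "v \<in> carrier V" for v using linear_mapD(1)[OF Gl[OF that] u] .
    fix x y assume xy: "x \<in> carrier V" "y \<in> carrier V"
    show "G (x \<oplus>\<^bsub>V\<^esub> y) u = G x u \<oplus>\<^bsub>Z\<^esub> G y u"
      by (rule vbasis_unique[OF W Z b(2) Gl[OF V.a_closed[OF xy]]
            linear_map_add[OF Z Gl[OF xy(1)] Gl[OF xy(2)]] _ u])
        (simp add: G(2) xy linear_mapD(2)[OF Fl])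
  next
    fix a x assume a: "a \<in> carrier k" and x: "x \<in> carrier V"
    show "G (a \<odot>\<^bsub>V\<^esub> x) u = a \<odot>\<^bsub>Z\<^esub> G x u"
      by (rule vbasis_unique[OF W Z b(2) Gl[OF V.smult_closed[OF a x]]
            linear_map_smult[OF Z Gl[OF x] a] _ u])
        (simp add: G(2) a x linear_mapD(3)[OF Fl])
  qed
  then have "bilinear_map k V W Z G" using Gl by (simp add: bilinear_map_def)
  moreover have "G (g b) (g' c) = w b c" if "b \<in> B" "c \<in> C" for b c
    using that F(2) G(2) vbasisD(1)[OF b(1)] by simp
  ultimately show ?thesis by blast
qed

text \<open>A bilinear map is determined by its values on pairs of basis vectors, and those values
  can be prescribed freely; the same holds for linear maps on \<open>T\<close> through the basis
  indexed by pairs. The two kinds of maps therefore correspond.\<close>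

lemma product_basis_is_tensor:
  fixes k :: "'u::grothendieck_universe ring"
  assumes V: "module k V" and W: "module k W" and T: "T \<in> vect k"
    and b: "vbasis k V B g \<phi>" "vbasis k W C g' \<psi>" "vbasis k T (B \<times> C) gT \<chi>"
  shows "\<exists>\<beta>. is_tensor k V W T \<beta> \<and> (\<forall>b\<in>B. \<forall>c\<in>C. \<beta> (g b) (g' c) = gT (b, c))"
proof -
  have Tm: "module k T" using T by (simp add: vect_def)
  obtain \<beta> where \<beta>: "bilinear_map k V W T \<beta>" "\<And>b c. b \<in> B \<Longrightarrow> c \<in> C \<Longrightarrow> \<beta> (g b) (g' c) = gT (b, c)"
    using bilinear_extend[OF V W Tm b(1,2), of "\<lambda>b c. gT (b, c)"] vbasisD(1)[OF b(3)] by auto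
  have "\<exists>!h. h \<in> lin_maps k T Z \<and> (\<forall>v\<in>carrier V. \<forall>w\<in>carrier W. h (\<beta> v w) = \<gamma> v w)"
    if Z: "Z \<in> vect k" and \<gamma>: "bilinear_map k V W Z \<gamma>" for Z \<gamma>
  proof -
    have Zm: "module k Z" using Z by (simp add: vect_def)
    have "\<exists>h\<in>lin_maps k T Z. \<forall>i\<in>B \<times> C. h (gT i) = \<gamma> (g (fst i)) (g' (snd i))"
      using bilinear_map_closed[OF \<gamma>] vbasisD(1)[OF b(1)] vbasisD(1)[OF b(2)]
      by (intro vbasis_extend[OF Tm Zm b(3)]) auto
    then obtain h where h: "h \<in> lin_maps k T Z"
        "\<And>b c. b \<in> B \<Longrightarrow> c \<in> C \<Longrightarrow> h (gT (b, c)) = \<gamma> (g b) (g' c)" by force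
    have hl: "linear_map k T Z h" using h(1) by (rule lin_mapsD)
    show ?thesis
    proof (rule ex1I[of _ h])
      have "h (\<beta> v w) = \<gamma> v w" if "v \<in> carrier V" "w \<in> carrier W" for v w
        by (rule bilinear_unique[OF V W Zm b(1,2) bilinear_compose[OF \<beta>(1) hl] \<gamma> _ that])
          (simp add: h(2) \<beta>(2))
      then show "h \<in> lin_maps k T Z \<and> (\<forall>v\<in>carrier V. \<forall>w\<in>carrier W. h (\<beta> v w) = \<gamma> v w)"
        using h(1) by blast
    next
      fix h' assume h': "h' \<in> lin_maps k T Z \<and> (\<forall>v\<in>carrier V. \<forall>w\<in>carrier W. h' (\<beta> v w) = \<gamma> v w)"
      have "h' (gT i) = h (gT i)" if "i \<in> B \<times> C" for i
      proof -
        obtain b c where i: "i = (b, c)" "b \<in> B" "c \<in> C"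
          using \<open>i \<in> B \<times> C\<close> by auto
        have "g b \<in> carrier V" "g' c \<in> carrier W"
          using vbasisD(1)[OF b(1) i(2)] vbasisD(1)[OF b(2) i(3)] by auto
        then have "h' (\<beta> (g b) (g' c)) = \<gamma> (g b) (g' c)" using h' by blast
        then show ?thesis using i h(2) \<beta>(2) by simp
      qed
      then show "h' = h"
        using h' h(1) hl vbasis_unique[OF Tm Zm b(3) lin_mapsD(1) hl, of h']
        by (intro lin_maps_eqI[of h' k T Z h]) auto
    qed
  qed
  then have "is_tensor k V W T \<beta>" using T \<beta>(1) by (simp add: is_tensor_def)
  then show ?thesis using \<beta>(2) by blast
qed

section \<open>Existence of small tensor products, with coordinates\<close>

lemma vect_module: "V \<in> vect k \<Longrightarrow> module k V"
  by (simp add: vect_def)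

lemma self_module_vect: "cring k \<Longrightarrow> small (carrier k) \<Longrightarrow> self_module k \<in> vect k"
  by (simp add: vect_def self_module_module)

text \<open>The last clause is the point: a coordinate function of a product basis is a functional
  on \<open>V\<close> times a functional on \<open>W\<close>. The index set consists of codes of
  pairs, so that it is a small subset of \<open>'u\<close>.\<close>

lemma ex_tensor_basis:
  fixes k :: "'u::grothendieck_universe ring"
  assumes k: "field k" "small (carrier k)" and V: "V \<in> vect k" and W: "W \<in> vect k"
  obtains T \<beta> and I :: "'u set" and g \<chi> where "is_tensor k V W T \<beta>" "small I" "vbasis k T I g \<chi>"
    "\<forall>i\<in>I. \<exists>\<phi>\<in>lin_maps k V (self_module k). \<exists>\<psi>\<in>lin_maps k W (self_module k).
        \<forall>v\<in>carrier V. \<forall>w\<in>carrier W. \<chi> i (\<beta> v w) = \<phi> v \<otimes>\<^bsub>k\<^esub> \<psi> w"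
proof -
  interpret k: field k by fact
  have sk: "module k (self_module k)" by (rule self_module_module[OF k.is_cring])
  note Vm = vect_module[OF V] and Wm = vect_module[OF W]
  obtain B \<phi> where B: "B \<subseteq> carrier V" "vbasis k V B (\<lambda>b. b) \<phi>" by (rule ex_vbasis[OF k(1) Vm])
  obtain C \<psi> where C: "C \<subseteq> carrier W" "vbasis k W C (\<lambda>b. b) \<psi>" by (rule ex_vbasis[OF k(1) Wm])
  have sB: "small B" "small C"
    using V W small_subset[OF _ B(1)] small_subset[OF _ C(1)] by (auto simp: vect_def)
  obtain p :: "'u \<Rightarrow> 'u \<Rightarrow> 'u" where p: "\<And>a b c d. p a b = p c d \<Longrightarrow> a = c \<and> b = d"
    and sp: "\<And>A B. small A \<Longrightarrow> small B \<Longrightarrow> small {p a b | a b. a \<in> A \<and> b \<in> B}"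
    using ex_pairing[where 'u = 'u] by blast
  let ?I = "{p a b | a b. a \<in> B \<and> b \<in> C}"
  have sI: "small ?I" by (rule sp[OF sB])
  obtain T g \<chi> where T: "T \<in> vect k" "vbasis k T ?I g \<chi>"
    by (rule ex_free_vect[OF k.is_cring k(2) sI])
  have "p a b \<in> (\<lambda>i. p (fst i) (snd i)) ` (B \<times> C)" if "a \<in> B" "b \<in> C" for a b
    using that by (intro image_eqI[of _ _ "(a, b)"]) auto
  then have "(\<lambda>i. p (fst i) (snd i)) ` (B \<times> C) = ?I" by auto blast
  moreover have "inj_on (\<lambda>i. p (fst i) (snd i)) (B \<times> C)" by (auto simp: inj_on_def dest: p)
  ultimately have bij: "bij_betw (\<lambda>i. p (fst i) (snd i)) (B \<times> C) ?I" by (simp add: bij_betw_def)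
  note T' = vbasis_reindex[OF bij T(2)]
  obtain \<beta> where \<beta>: "is_tensor k V W T \<beta>"
      "\<And>b c. b \<in> B \<Longrightarrow> c \<in> C \<Longrightarrow> \<beta> b c = g (p b c)"
    using product_basis_is_tensor[OF Vm Wm T(1) B(2) C(2) T'] by auto
  have bil: "bilinear_map k V W T \<beta>" using \<beta>(1) by (simp add: is_tensor_def)
  have "\<exists>\<phi>\<in>lin_maps k V (self_module k). \<exists>\<psi>\<in>lin_maps k W (self_module k).
        \<forall>v\<in>carrier V. \<forall>w\<in>carrier W. \<chi> i (\<beta> v w) = \<phi> v \<otimes>\<^bsub>k\<^esub> \<psi> w" if i: "i \<in> ?I" for i
  proof -
    obtain b c where bc: "i = p b c" "b \<in> B" "c \<in> C" using i by auto
    have pI: "p b' c' \<in> ?I" if "b' \<in> B" "c' \<in> C" for b' c' using that by blast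
    note fb = vbasisD[OF B(2)] and pc = vbasisD[OF C(2)]
    have bm: "bilinear_map k V W (self_module k) (\<lambda>v w. \<phi> b v \<otimes>\<^bsub>k\<^esub> \<psi> c w)"
      unfolding bilinear_map_def
    proof (intro conjI ballI)
      show "linear_map k W (self_module k) (\<lambda>w. \<phi> b v \<otimes>\<^bsub>k\<^esub> \<psi> c w)" if "v \<in> carrier V" for v
        using linear_map_smult[OF sk pc(3)[OF bc(3)] fb(4)[OF bc(2) that]] by simp
      show "linear_map k V (self_module k) (\<lambda>v. \<phi> b v \<otimes>\<^bsub>k\<^esub> \<psi> c w)" if w: "w \<in> carrier W" for w
      proof (rule linear_mapI)
        note l = linear_mapD[OF fb(3)[OF bc(2)]] and pw = pc(4)[OF bc(3) w]
        show "\<phi> b x \<otimes>\<^bsub>k\<^esub> \<psi> c w \<in> carrier (self_module k)" if "x \<in> carrier V" for x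
          using l(1)[OF that] pw by simp
        show "\<phi> b (x \<oplus>\<^bsub>V\<^esub> y) \<otimes>\<^bsub>k\<^esub> \<psi> c w
            = \<phi> b x \<otimes>\<^bsub>k\<^esub> \<psi> c w \<oplus>\<^bsub>self_module k\<^esub> \<phi> b y \<otimes>\<^bsub>k\<^esub> \<psi> c w"
          if "x \<in> carrier V" "y \<in> carrier V" for x y
          using l(1)[OF that(1)] l(1)[OF that(2)] l(2)[OF that] pw by (simp add: k.l_distr)
        show "\<phi> b (a \<odot>\<^bsub>V\<^esub> x) \<otimes>\<^bsub>k\<^esub> \<psi> c w = a \<odot>\<^bsub>self_module k\<^esub> (\<phi> b x \<otimes>\<^bsub>k\<^esub> \<psi> c w)"
          if "a \<in> carrier k" "x \<in> carrier V" for a x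
          using l(1)[OF that(2)] l(3)[OF that] pw that(1) by (simp add: k.m_assoc)
      qed
    qed
    have cl: "linear_map k T (self_module k) (\<chi> i)" using vbasisD(3)[OF T(2) i] .
    have "\<chi> i (\<beta> v w) = \<phi> b v \<otimes>\<^bsub>k\<^esub> \<psi> c w" if "v \<in> carrier V" "w \<in> carrier W" for v w
    proof (rule bilinear_unique[OF Vm Wm sk B(2) C(2) bilinear_compose[OF bil cl] bm _ that])
      fix b' c' assume bc': "b' \<in> B" "c' \<in> C"
      have "\<chi> i (\<beta> b' c') = (if p b c = p b' c' then \<one>\<^bsub>k\<^esub> else \<zero>\<^bsub>k\<^esub>)"
        using vbasisD(5)[OF T(2) i pI[OF bc']] \<beta>(2)[OF bc'] bc(1) by simp
      \<comment> \<open>Injectivity of the pairing splits the delta of a pair into a product of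
        deltas.\<close>
      also have "\<dots> = (if b = b' then \<one>\<^bsub>k\<^esub> else \<zero>\<^bsub>k\<^esub>) \<otimes>\<^bsub>k\<^esub> (if c = c' then \<one>\<^bsub>k\<^esub> else \<zero>\<^bsub>k\<^esub>)"
        using p[of b c b' c'] by auto
      finally show "\<chi> i (\<beta> b' c') = \<phi> b b' \<otimes>\<^bsub>k\<^esub> \<psi> c c'"
        using fb(5)[OF bc(2) bc'(1)] pc(5)[OF bc(3) bc'(2)] by simp
    qed
    then show ?thesis using fb(2)[OF bc(2)] pc(2)[OF bc(3)] by blast
  qed
  then show thesis using that[OF \<beta>(1) sI T(2)] by blast
qed

lemma is_tensor_tensor:
  assumes "field k" "small (carrier k)" "V \<in> vect k" "W \<in> vect k"
  shows "is_tensor k V W (tensor k V W) (tens k V W)"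
proof -
  obtain T \<beta> where "is_tensor k V W T \<beta>" by (rule ex_tensor_basis[OF assms])
  \<comment> \<open>The choice is made over pairs by a tuple pattern; this puts the witness in the
    matching form.\<close>
  then have "case (T, \<beta>) of (T, b) \<Rightarrow> is_tensor k V W T b" by simp
  then have "case tensor_choice k V W of (T, b) \<Rightarrow> is_tensor k V W T b"
    unfolding tensor_choice_def by (rule someI)
  then show ?thesis by (simp add: tensor_def tens_def case_prod_beta)
qed

lemma is_tensor_lift:
  assumes "is_tensor k V W T b" "Z \<in> vect k" "bilinear_map k V W Z \<beta>"
  shows "\<exists>h\<in>lin_maps k T Z. \<forall>v\<in>carrier V. \<forall>w\<in>carrier W. h (b v w) = \<beta> v w"
  using assms unfolding is_tensor_def by blast

text \<open>The common composite with \<open>b\<close> is itself bilinear, and the uniqueness clause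
  applies to it.\<close>

lemma is_tensor_unique:
  assumes T: "is_tensor k V W T b" "Z \<in> vect k" "h \<in> lin_maps k T Z" "h' \<in> lin_maps k T Z"
    and eq: "\<And>v w. v \<in> carrier V \<Longrightarrow> w \<in> carrier W \<Longrightarrow> h (b v w) = h' (b v w)"
  shows "h = h'"
proof -
  have "bilinear_map k V W Z (\<lambda>v w. h (b v w))"
    using T(1) by (intro bilinear_compose[OF _ lin_mapsD(1)[OF T(3)]]) (simp add: is_tensor_def)
  then have "\<exists>!h''. h'' \<in> lin_maps k T Z \<and> (\<forall>v\<in>carrier V. \<forall>w\<in>carrier W. h'' (b v w) = h (b v w))"
    using T(1,2) unfolding is_tensor_def by blast
  then show ?thesis using T(3,4) eq by metis
qed

section \<open>The chosen tensor product: functoriality, contraction, coordinates\<close>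

context
  fixes k :: "'u::grothendieck_universe ring"
  assumes k: "field k" "small (carrier k)"
begin

lemma tensor_vect: "V \<in> vect k \<Longrightarrow> W \<in> vect k \<Longrightarrow> tensor k V W \<in> vect k"
  using is_tensor_tensor[OF k] by (simp add: is_tensor_def)

lemma tens_bilinear:
  "V \<in> vect k \<Longrightarrow> W \<in> vect k \<Longrightarrow> bilinear_map k V W (tensor k V W) (tens k V W)"
  using is_tensor_tensor[OF k] by (simp add: is_tensor_def)

lemma tens_closed:
  assumes "V \<in> vect k" "W \<in> vect k" "v \<in> carrier V" "w \<in> carrier W"
  shows "tens k V W v w \<in> carrier (tensor k V W)"
  using bilinear_map_closed[OF tens_bilinear[OF assms(1,2)] assms(3,4)] .

lemma tensor_map_spec:
  assumes "V \<in> vect k" "W \<in> vect k" "V' \<in> vect k" "W' \<in> vect k"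
    and "f \<in> lin_maps k V V'" "g \<in> lin_maps k W W'"
  shows "tensor_map k V V' W W' f g \<in> lin_maps k (tensor k V W) (tensor k V' W')"
    and "v \<in> carrier V \<Longrightarrow> w \<in> carrier W \<Longrightarrow>
      tensor_map k V V' W W' f g (tens k V W v w) = tens k V' W' (f v) (g w)"
proof -
  have "bilinear_map k V W (tensor k V' W') (\<lambda>v w. tens k V' W' (f v) (g w))"
    using assms lin_mapsD(1) by (intro bilinear_precompose[OF tens_bilinear]) blast+
  then have "\<exists>!h. h \<in> lin_maps k (tensor k V W) (tensor k V' W') \<and>
      (\<forall>v\<in>carrier V. \<forall>w\<in>carrier W. h (tens k V W v w) = tens k V' W' (f v) (g w))"
    using is_tensor_tensor[OF k assms(1,2)] tensor_vect[OF assms(3,4)] by (simp add: is_tensor_def)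
  from theI'[OF this]
  show "tensor_map k V V' W W' f g \<in> lin_maps k (tensor k V W) (tensor k V' W')"
    and "v \<in> carrier V \<Longrightarrow> w \<in> carrier W \<Longrightarrow>
      tensor_map k V V' W W' f g (tens k V W v w) = tens k V' W' (f v) (g w)"
    unfolding tensor_map_def by blast+
qed

text \<open>This is \<phi> \<otimes> id followed by the unit isomorphism from k \<otimes> W to
  \<open>W\<close>, taken in one step from the universal property.\<close>

definition contraction :: "('u, 'u) module \<Rightarrow> ('u, 'u) module \<Rightarrow> ('u \<Rightarrow> 'u) \<Rightarrow> 'u \<Rightarrow> 'u" where
  "contraction H W \<phi> = (SOME l. l \<in> lin_maps k (tensor k H W) W \<and>
     (\<forall>h\<in>carrier H. \<forall>w\<in>carrier W. l (tens k H W h w) = \<phi> h \<odot>\<^bsub>W\<^esub> w))"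

lemma contraction_spec:
  assumes H: "H \<in> vect k" and W: "W \<in> vect k" and \<phi>: "\<phi> \<in> lin_maps k H (self_module k)"
  shows "contraction H W \<phi> \<in> lin_maps k (tensor k H W) W"
    and "h \<in> carrier H \<Longrightarrow> w \<in> carrier W \<Longrightarrow> contraction H W \<phi> (tens k H W h w) = \<phi> h \<odot>\<^bsub>W\<^esub> w"
proof -
  interpret W: module k W using vect_module[OF W] .
  note l = linear_mapD[OF lin_mapsD(1)[OF \<phi>], simplified]
  have "bilinear_map k H W W (\<lambda>h w. \<phi> h \<odot>\<^bsub>W\<^esub> w)"
    unfolding bilinear_map_def
  proof (intro conjI ballI)
    show "linear_map k W W (\<lambda>w. \<phi> h \<odot>\<^bsub>W\<^esub> w)" if "h \<in> carrier H" for h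
      using l(1)[OF that] by (intro linear_map_smult[OF vect_module[OF W]] linear_mapI) auto
    show "linear_map k H W (\<lambda>h. \<phi> h \<odot>\<^bsub>W\<^esub> w)" if "w \<in> carrier W" for w
      using l that by (intro linear_mapI) (auto simp: W.smult_l_distr W.smult_assoc1)
  qed
  then have "\<exists>l. l \<in> lin_maps k (tensor k H W) W \<and>
      (\<forall>h\<in>carrier H. \<forall>w\<in>carrier W. l (tens k H W h w) = \<phi> h \<odot>\<^bsub>W\<^esub> w)"
    using is_tensor_lift[OF is_tensor_tensor[OF k H W] W] by blast
  from someI_ex[OF this]
  show "contraction H W \<phi> \<in> lin_maps k (tensor k H W) W"
    and "h \<in> carrier H \<Longrightarrow> w \<in> carrier W \<Longrightarrow> contraction H W \<phi> (tens k H W h w) = \<phi> h \<odot>\<^bsub>W\<^esub> w"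
    unfolding contraction_def by blast+
qed

text \<open>Both sides send h \<otimes> w to \<phi>(h) f(w). This naturality in \<open>W\<close> is
  what turns a transformation into Y(H \<otimes> -) into one into \<open>Y\<close>.\<close>

lemma contraction_natural:
  assumes H: "H \<in> vect k" and W: "W \<in> vect k" and W': "W' \<in> vect k"
    and \<phi>: "\<phi> \<in> lin_maps k H (self_module k)" and f: "f \<in> lin_maps k W W'"
  shows "compose (carrier (tensor k H W)) (contraction H W' \<phi>) (tensor_map k H H W W' (id_map H) f) =
    compose (carrier (tensor k H W)) f (contraction H W \<phi>)"
proof (rule is_tensor_unique[OF is_tensor_tensor[OF k H W] W'])
  note id = id_map_lin[OF vect_module[OF H]]
  note Tm = vect_module[OF tensor_vect[OF H W]]
  note tm = tensor_map_spec[OF H W H W' id f]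
  note l = contraction_spec[OF H W \<phi>] and l' = contraction_spec[OF H W' \<phi>]
  show "compose (carrier (tensor k H W)) (contraction H W' \<phi>) (tensor_map k H H W W' (id_map H) f)
      \<in> lin_maps k (tensor k H W) W'" using lin_maps_compose[OF Tm tm(1) l'(1)] .
  show "compose (carrier (tensor k H W)) f (contraction H W \<phi>) \<in> lin_maps k (tensor k H W) W'"
    using lin_maps_compose[OF Tm l(1) f] .
  note fl = linear_mapD[OF lin_mapsD(1)[OF f]] and pl = linear_mapD[OF lin_mapsD(1)[OF \<phi>], simplified]
  fix h w assume hw: "h \<in> carrier H" "w \<in> carrier W"
  then show "compose (carrier (tensor k H W)) (contraction H W' \<phi>)
        (tensor_map k H H W W' (id_map H) f) (tens k H W h w) =
      compose (carrier (tensor k H W)) f (contraction H W \<phi>) (tens k H W h w)"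
    using tens_closed[OF H W hw] tm(2)[OF hw] l(2)[OF hw] l'(2)[OF hw(1) fl(1)[OF hw(2)]]
      fl(3)[OF pl(1)[OF hw(1)] hw(2)]
    by (simp add: compose_eq id_map_def)
qed

text \<open>\<open>tensor\<close> comes with a universal property but no basis, so it is compared
  with a tensor product \<open>V\<close> that has a product basis. The identity for \<open>s\<close>
  and \<open>r\<close> lets vanishing at \<open>V\<close> be carried back to \<open>T\<close>; the
  coordinate equation holds because both composites send h \<otimes> w to \<phi>(h)
  \<psi>(w).\<close>

lemma tensor_coordinates:
  assumes H: "H \<in> vect k" and W: "W \<in> vect k"
  defines "T \<equiv> tensor k H W"
  obtains V and I :: "'u set" and g \<chi> r s where "V \<in> vect k" "small I" "vbasis k V I g \<chi>"
    "r \<in> lin_maps k T V" "s \<in> lin_maps k V T" "compose (carrier T) s r = id_map T"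
    "\<forall>i\<in>I. \<exists>\<phi>\<in>lin_maps k H (self_module k). \<exists>\<psi>\<in>lin_maps k W (self_module k).
        compose (carrier T) (\<chi> i) r = compose (carrier T) \<psi> (contraction H W \<phi>)"
proof -
  interpret k: field k using k(1) .
  note Tv = tensor_vect[OF H W, folded T_def] and Tb = tens_bilinear[OF H W, folded T_def]
  note Tt = is_tensor_tensor[OF k H W, folded T_def] and tc = tens_closed[OF H W, folded T_def]
  note Tm = vect_module[OF Tv]
  obtain V \<beta> and I :: "'u set" and g \<chi> where V: "is_tensor k H W V \<beta>" "small I" "vbasis k V I g \<chi>"
    and co: "\<forall>i\<in>I. \<exists>\<phi>\<in>lin_maps k H (self_module k). \<exists>\<psi>\<in>lin_maps k W (self_module k).
        \<forall>v\<in>carrier H. \<forall>w\<in>carrier W. \<chi> i (\<beta> v w) = \<phi> v \<otimes>\<^bsub>k\<^esub> \<psi> w"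
    by (rule ex_tensor_basis[OF k H W])
  have Vv: "V \<in> vect k" and Vb: "bilinear_map k H W V \<beta>" using V(1) by (auto simp: is_tensor_def)
  obtain r where r: "r \<in> lin_maps k T V"
      "\<And>v w. v \<in> carrier H \<Longrightarrow> w \<in> carrier W \<Longrightarrow> r (tens k H W v w) = \<beta> v w"
    using is_tensor_lift[OF Tt Vv Vb] by blast
  obtain s where s: "s \<in> lin_maps k V T"
      "\<And>v w. v \<in> carrier H \<Longrightarrow> w \<in> carrier W \<Longrightarrow> s (\<beta> v w) = tens k H W v w"
    using is_tensor_lift[OF V(1) Tv Tb] by blast
  have "compose (carrier T) s r = id_map T"
    by (rule is_tensor_unique[OF Tt Tv lin_maps_compose[OF Tm r(1) s(1)] id_map_lin[OF Tm]])
      (simp add: compose_eq id_map_def tc r(2) s(2))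
  moreover have "\<exists>\<phi>\<in>lin_maps k H (self_module k). \<exists>\<psi>\<in>lin_maps k W (self_module k).
        compose (carrier T) (\<chi> i) r = compose (carrier T) \<psi> (contraction H W \<phi>)" if i: "i \<in> I" for i
  proof -
    obtain \<phi> \<psi> where fp: "\<phi> \<in> lin_maps k H (self_module k)" "\<psi> \<in> lin_maps k W (self_module k)"
      "\<And>v w. v \<in> carrier H \<Longrightarrow> w \<in> carrier W \<Longrightarrow> \<chi> i (\<beta> v w) = \<phi> v \<otimes>\<^bsub>k\<^esub> \<psi> w" using co i by blast
    note sv = self_module_vect[OF k.is_cring k(2)]
    note l = contraction_spec[OF H W fp(1), folded T_def]
    note fl = linear_mapD[OF lin_mapsD(1)[OF fp(1)], simplified]
      and pl = linear_mapD[OF lin_mapsD(1)[OF fp(2)], simplified]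
    have "compose (carrier T) (\<chi> i) r = compose (carrier T) \<psi> (contraction H W \<phi>)"
      by (rule is_tensor_unique[OF Tt sv lin_maps_compose[OF Tm r(1) vbasisD(2)[OF V(3) i]]
            lin_maps_compose[OF Tm l(1) fp(2)]])
        (simp add: compose_eq tc r(2) l(2) fp(3) pl(3) fl(1))
    then show ?thesis using fp(1,2) by blast
  qed
  ultimately show thesis using that[OF Vv V(2,3) r(1) s(1)] by blast
qed

end


section \<open>Quotients of functors\<close>

lemma submodule_abelian_subgroup:
  assumes "module k M" "submodule S k M"
  shows "abelian_subgroup S M"
proof -
  interpret M: module k M by fact
  show ?thesis
    using submodule.axioms(1)[OF assms(2)]
    by (intro abelian_subgroupI3 additive_subgroup.intro M.abelian_group_axioms)
qed

text \<open>Scalar multiplication and functoriality on quotients are defined as unions over all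
  representatives. Here the union collapses to a single coset, since \<open>h\<close> maps
  \<open>S\<close> into \<open>S'\<close> and so all representatives give the same one.\<close>

lemma coset_Union:
  assumes M: "module k M" and N: "module k N" and S: "submodule S k M" and S': "submodule S' k N"
    and h: "linear_map k M N h" "\<And>s. s \<in> S \<Longrightarrow> h s \<in> S'" and x: "x \<in> carrier M"
  shows "(\<Union>z\<in>S +>\<^bsub>M\<^esub> x. S' +>\<^bsub>N\<^esub> h z) = S' +>\<^bsub>N\<^esub> h x"
proof -
  interpret M: module k M by fact
  interpret N: module k N by fact
  interpret S: abelian_subgroup S M by (rule submodule_abelian_subgroup[OF M S])
  interpret S': abelian_subgroup S' N by (rule submodule_abelian_subgroup[OF N S'])
  have "S' +>\<^bsub>N\<^esub> h z = S' +>\<^bsub>N\<^esub> h x" if z: "z \<in> S +>\<^bsub>M\<^esub> x" for z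
  proof -
    obtain s where s: "s \<in> S" "z = s \<oplus>\<^bsub>M\<^esub> x" using z by (auto simp: a_r_coset_def')
    have "h z = h s \<oplus>\<^bsub>N\<^esub> h x" using linear_mapD(2)[OF h(1) _ x] s by simp
    then have "h z \<in> S' +>\<^bsub>N\<^esub> h x" using h(2)[OF s(1)] by (auto simp: a_r_coset_def')
    then show ?thesis
      using N.a_repr_independence[OF _ linear_mapD(1)[OF h(1) x]] submodule.axioms(1)[OF S'] by blast
  qed
  moreover have "x \<in> S +>\<^bsub>M\<^esub> x" using S.a_rcos_self[OF x] .
  ultimately show ?thesis by blast
qed

text \<open>What members of \<open>Q3\<close> and \<open>Q4\<close> share: each is the quotient of a
  functor by a stable family of submodules, so maps out of them can be treated once.\<close>

locale subfunctor =
  fixes k :: "'u::grothendieck_universe ring"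
    and F :: "('u, 'a) vfunctor"
    and S :: "('u, 'u) module \<Rightarrow> 'a set"
  assumes Ob_module: "V \<in> vect k \<Longrightarrow> module k (Ob F V)"
    and Map_linear: "V \<in> vect k \<Longrightarrow> W \<in> vect k \<Longrightarrow> f \<in> lin_maps k V W \<Longrightarrow>
      linear_map k (Ob F V) (Ob F W) (Map F V W f)"
    and sub: "V \<in> vect k \<Longrightarrow> submodule (S V) k (Ob F V)"
    and stable: "V \<in> vect k \<Longrightarrow> W \<in> vect k \<Longrightarrow> f \<in> lin_maps k V W \<Longrightarrow> s \<in> S V \<Longrightarrow>
      Map F V W f s \<in> S W"
begin

abbreviation "Q \<equiv> quotient_functor k F S"

abbreviation "coset V x \<equiv> S V +>\<^bsub>Ob F V\<^esub> x"

lemma quotient_carrier: "carrier (Ob Q V) = {coset V x | x. x \<in> carrier (Ob F V)}"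
  by (auto simp: quotient_functor_def quotient_module_def A_RCOSETS_def')

lemma cosetE:
  assumes "C \<in> carrier (Ob Q V)"
  obtains x where "x \<in> carrier (Ob F V)" "C = coset V x"
  using assms unfolding quotient_carrier by blast

lemma coset_closed: "x \<in> carrier (Ob F V) \<Longrightarrow> coset V x \<in> carrier (Ob Q V)"
  unfolding quotient_carrier by blast

lemma quotient_add:
  assumes "V \<in> vect k" "x \<in> carrier (Ob F V)" "y \<in> carrier (Ob F V)"
  shows "coset V x \<oplus>\<^bsub>Ob Q V\<^esub> coset V y = coset V (x \<oplus>\<^bsub>Ob F V\<^esub> y)"
proof -
  interpret S: abelian_subgroup "S V" "Ob F V"
    by (rule submodule_abelian_subgroup[OF Ob_module[OF assms(1)] sub[OF assms(1)]])
  show ?thesis using S.a_rcos_sum[OF assms(2,3)]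
    by (simp add: quotient_functor_def quotient_module_def)
qed

lemma quotient_smult:
  assumes V: "V \<in> vect k" and a: "a \<in> carrier k" and x: "x \<in> carrier (Ob F V)"
  shows "a \<odot>\<^bsub>Ob Q V\<^esub> coset V x = coset V (a \<odot>\<^bsub>Ob F V\<^esub> x)"
proof -
  note M = Ob_module[OF V]
  have "linear_map k (Ob F V) (Ob F V) (\<lambda>x. a \<odot>\<^bsub>Ob F V\<^esub> x)"
    by (rule linear_map_smult[OF M _ a]) (rule linear_mapI, auto)
  then show ?thesis
    using coset_Union[OF M M sub[OF V] sub[OF V] _ _ x] submodule_closed(5)[OF M sub[OF V] a]
    by (simp add: quotient_functor_def quotient_module_def)
qed

lemma quotient_Map:
  assumes V: "V \<in> vect k" and W: "W \<in> vect k" and f: "f \<in> lin_maps k V W"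
    and x: "x \<in> carrier (Ob F V)"
  shows "Map Q V W f (coset V x) = coset W (Map F V W f x)"
  using coset_Union[OF Ob_module[OF V] Ob_module[OF W] sub[OF V] sub[OF W] Map_linear[OF V W f] _ x]
    stable[OF V W f] coset_closed[OF x]
  by (simp add: quotient_functor_def)

lemma quotient_Map_closed:
  assumes "V \<in> vect k" "W \<in> vect k" "f \<in> lin_maps k V W" "C \<in> carrier (Ob Q V)"
  shows "Map Q V W f C \<in> carrier (Ob Q W)"
  using assms(4)
  by (rule cosetE)
    (use assms(1-3) linear_mapD(1)[OF Map_linear[OF assms(1-3)]] in
      \<open>auto simp: quotient_Map intro: coset_closed\<close>)

lemma quotient_add_closed:
  assumes "V \<in> vect k" "C \<in> carrier (Ob Q V)" "D \<in> carrier (Ob Q V)"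
  shows "C \<oplus>\<^bsub>Ob Q V\<^esub> D \<in> carrier (Ob Q V)"
proof -
  interpret M: module k "Ob F V" by (rule Ob_module[OF assms(1)])
  obtain x y where x: "x \<in> carrier (Ob F V)" "C = coset V x"
    and y: "y \<in> carrier (Ob F V)" "D = coset V y"
    using assms(2,3) unfolding quotient_carrier by blast
  show ?thesis
    unfolding x(2) y(2) quotient_add[OF assms(1) x(1) y(1)] using x(1) y(1) by (intro coset_closed) simp
qed

lemma quotient_smult_closed:
  assumes "V \<in> vect k" "a \<in> carrier k" "C \<in> carrier (Ob Q V)"
  shows "a \<odot>\<^bsub>Ob Q V\<^esub> C \<in> carrier (Ob Q V)"
proof -
  interpret M: module k "Ob F V" by (rule Ob_module[OF assms(1)])
  obtain x where x: "x \<in> carrier (Ob F V)" "C = coset V x"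
    using assms(3) unfolding quotient_carrier by blast
  show ?thesis
    unfolding x(2) quotient_smult[OF assms(1,2) x(1)] using x(1) assms(2) by (intro coset_closed) simp
qed

text \<open>Maps on a quotient are given by choosing a representative. Two representatives differ by
  an element of \<open>S V\<close>, which \<open>h\<close> kills.\<close>

lemma coset_repr:
  assumes V: "V \<in> vect k" and N: "module k N" and h: "linear_map k (Ob F V) N h"
    and van: "\<And>s. s \<in> S V \<Longrightarrow> h s = \<zero>\<^bsub>N\<^esub>" and x: "x \<in> carrier (Ob F V)"
  shows "h (SOME z. z \<in> coset V x) = h x"
proof -
  interpret N: module k N by fact
  interpret S: abelian_subgroup "S V" "Ob F V"
    by (rule submodule_abelian_subgroup[OF Ob_module[OF V] sub[OF V]])
  have "(SOME z. z \<in> coset V x) \<in> coset V x"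
    using S.a_rcos_self[OF x] by (rule someI)
  then obtain s where s: "s \<in> S V" "(SOME z. z \<in> coset V x) = s \<oplus>\<^bsub>Ob F V\<^esub> x"
    by (auto simp: a_r_coset_def')
  have "s \<in> carrier (Ob F V)" using s(1) submodule_closed(1)[OF Ob_module[OF V] sub[OF V]] by auto
  then show ?thesis
    using s linear_mapD(1,2)[OF h] van x by simp
qed

text \<open>The universal property of the cokernel joined to freeness: since \<eta> vanishes on
  \<open>S\<close> it factors through \<open>Q\<close>, and the factor \<theta> must be zero. This
  is how freeness yields equations between elements.\<close>

lemma induced_nat_transf_zero:
  assumes G: "\<And>V. V \<in> vect k \<Longrightarrow> module k (Ob G V)"
    and \<eta>: "\<And>V. V \<in> vect k \<Longrightarrow> linear_map k (Ob F V) (Ob G V) (\<eta> V)"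
    and nat: "\<And>V W f x. V \<in> vect k \<Longrightarrow> W \<in> vect k \<Longrightarrow> f \<in> lin_maps k V W \<Longrightarrow>
        x \<in> carrier (Ob F V) \<Longrightarrow> \<eta> W (Map F V W f x) = Map G V W f (\<eta> V x)"
    and van: "\<And>V s. V \<in> vect k \<Longrightarrow> s \<in> S V \<Longrightarrow> \<eta> V s = \<zero>\<^bsub>Ob G V\<^esub>"
    and free: "nat_transfs k Q G \<subseteq> {\<zero>\<^bsub>nat_module k Q G\<^esub>}"
    and V: "V \<in> vect k" and x: "x \<in> carrier (Ob F V)"
  shows "\<eta> V x = \<zero>\<^bsub>Ob G V\<^esub>"
proof -
  define \<theta> where "\<theta> = (\<lambda>V\<in>vect k. \<lambda>C\<in>carrier (Ob Q V). \<eta> V (SOME z. z \<in> C))"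
  have \<theta>: "\<theta> V (coset V x) = \<eta> V x" if "V \<in> vect k" "x \<in> carrier (Ob F V)" for V x
    using coset_repr[OF that(1) G[OF that(1)] \<eta>[OF that(1)] van[OF that(1)] that(2)]
      coset_closed[OF that(2)] that(1) by (simp add: \<theta>_def)
  have lin: "linear_map k (Ob Q V) (Ob G V) (\<theta> V)" if V: "V \<in> vect k" for V
  proof (rule linear_mapI)
    interpret M: module k "Ob F V" by (rule Ob_module[OF V])
    note l = linear_mapD[OF \<eta>[OF V]]
    show "\<theta> V C \<in> carrier (Ob G V)" if "C \<in> carrier (Ob Q V)" for C
      using that by (rule cosetE) (simp add: \<theta> V l(1))
    show "\<theta> V (C \<oplus>\<^bsub>Ob Q V\<^esub> D) = \<theta> V C \<oplus>\<^bsub>Ob G V\<^esub> \<theta> V D"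
      if "C \<in> carrier (Ob Q V)" "D \<in> carrier (Ob Q V)" for C D
      using that(1)
    proof (rule cosetE)
      fix x assume x: "x \<in> carrier (Ob F V)" "C = coset V x"
      show ?thesis using that(2)
        by (rule cosetE) (simp add: x V quotient_add \<theta> l(2))
    qed
    show "\<theta> V (a \<odot>\<^bsub>Ob Q V\<^esub> C) = a \<odot>\<^bsub>Ob G V\<^esub> \<theta> V C"
      if "a \<in> carrier k" "C \<in> carrier (Ob Q V)" for a C
      using that(2) by (rule cosetE) (simp add: V quotient_smult \<theta> l(3) that(1))
  qed
  have "\<theta> \<in> nat_transfs k Q G"
    unfolding nat_transfs_def
  proof (intro CollectI conjI ballI)
    show "\<theta> \<in> extensional (vect k)" by (simp add: \<theta>_def)
    show "\<theta> V \<in> lin_maps k (Ob Q V) (Ob G V)" if "V \<in> vect k" for V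
      using lin[OF that] that by (simp add: lin_maps_def) (simp add: \<theta>_def)
    show "\<theta> W (Map Q V W f C) = Map G V W f (\<theta> V C)"
      if "V \<in> vect k" "W \<in> vect k" "f \<in> lin_maps k V W" "C \<in> carrier (Ob Q V)" for V W f C
      using that(4)
      by (rule cosetE)
        (simp add: that(1-3) quotient_Map \<theta> nat linear_mapD(1)[OF Map_linear[OF that(1-3)]])
  qed
  then have "\<theta> = \<zero>\<^bsub>nat_module k Q G\<^esub>" using free by auto
  then have "\<theta> V (coset V x) = \<zero>\<^bsub>Ob G V\<^esub>"
    using V coset_closed[OF x] by (simp add: nat_module_def)
  then show ?thesis using \<theta>[OF V x] by simp
qed

end

section \<open>Representables, powers and the subfunctors defining the two classes\<close>

lemma yoneda_simps [simp]:
  "Ob (yoneda k V) W = hom_module k V W"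
  "Map (yoneda k V) W W' g = (\<lambda>f\<in>lin_maps k V W. compose (carrier V) g f)"
  by (simp_all add: yoneda_def)

lemma yoneda_Map_linear:
  assumes V: "module k V" and W: "module k W" and g: "g \<in> lin_maps k W W'"
  shows "linear_map k (hom_module k V W) (hom_module k V W') (\<lambda>f\<in>lin_maps k V W. compose (carrier V) g f)"
proof -
  note gl = linear_mapD[OF lin_mapsD(1)[OF g]]
  show ?thesis
  proof (rule linear_mapI)
    show "(\<lambda>f\<in>lin_maps k V W. compose (carrier V) g f) x \<in> carrier (hom_module k V W')"
      if "x \<in> carrier (hom_module k V W)" for x
      using that lin_maps_compose[OF V _ g] by simp
  next
    fix x y assume xy: "x \<in> carrier (hom_module k V W)" "y \<in> carrier (hom_module k V W)"
    then have s: "(\<lambda>v\<in>carrier V. x v \<oplus>\<^bsub>W\<^esub> y v) \<in> lin_maps k V W"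
      using lin_maps_add[OF V W] by auto
    have c: "x v \<in> carrier W" "y v \<in> carrier W" if "v \<in> carrier V" for v
      using xy that linear_mapD(1)[OF lin_mapsD(1)] by auto
    show "(\<lambda>f\<in>lin_maps k V W. compose (carrier V) g f) (x \<oplus>\<^bsub>hom_module k V W\<^esub> y)
      = (\<lambda>f\<in>lin_maps k V W. compose (carrier V) g f) x
        \<oplus>\<^bsub>hom_module k V W'\<^esub> (\<lambda>f\<in>lin_maps k V W. compose (carrier V) g f) y"
      using xy s by (auto simp: compose_def gl(2) c intro!: restrict_ext)
  next
    fix a x assume a: "a \<in> carrier k" and x: "x \<in> carrier (hom_module k V W)"
    then have s: "(\<lambda>v\<in>carrier V. a \<odot>\<^bsub>W\<^esub> x v) \<in> lin_maps k V W"
      using lin_maps_smult[OF V W] by auto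
    have c: "x v \<in> carrier W" if "v \<in> carrier V" for v
      using x that linear_mapD(1)[OF lin_mapsD(1)] by auto
    show "(\<lambda>f\<in>lin_maps k V W. compose (carrier V) g f) (a \<odot>\<^bsub>hom_module k V W\<^esub> x)
      = a \<odot>\<^bsub>hom_module k V W'\<^esub> (\<lambda>f\<in>lin_maps k V W. compose (carrier V) g f) x"
      using x s a by (auto simp: compose_def gl(3) c intro!: restrict_ext)
  qed
qed

lemma power_functor_simps [simp]:
  "Ob (power_functor I F) V = power_module I (Ob F V)"
  "Map (power_functor I F) V W f = (\<lambda>x\<in>I \<rightarrow>\<^sub>E carrier (Ob F V). \<lambda>i\<in>I. Map F V W f (x i))"
  by (simp_all add: power_functor_def)

text \<open>Linear maps preserve zero, so applying one componentwise can only shrink the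
  support.\<close>

lemma subfunctor_direct_sum:
  assumes "\<And>V. V \<in> vect k \<Longrightarrow> module k (Ob F V)"
    and "\<And>V W f. V \<in> vect k \<Longrightarrow> W \<in> vect k \<Longrightarrow> f \<in> lin_maps k V W \<Longrightarrow>
      linear_map k (Ob F V) (Ob F W) (Map F V W f)"
  shows "subfunctor k (power_functor I F) (\<lambda>V. direct_sum I (Ob F V))"
proof (rule subfunctor.intro)
  show "module k (Ob (power_functor I F) V)" if "V \<in> vect k" for V
    using power_module_module[OF assms(1)[OF that]] by simp
  show "submodule (direct_sum I (Ob F V)) k (Ob (power_functor I F) V)" if "V \<in> vect k" for V
    using direct_sum_submodule[OF assms(1)[OF that]] by simp
next
  fix V W f assume VWf: "V \<in> vect k" "W \<in> vect k" "f \<in> lin_maps k V W"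
  interpret V: module k "Ob F V" by (rule assms(1)[OF VWf(1)])
  note l = linear_mapD[OF assms(2)[OF VWf]]
  have c: "x i \<in> carrier (Ob F V)" if "x \<in> I \<rightarrow>\<^sub>E carrier (Ob F V)" "i \<in> I" for x i
    using that by auto
  show "linear_map k (Ob (power_functor I F) V) (Ob (power_functor I F) W) (Map (power_functor I F) V W f)"
    by (rule linear_mapI) (auto simp: l c fun_eq_iff restrict_def PiE_iff extensional_def)
  have z: "Map F V W f \<zero>\<^bsub>Ob F V\<^esub> = \<zero>\<^bsub>Ob F W\<^esub>"
    by (rule linear_map_zero[OF assms(1)[OF VWf(1)] assms(1)[OF VWf(2)] assms(2)[OF VWf]])
  fix s assume s: "s \<in> direct_sum I (Ob F V)"
  have "finite {i\<in>I. (\<lambda>i\<in>I. Map F V W f (s i)) i \<noteq> \<zero>\<^bsub>Ob F W\<^esub>}"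
    by (rule finite_subset[of _ "{i\<in>I. s i \<noteq> \<zero>\<^bsub>Ob F V\<^esub>}"]) (use s z in \<open>auto simp: direct_sum_def\<close>)
  moreover have "(\<lambda>i\<in>I. Map F V W f (s i)) \<in> I \<rightarrow>\<^sub>E carrier (Ob F W)"
    using s l(1) c by (auto simp: direct_sum_def)
  moreover have "s \<in> I \<rightarrow>\<^sub>E carrier (Ob F V)" using s by (simp add: direct_sum_def)
  ultimately show "Map (power_functor I F) V W f s \<in> direct_sum I (Ob F W)"
    unfolding direct_sum_def by simp
qed

lemma yoneda_vanishing_submodule:
  assumes V: "module k V" and W: "module k W" and H: "H \<subseteq> carrier V"
  shows "submodule (yoneda_vanishing k V H W) k (hom_module k V W)"
proof -
  interpret W: module k W by fact
  show ?thesis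
  proof (rule submodule_intro[OF hom_module_module[OF V W]])
    show "\<zero>\<^bsub>hom_module k V W\<^esub> \<in> yoneda_vanishing k V H W"
      using H lin_mapsI[OF V linear_map_const_zero[OF W]] by (auto simp: yoneda_vanishing_def)
    fix x y assume "x \<in> yoneda_vanishing k V H W" "y \<in> yoneda_vanishing k V H W"
    then show "x \<oplus>\<^bsub>hom_module k V W\<^esub> y \<in> yoneda_vanishing k V H W"
      using H lin_maps_add[OF V W]
      by (auto simp: yoneda_vanishing_def subset_iff)
  next
    fix a x assume "a \<in> carrier k" "x \<in> yoneda_vanishing k V H W"
    then show "a \<odot>\<^bsub>hom_module k V W\<^esub> x \<in> yoneda_vanishing k V H W"
      using H lin_maps_smult[OF V W]
      by (auto simp: yoneda_vanishing_def subset_iff)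
  qed (auto simp: yoneda_vanishing_def)
qed

text \<open>Closure of the filter under intersection makes the union directed: maps vanishing on
  \<open>H\<close> or on \<open>H'\<close> all vanish on the intersection. Stability holds because
  linear maps preserve zero.\<close>

lemma subfunctor_filter:
  assumes V: "V \<in> vect k" and F: "subspace_filter k V \<F>"
  shows "subfunctor k (yoneda k V) (\<lambda>W. \<Union>H\<in>\<F>. yoneda_vanishing k V H W)"
proof (rule subfunctor.intro)
  note Vm = vect_module[OF V]
  have sub: "submodule H k V" if "H \<in> \<F>" for H using F that by (auto simp: subspace_filter_def)
  have sub': "H \<subseteq> carrier V" if "H \<in> \<F>" for H using submodule_closed(1)[OF Vm sub[OF that]] .
  show "module k (Ob (yoneda k V) W)" if "W \<in> vect k" for W
    using hom_module_module[OF Vm vect_module[OF that]] by simp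
  show "linear_map k (Ob (yoneda k V) W) (Ob (yoneda k V) W') (Map (yoneda k V) W W' f)"
    if "W \<in> vect k" "W' \<in> vect k" "f \<in> lin_maps k W W'" for W W' f
    using yoneda_Map_linear[OF Vm vect_module[OF that(1)] that(3)] by simp
  show "submodule (\<Union>H\<in>\<F>. yoneda_vanishing k V H W) k (Ob (yoneda k V) W)" if W: "W \<in> vect k" for W
    unfolding yoneda_simps
  proof (rule directed_Union_submodule[OF hom_module_module[OF Vm vect_module[OF W]]])
    show "(\<lambda>H. yoneda_vanishing k V H W) ` \<F> \<noteq> {}" using F by (auto simp: subspace_filter_def)
    show "submodule S k (hom_module k V W)" if "S \<in> (\<lambda>H. yoneda_vanishing k V H W) ` \<F>" for S
      using that yoneda_vanishing_submodule[OF Vm vect_module[OF W] sub'] by auto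
    fix S T assume "S \<in> (\<lambda>H. yoneda_vanishing k V H W) ` \<F>" "T \<in> (\<lambda>H. yoneda_vanishing k V H W) ` \<F>"
    then obtain H H' where *: "H \<in> \<F>" "H' \<in> \<F>" "S = yoneda_vanishing k V H W"
      "T = yoneda_vanishing k V H' W" by auto
    have "H \<inter> H' \<in> \<F>" using F *(1,2) by (auto simp: subspace_filter_def)
    moreover have "S \<subseteq> yoneda_vanishing k V (H \<inter> H') W" "T \<subseteq> yoneda_vanishing k V (H \<inter> H') W"
      using * by (auto simp: yoneda_vanishing_def)
    ultimately show "\<exists>U\<in>(\<lambda>H. yoneda_vanishing k V H W) ` \<F>. S \<subseteq> U \<and> T \<subseteq> U" by blast
  qed
  show "Map (yoneda k V) W W' f s \<in> (\<Union>H\<in>\<F>. yoneda_vanishing k V H W')"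
    if W: "W \<in> vect k" "W' \<in> vect k" and f: "f \<in> lin_maps k W W'"
      and s: "s \<in> (\<Union>H\<in>\<F>. yoneda_vanishing k V H W)" for W W' f s
  proof -
    obtain H where H: "H \<in> \<F>" "s \<in> lin_maps k V W" "\<forall>h\<in>H. s h = \<zero>\<^bsub>W\<^esub>"
      using s by (auto simp: yoneda_vanishing_def)
    have "f \<zero>\<^bsub>W\<^esub> = \<zero>\<^bsub>W'\<^esub>"
      by (rule linear_map_zero[OF vect_module[OF W(1)] vect_module[OF W(2)] lin_mapsD(1)[OF f]])
    then have "compose (carrier V) f s \<in> yoneda_vanishing k V H W'"
      using H sub'[OF H(1)] lin_maps_compose[OF Vm H(2) f]
      by (auto simp: yoneda_vanishing_def compose_eq subset_iff)
    then show ?thesis using H by auto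
  qed
qed


section \<open>Freeness and separation by coordinates\<close>

lemma endofunctorD:
  assumes "Y \<in> vect_endofunctors k"
  shows "V \<in> vect k \<Longrightarrow> module k (Ob Y V)"
    and "V \<in> vect k \<Longrightarrow> W \<in> vect k \<Longrightarrow>
      linear_map k (hom_module k V W) (hom_module k (Ob Y V) (Ob Y W)) (Map Y V W)"
    and "V \<in> vect k \<Longrightarrow> W \<in> vect k \<Longrightarrow> f \<in> lin_maps k V W \<Longrightarrow>
      Map Y V W f \<in> lin_maps k (Ob Y V) (Ob Y W)"
    and "V \<in> vect k \<Longrightarrow> y \<in> carrier (Ob Y V) \<Longrightarrow> Map Y V V (id_map V) y = y"
    and "V \<in> vect k \<Longrightarrow> W \<in> vect k \<Longrightarrow> Z \<in> vect k \<Longrightarrow> f \<in> lin_maps k V W \<Longrightarrow>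
      g \<in> lin_maps k W Z \<Longrightarrow> y \<in> carrier (Ob Y V) \<Longrightarrow>
      Map Y V Z (compose (carrier V) g f) y = Map Y W Z g (Map Y V W f y)"
proof -
  have A: "additive_functor k Y" using assms by (simp add: vect_endofunctors_def)
  show "V \<in> vect k \<Longrightarrow> module k (Ob Y V)" using A by (simp add: additive_functor_def)
  show l: "linear_map k (hom_module k V W) (hom_module k (Ob Y V) (Ob Y W)) (Map Y V W)"
    if "V \<in> vect k" "W \<in> vect k" for V W using A that by (simp add: additive_functor_def)
  show "V \<in> vect k \<Longrightarrow> W \<in> vect k \<Longrightarrow> f \<in> lin_maps k V W \<Longrightarrow>
      Map Y V W f \<in> lin_maps k (Ob Y V) (Ob Y W)" using linear_mapD(1)[OF l] by simp
  show "V \<in> vect k \<Longrightarrow> y \<in> carrier (Ob Y V) \<Longrightarrow> Map Y V V (id_map V) y = y"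
    using A by (simp add: additive_functor_def id_map_def)
  show "V \<in> vect k \<Longrightarrow> W \<in> vect k \<Longrightarrow> Z \<in> vect k \<Longrightarrow> f \<in> lin_maps k V W \<Longrightarrow>
      g \<in> lin_maps k W Z \<Longrightarrow> y \<in> carrier (Ob Y V) \<Longrightarrow>
      Map Y V Z (compose (carrier V) g f) y = Map Y W Z g (Map Y V W f y)"
    using A by (simp add: additive_functor_def compose_eq)
qed

text \<open>The Yoneda transformation of \<open>y\<close>, at \<open>W\<close>. Its linearity is
  where additivity of \<open>Y\<close> enters.\<close>

lemma endofunctor_evaluation:
  assumes Y: "Y \<in> vect_endofunctors k" and V: "V \<in> vect k" and W: "W \<in> vect k"
    and y: "y \<in> carrier (Ob Y V)"
  shows "linear_map k (hom_module k V W) (Ob Y W) (\<lambda>f. Map Y V W f y)"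
proof (rule linear_map_compose[OF endofunctorD(2)[OF Y V W]])
  show "linear_map k (hom_module k (Ob Y V) (Ob Y W)) (Ob Y W) (\<lambda>f. f y)"
    by (rule linear_mapI) (use y linear_mapD(1)[OF lin_mapsD(1)] in auto)
qed

definition killed_by_coordinates ::
    "'u::grothendieck_universe ring \<Rightarrow> ('u, 'u) vfunctor \<Rightarrow> ('u, 'u) module \<Rightarrow> 'i set \<Rightarrow>
     ('i \<Rightarrow> 'u \<Rightarrow> 'u) \<Rightarrow> 'u \<Rightarrow> bool" where
  "killed_by_coordinates k Y V I \<chi> y \<longleftrightarrow> y \<in> carrier (Ob Y V) \<and>
     (\<forall>i\<in>I. Map Y V (self_module k) (\<chi> i) y = \<zero>\<^bsub>Ob Y (self_module k)\<^esub>)"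

text \<open>The common consequence of both kinds of freeness. Index sets are small subsets of
  \<open>'u\<close>, as in \<open>Q3\<close>.\<close>

definition separated_by_coordinates ::
    "'u::grothendieck_universe ring \<Rightarrow> ('u, 'u) vfunctor \<Rightarrow> bool" where
  "separated_by_coordinates k Y \<longleftrightarrow>
     (\<forall>V\<in>vect k. \<forall>I::'u set. \<forall>g \<chi> y. small I \<longrightarrow> vbasis k V I g \<chi> \<longrightarrow>
        killed_by_coordinates k Y V I \<chi> y \<longrightarrow> y = \<zero>\<^bsub>Ob Y V\<^esub>)"

text \<open>
  A linear map that vanishes on all but finitely many basis vectors is a finite sum of maps
  factoring through coordinate functions.
\<close>

lemma killed_by_finite_rank:
  assumes k: "cring k" "small (carrier k)" and Y: "Y \<in> vect_endofunctors k"
    and V: "V \<in> vect k" and W: "W \<in> vect k" and b: "vbasis k V I g \<chi>"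
    and y: "killed_by_coordinates k Y V I \<chi> y"
    and f: "f \<in> lin_maps k V W" and fin: "finite {i\<in>I. f (g i) \<noteq> \<zero>\<^bsub>W\<^esub>}"
  shows "Map Y V W f y = \<zero>\<^bsub>Ob Y W\<^esub>"
proof -
  note Vm = vect_module[OF V] and Wm = vect_module[OF W] and D = vbasisD[OF b]
  note sv = self_module_vect[OF k] and YD = endofunctorD[OF Y]
  interpret W: module k W by fact
  interpret YW: module k "Ob Y W" by (rule YD(1)[OF W])
  have yc: "y \<in> carrier (Ob Y V)"
    and y0: "\<And>i. i \<in> I \<Longrightarrow> Map Y V (self_module k) (\<chi> i) y = \<zero>\<^bsub>Ob Y (self_module k)\<^esub>"
    using y by (auto simp: killed_by_coordinates_def)
  note ev = endofunctor_evaluation[OF Y V W yc]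
  have "Map Y V W f y = \<zero>\<^bsub>Ob Y W\<^esub>"
    if "finite J" "f \<in> lin_maps k V W" "{i\<in>I. f (g i) \<noteq> \<zero>\<^bsub>W\<^esub>} \<subseteq> J" for J f
    using that
  proof (induction J arbitrary: f rule: finite_induct)
    case empty
    note z = linear_map_const_zero[OF Wm]
    have "f = (\<lambda>v\<in>carrier V. \<zero>\<^bsub>W\<^esub>)"
    proof (rule lin_maps_eqI[OF empty.prems(1) lin_mapsI[OF Vm z]])
      fix v assume v: "v \<in> carrier V"
      have "f v = \<zero>\<^bsub>W\<^esub>"
        by (rule vbasis_unique[OF Vm Wm b lin_mapsD(1)[OF empty.prems(1)] z _ v])
          (use empty.prems(2) in auto)
      then show "f v = (\<lambda>v\<in>carrier V. \<zero>\<^bsub>W\<^esub>) v" using v by simp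
    qed
    then have f0: "f = \<zero>\<^bsub>hom_module k V W\<^esub>" by (simp only: hom_module_simps)
    show ?case
      unfolding f0 by (rule linear_map_zero[OF hom_module_module[OF Vm Wm] YD(1)[OF W] ev])
  next
    case (insert j J)
    note fl = lin_mapsD(1)[OF insert.prems(1)]
    have fg: "f (g i) \<in> carrier W" if "i \<in> I" for i using linear_mapD(1)[OF fl D(1)[OF that]] .
    show ?case
    proof (cases "j \<in> I")
      case False
      then have "{i \<in> I. f (g i) \<noteq> \<zero>\<^bsub>W\<^esub>} \<subseteq> J" using insert.prems by auto
      then show ?thesis using insert by blast
    next
      case j: True
      \<comment> \<open>Split off the part of \<open>f\<close> at \<open>g j\<close>:
        \<open>f'\<close> is \<open>f\<close> with that value replaced by zero, and \<open>u\<close>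
        sends \<open>v\<close> to \<chi>_j(v) times \<open>f (g j)\<close>. Since \<open>u\<close>
        factors through \<chi>_j, its image at \<open>y\<close> is zero.\<close>
      have "\<exists>f'\<in>lin_maps k V W. \<forall>i\<in>I. f' (g i) = (if i = j then \<zero>\<^bsub>W\<^esub> else f (g i))"
        using fg by (intro vbasis_extend[OF Vm Wm b]) auto
      then obtain f' where f': "f' \<in> lin_maps k V W"
          "\<And>i. i \<in> I \<Longrightarrow> f' (g i) = (if i = j then \<zero>\<^bsub>W\<^esub> else f (g i))" by blast
      define m where "m = (\<lambda>c\<in>carrier k. c \<odot>\<^bsub>W\<^esub> f (g j))"
      have "linear_map k (self_module k) W (\<lambda>c. c \<odot>\<^bsub>W\<^esub> f (g j))"
        using fg[OF j] by (intro linear_mapI) (auto simp: W.smult_l_distr W.smult_assoc1)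
      then have m: "m \<in> lin_maps k (self_module k) W"
        using lin_mapsI[OF vect_module[OF sv]] by (simp add: m_def)
      define u where "u = compose (carrier V) m (\<chi> j)"
      have u: "u \<in> lin_maps k V W" unfolding u_def by (rule lin_maps_compose[OF Vm D(2)[OF j] m])
      have s: "linear_map k V W (\<lambda>v. f' v \<oplus>\<^bsub>W\<^esub> u v)"
        by (rule linear_map_add[OF Wm lin_mapsD(1)[OF f'(1)] lin_mapsD(1)[OF u]])
      have "f = (\<lambda>v\<in>carrier V. f' v \<oplus>\<^bsub>W\<^esub> u v)"
      proof (rule lin_maps_eqI[OF insert.prems(1) lin_mapsI[OF Vm s]])
        fix v assume v: "v \<in> carrier V"
        have "f v = f' v \<oplus>\<^bsub>W\<^esub> u v"
        proof (rule vbasis_unique[OF Vm Wm b fl s _ v])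
          fix i assume i: "i \<in> I"
          have "u (g i) = (if i = j then f (g j) else \<zero>\<^bsub>W\<^esub>)"
            using D(1)[OF i] D(5)[OF j i] fg[OF j] by (simp add: u_def m_def compose_eq)
          then show "f (g i) = f' (g i) \<oplus>\<^bsub>W\<^esub> u (g i)" using f'(2)[OF i] fg[OF i] fg[OF j] by simp
        qed
        then show "f v = (\<lambda>v\<in>carrier V. f' v \<oplus>\<^bsub>W\<^esub> u v) v" using v by simp
      qed
      then have "f = f' \<oplus>\<^bsub>hom_module k V W\<^esub> u" by simp
      then have "Map Y V W f y = Map Y V W f' y \<oplus>\<^bsub>Ob Y W\<^esub> Map Y V W u y"
        using linear_mapD(2)[OF ev] f'(1) u by simp
      moreover have "Map Y V W f' y = \<zero>\<^bsub>Ob Y W\<^esub>"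
        by (rule insert.IH[OF f'(1)]) (use insert.prems(2) f'(2) in \<open>auto split: if_splits\<close>)
      moreover have "Map Y V W u y = \<zero>\<^bsub>Ob Y W\<^esub>"
        unfolding u_def YD(5)[OF V sv W D(2)[OF j] m yc] y0[OF j]
        by (rule linear_map_zero[OF YD(1)[OF sv] YD(1)[OF W] lin_mapsD(1)[OF YD(3)[OF sv W m]]])
      ultimately show ?thesis by simp
    qed
  qed
  then show ?thesis using f fin by blast
qed

lemma Q3_subfunctor:
  assumes "cring k" "small (carrier k)"
  shows "subfunctor k (power_functor I (yoneda k (self_module k)))
    (\<lambda>V. direct_sum I (Ob (yoneda k (self_module k)) V))"
  by (rule subfunctor_direct_sum)
    (use yoneda_Map_linear[OF self_module_module[OF assms(1)] vect_module]
      hom_module_module[OF self_module_module[OF assms(1)] vect_module] in auto)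

text \<open>
  A family of maps from the ground field to \<open>W\<close>, indexed by a basis of \<open>V\<close>, is the same as a linear
  map from \<open>V\<close> to \<open>W\<close>; so an element of \<open>Y\<close> at \<open>V\<close> is a transformation out of the power.
\<close>

lemma Q3_free_separated:
  assumes k: "cring k" "small (carrier k)" and Y: "Y \<in> vect_endofunctors k"
    and free: "Q_free k (Q3 k) Y"
  shows "separated_by_coordinates k Y"
  unfolding separated_by_coordinates_def
proof (intro ballI allI impI)
  fix V and I :: "'a set" and g \<chi> y
  assume V: "V \<in> vect k" and I: "small I" and b: "vbasis k V I g \<chi>"
    and y: "killed_by_coordinates k Y V I \<chi> y"
  interpret k: cring k by fact
  note Vm = vect_module[OF V] and D = vbasisD[OF b]
  note sv = self_module_vect[OF k] and YD = endofunctorD[OF Y]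
  have yc: "y \<in> carrier (Ob Y V)" using y by (simp add: killed_by_coordinates_def)
  let ?K = "self_module k"
  let ?P = "power_functor I (yoneda k ?K)"
  let ?S = "\<lambda>V. direct_sum I (Ob (yoneda k ?K) V)"
  interpret S: subfunctor k ?P ?S by (rule Q3_subfunctor[OF k])
  have Pc: "x i \<in> lin_maps k ?K W" if "x \<in> carrier (Ob ?P W)" "i \<in> I" for x i W
    using that by auto
  have P1: "x i \<one>\<^bsub>k\<^esub> \<in> carrier W" if "x \<in> carrier (Ob ?P W)" "i \<in> I" for x i W
    using linear_mapD(1)[OF lin_mapsD(1)[OF Pc[OF that]]] by simp
  define L where "L = (\<lambda>(W :: ('a, 'a) module) x. SOME f. f \<in> lin_maps k V W \<and> (\<forall>i\<in>I. f (g i) = x i \<one>\<^bsub>k\<^esub>))"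
  have "L W x \<in> lin_maps k V W \<and> (\<forall>i\<in>I. L W x (g i) = x i \<one>\<^bsub>k\<^esub>)"
    if "W \<in> vect k" "x \<in> carrier (Ob ?P W)" for W x
  proof -
    have "\<exists>f\<in>lin_maps k V W. \<forall>i\<in>I. f (g i) = x i \<one>\<^bsub>k\<^esub>"
      using P1[OF that(2)] by (intro vbasis_extend[OF Vm vect_module[OF that(1)] b])
    then have "\<exists>f. f \<in> lin_maps k V W \<and> (\<forall>i\<in>I. f (g i) = x i \<one>\<^bsub>k\<^esub>)" by blast
    then show ?thesis unfolding L_def by (rule someI_ex)
  qed
  then have L: "L W x \<in> lin_maps k V W" "i \<in> I \<Longrightarrow> L W x (g i) = x i \<one>\<^bsub>k\<^esub>"
    if "W \<in> vect k" "x \<in> carrier (Ob ?P W)" for W x i using that by blast+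
  \<comment> \<open>Linearity and naturality of \<open>L\<close> are checked through this
    uniqueness, by comparing values on the basis.\<close>
  have Leq: "L W x = f" if W: "W \<in> vect k" and x: "x \<in> carrier (Ob ?P W)" and f: "f \<in> lin_maps k V W"
    and e: "\<And>i. i \<in> I \<Longrightarrow> f (g i) = x i \<one>\<^bsub>k\<^esub>" for W x f
  proof (rule lin_maps_eqI[OF L(1)[OF W x] f])
    show "L W x v = f v" if "v \<in> carrier V" for v
      by (rule vbasis_unique[OF Vm vect_module[OF W] b lin_mapsD(1)[OF L(1)[OF W x]] lin_mapsD(1)[OF f] _ that])
        (simp add: L(2)[OF W x] e)
  qed
  have Llin: "linear_map k (Ob ?P W) (hom_module k V W) (L W)" if W: "W \<in> vect k" for W
  proof (rule linear_mapI)
    note Wm = vect_module[OF W]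
    interpret P: module k "Ob ?P W" by (rule S.Ob_module[OF W])
    show "L W x \<in> carrier (hom_module k V W)" if "x \<in> carrier (Ob ?P W)" for x
      using L(1)[OF W that] by simp
    show "L W (x \<oplus>\<^bsub>Ob ?P W\<^esub> x') = L W x \<oplus>\<^bsub>hom_module k V W\<^esub> L W x'"
      if x: "x \<in> carrier (Ob ?P W)" "x' \<in> carrier (Ob ?P W)" for x x'
      unfolding hom_module_simps
      by (rule Leq[OF W P.a_closed[OF x] lin_maps_add[OF Vm Wm L(1)[OF W x(1)] L(1)[OF W x(2)]]])
        (use D(1) L(2)[OF W x(1)] L(2)[OF W x(2)] in simp)
    show "L W (a \<odot>\<^bsub>Ob ?P W\<^esub> x) = a \<odot>\<^bsub>hom_module k V W\<^esub> L W x"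
      if a: "a \<in> carrier k" and x: "x \<in> carrier (Ob ?P W)" for a x
      unfolding hom_module_simps
      by (rule Leq[OF W P.smult_closed[OF a x] lin_maps_smult[OF Vm Wm L(1)[OF W x] a]])
        (use D(1) L(2)[OF W x] in simp)
  qed
  have lin: "linear_map k (Ob ?P W) (Ob Y W) (\<lambda>x. Map Y V W (L W x) y)" if W: "W \<in> vect k" for W
    by (rule linear_map_compose[OF Llin[OF W] endofunctor_evaluation[OF Y V W yc]])
  have nat: "Map Y V W' (L W' (Map ?P W W' f x)) y = Map Y W W' f (Map Y V W (L W x) y)"
    if W: "W \<in> vect k" and W': "W' \<in> vect k" and f: "f \<in> lin_maps k W W'"
      and x: "x \<in> carrier (Ob ?P W)" for W W' f x
  proof -
    have "L W' (Map ?P W W' f x) = compose (carrier V) f (L W x)"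
    proof (rule Leq[OF W' _ lin_maps_compose[OF Vm L(1)[OF W x] f]])
      show "Map ?P W W' f x \<in> carrier (Ob ?P W')"
        by (rule linear_mapD(1)[OF S.Map_linear[OF W W' f] x])
      fix i assume i: "i \<in> I"
      have "Map ?P W W' f x i = compose (carrier k) f (x i)" using x i Pc[OF x i] by simp
      then show "compose (carrier V) f (L W x) (g i) = Map ?P W W' f x i \<one>\<^bsub>k\<^esub>"
        using D(1)[OF i] L(2)[OF W x i] by (simp add: compose_eq)
    qed
    then show ?thesis using YD(5)[OF V W W' L(1)[OF W x] f yc] by simp
  qed
  \<comment> \<open>A finitely supported family gives a map that is nonzero only on basis vectors
    from its support.\<close>
  have van: "Map Y V W (L W x) y = \<zero>\<^bsub>Ob Y W\<^esub>" if W: "W \<in> vect k" and x: "x \<in> ?S W" for W x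
  proof -
    have xc: "x \<in> carrier (Ob ?P W)" using x by (auto simp: direct_sum_def)
    have "finite {i\<in>I. x i \<noteq> \<zero>\<^bsub>hom_module k ?K W\<^esub>}" using x by (simp add: direct_sum_def)
    moreover have "{i\<in>I. L W x (g i) \<noteq> \<zero>\<^bsub>W\<^esub>} \<subseteq> {i\<in>I. x i \<noteq> \<zero>\<^bsub>hom_module k ?K W\<^esub>}"
      using L(2)[OF W xc] by auto
    ultimately have "finite {i\<in>I. L W x (g i) \<noteq> \<zero>\<^bsub>W\<^esub>}" by (rule rev_finite_subset)
    then show ?thesis by (rule killed_by_finite_rank[OF k Y V W b y L(1)[OF W xc]])
  qed
  have "S.Q \<in> Q3 k" using I by (auto simp: Q3_def)
  then have fr: "nat_transfs k S.Q Y \<subseteq> {\<zero>\<^bsub>nat_module k S.Q Y\<^esub>}" using free by (simp add: Q_free_def)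
  \<comment> \<open>The inclusions of the coordinate lines. Under the correspondence this family is
    the identity of \<open>V\<close>, whose image is \<open>y\<close>.\<close>
  define x where "x = (\<lambda>i\<in>I. \<lambda>c\<in>carrier k. c \<odot>\<^bsub>V\<^esub> g i)"
  interpret V: module k V by (rule Vm)
  have "(\<lambda>c\<in>carrier ?K. c \<odot>\<^bsub>V\<^esub> g i) \<in> lin_maps k ?K V" if "i \<in> I" for i
    using D(1)[OF that]
    by (intro lin_mapsI[OF vect_module[OF sv]] linear_mapI) (auto simp: V.smult_l_distr V.smult_assoc1)
  then have x: "x \<in> carrier (Ob ?P V)" by (auto simp: x_def)
  have "L V x = id_map V"
    by (rule Leq[OF V x id_map_lin[OF Vm]]) (use D(1) in \<open>simp add: x_def id_map_def\<close>)
  moreover have "Map Y V V (L V x) y = \<zero>\<^bsub>Ob Y V\<^esub>"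
    by (rule S.induced_nat_transf_zero[where \<eta> = "\<lambda>W x. Map Y V W (L W x) y" and G = Y,
          OF YD(1) lin nat van fr V x])
  ultimately show "y = \<zero>\<^bsub>Ob Y V\<^esub>" using YD(4)[OF V yc] by simp
qed

text \<open>The filter consists of the subspaces containing all but finitely many basis vectors. A
  map vanishing on one of them is nonzero on finitely many basis vectors only, so the transformation
  given by \<open>y\<close> kills it. The intersection is zero because the kernel of \<chi>_i misses
  no basis vector except possibly \<open>g i\<close>, so it belongs to the filter, and the
  coordinates separate points.\<close>

lemma Q4_free_separated:
  assumes k: "cring k" "small (carrier k)" and Y: "Y \<in> vect_endofunctors k"
    and free: "Q_free k (Q4 k) Y"
  shows "separated_by_coordinates k Y"
  unfolding separated_by_coordinates_def
proof (intro ballI allI impI)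
  fix V and I :: "'a set" and g \<chi> y
  assume V: "V \<in> vect k" and I: "small I" and b: "vbasis k V I g \<chi>"
    and y: "killed_by_coordinates k Y V I \<chi> y"
  interpret k: cring k by fact
  note Vm = vect_module[OF V] and D = vbasisD[OF b]
  note sv = self_module_vect[OF k] and YD = endofunctorD[OF Y]
  have yc: "y \<in> carrier (Ob Y V)" using y by (simp add: killed_by_coordinates_def)
  let ?K = "self_module k"
  define \<F> where "\<F> = {H. submodule H k V \<and> finite {i\<in>I. g i \<notin> H}}"
  interpret V: module k V by (rule Vm)
  have int: "submodule (H \<inter> H') k V" if "submodule H k V" "submodule H' k V" for H H'
    by (rule submodule_intro[OF Vm]) (use submodule_closed[OF Vm that(1)] submodule_closed[OF Vm that(2)] in auto)
  have filt: "subspace_filter k V \<F>"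
    unfolding subspace_filter_def
  proof (intro conjI ballI allI impI)
    show "\<F> \<subseteq> {H. submodule H k V}" by (auto simp: \<F>_def)
    have "{i\<in>I. g i \<notin> carrier V} = {}" using D(1) by auto
    then have "finite {i\<in>I. g i \<notin> carrier V}" by (simp only: finite.emptyI)
    then have "carrier V \<in> \<F>" using V.carrier_is_submodule by (simp add: \<F>_def)
    then show "\<F> \<noteq> {}" by auto
  next
    fix H H' assume H: "H \<in> \<F>" "H' \<in> \<F>"
    have "{i\<in>I. g i \<notin> H \<inter> H'} = {i\<in>I. g i \<notin> H} \<union> {i\<in>I. g i \<notin> H'}" by auto
    then have "finite {i\<in>I. g i \<notin> H \<inter> H'}" using H by (simp add: \<F>_def)
    then show "H \<inter> H' \<in> \<F>" using H int by (simp add: \<F>_def)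
  next
    fix H H' assume H: "H \<in> \<F>" and H': "submodule H' k V \<and> H \<subseteq> H'"
    have "finite {i\<in>I. g i \<notin> H'}"
      by (rule finite_subset[of _ "{i\<in>I. g i \<notin> H}"]) (use H H' in \<open>auto simp: \<F>_def\<close>)
    then show "H' \<in> \<F>" using H' by (simp add: \<F>_def)
  qed
  have zero: "\<Inter>\<F> = {\<zero>\<^bsub>V\<^esub>}"
  proof
    show "{\<zero>\<^bsub>V\<^esub>} \<subseteq> \<Inter>\<F>" using submodule_closed(2)[OF Vm] by (auto simp: \<F>_def)
    show "\<Inter>\<F> \<subseteq> {\<zero>\<^bsub>V\<^esub>}"
    proof
      fix v assume v: "v \<in> \<Inter>\<F>"
      have ker: "v \<in> carrier V \<and> \<chi> i v = \<zero>\<^bsub>k\<^esub>" if i: "i \<in> I" for i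
      proof -
        let ?H = "{v \<in> carrier V. \<chi> i v = \<zero>\<^bsub>?K\<^esub>}"
        have "submodule ?H k V"
          by (rule equalizer_submodule[OF Vm vect_module[OF sv] D(3)[OF i]
                linear_map_const_zero[OF vect_module[OF sv]]])
        moreover have "finite {j\<in>I. g j \<notin> ?H}"
          by (rule finite_subset[of _ "{i}"]) (use D(1) D(5)[OF i] in \<open>auto split: if_splits\<close>)
        ultimately have "?H \<in> \<F>" by (simp add: \<F>_def)
        then show ?thesis using v by auto
      qed
      \<comment> \<open>For empty \<open>I\<close> there are no kernels to place \<open>v\<close> in
        the carrier, so the whole space is used.\<close>
      have "carrier V \<in> \<F>"
        using filt V.carrier_is_submodule submodule_closed(1)[OF Vm]
        unfolding subspace_filter_def by blast
      then have "v \<in> carrier V" using v by auto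
      then show "v \<in> {\<zero>\<^bsub>V\<^esub>}" using D(7)[of v] ker by simp
    qed
  qed
  let ?S = "\<lambda>W. \<Union>H\<in>\<F>. yoneda_vanishing k V H W"
  interpret S: subfunctor k "yoneda k V" ?S by (rule subfunctor_filter[OF V filt])
  have lin: "linear_map k (Ob (yoneda k V) W) (Ob Y W) (\<lambda>f. Map Y V W f y)" if W: "W \<in> vect k" for W
    using endofunctor_evaluation[OF Y V W yc] by simp
  have nat: "Map Y V W' (Map (yoneda k V) W W' f x) y = Map Y W W' f (Map Y V W x y)"
    if W: "W \<in> vect k" and W': "W' \<in> vect k" and f: "f \<in> lin_maps k W W'"
      and x: "x \<in> carrier (Ob (yoneda k V) W)" for W W' f x
    using YD(5)[OF V W W' _ f yc] x by simp
  have van: "Map Y V W x y = \<zero>\<^bsub>Ob Y W\<^esub>" if W: "W \<in> vect k" and x: "x \<in> ?S W" for W x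
  proof -
    obtain H where H: "H \<in> \<F>" "x \<in> lin_maps k V W" "\<forall>h\<in>H. x h = \<zero>\<^bsub>W\<^esub>"
      using x by (auto simp: yoneda_vanishing_def)
    have "finite {i\<in>I. x (g i) \<noteq> \<zero>\<^bsub>W\<^esub>}"
      by (rule finite_subset[of _ "{i\<in>I. g i \<notin> H}"]) (use H in \<open>auto simp: \<F>_def\<close>)
    then show ?thesis by (rule killed_by_finite_rank[OF k Y V W b y H(2)])
  qed
  have "S.Q \<in> Q4 k" using V filt zero by (auto simp: Q4_def)
  then have fr: "nat_transfs k S.Q Y \<subseteq> {\<zero>\<^bsub>nat_module k S.Q Y\<^esub>}" using free by (simp add: Q_free_def)
  have id: "id_map V \<in> carrier (Ob (yoneda k V) V)" using id_map_lin[OF Vm] by simp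
  have "Map Y V V (id_map V) y = \<zero>\<^bsub>Ob Y V\<^esub>"
    by (rule S.induced_nat_transf_zero[where \<eta> = "\<lambda>W f. Map Y V W f y" and G = Y,
          OF YD(1) lin nat van fr V id])
  then show "y = \<zero>\<^bsub>Ob Y V\<^esub>" using YD(4)[OF V yc] by simp
qed


section \<open>The internal hom\<close>

text \<open>Stated for any quotient, so that one proof serves both classes. Freeness of
  \<open>Y\<close> enters twice: at \<open>Q\<close> itself it kills the contracted transformations,
  and through \<open>sep\<close> it makes elements with vanishing contractions zero.\<close>

lemma inner_hom_transfs_zero:
  assumes k: "field k" "small (carrier k)" and Y: "Y \<in> vect_endofunctors k"
    and Q: "subfunctor k F S"
    and free: "nat_transfs k (quotient_functor k F S) Y \<subseteq> {\<zero>\<^bsub>nat_module k (quotient_functor k F S) Y\<^esub>}"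
    and sep: "separated_by_coordinates k Y"
  defines "Q \<equiv> quotient_functor k F S"
  shows "nat_transfs k Q (inner_hom k X Y) \<subseteq> {\<zero>\<^bsub>nat_module k Q (inner_hom k X Y)\<^esub>}"
proof
  interpret k: field k by (rule k(1))
  note YD = endofunctorD[OF Y] and sv = self_module_vect[OF k.is_cring k(2)]
  note contr = contraction_spec[OF k] and tv = tensor_vect[OF k]
  fix \<eta> assume \<eta>: "\<eta> \<in> nat_transfs k Q (inner_hom k X Y)"
  \<comment> \<open>The values of \<eta> are themselves transformations, so linearity and naturality
    of \<eta> are restated for the elements \<open>\<eta> V q H x\<close> obtained by evaluating all
    the way down.\<close>
  have \<eta>lin: "linear_map k (Ob Q V) (nat_module k X (tensor_precomp k Y V)) (\<eta> V)"
    "\<eta> V \<in> extensional (carrier (Ob Q V))" if "V \<in> vect k" for V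
    using \<eta> that by (auto simp: nat_transfs_def inner_hom_def lin_maps_def)
  have \<eta>q: "\<eta> V q \<in> nat_transfs k X (tensor_precomp k Y V)"
    if "V \<in> vect k" "q \<in> carrier (Ob Q V)" for V q
    using linear_mapD(1)[OF \<eta>lin(1)[OF that(1)] that(2)] by (simp add: nat_module_def)
  have \<eta>H: "\<eta> V q H \<in> lin_maps k (Ob X H) (Ob Y (tensor k H V))"
    if "V \<in> vect k" "q \<in> carrier (Ob Q V)" "H \<in> vect k" for V q H
    using \<eta>q[OF that(1,2)] that(3) by (simp add: nat_transfs_def tensor_precomp_def)
  have \<eta>c: "\<eta> V q H x \<in> carrier (Ob Y (tensor k H V))"
    if "V \<in> vect k" "q \<in> carrier (Ob Q V)" "H \<in> vect k" "x \<in> carrier (Ob X H)" for V q H x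
    using linear_mapD(1)[OF lin_mapsD(1)[OF \<eta>H[OF that(1-3)]] that(4)] .
  have \<eta>add: "\<eta> V (q \<oplus>\<^bsub>Ob Q V\<^esub> q') H x = \<eta> V q H x \<oplus>\<^bsub>Ob Y (tensor k H V)\<^esub> \<eta> V q' H x"
    if "V \<in> vect k" "q \<in> carrier (Ob Q V)" "q' \<in> carrier (Ob Q V)" "H \<in> vect k" "x \<in> carrier (Ob X H)"
    for V q q' H x
    using linear_mapD(2)[OF \<eta>lin(1)[OF that(1)] that(2,3)] that(4,5)
    by (simp add: nat_module_def tensor_precomp_def)
  have \<eta>smult: "\<eta> V (a \<odot>\<^bsub>Ob Q V\<^esub> q) H x = a \<odot>\<^bsub>Ob Y (tensor k H V)\<^esub> \<eta> V q H x"
    if "V \<in> vect k" "a \<in> carrier k" "q \<in> carrier (Ob Q V)" "H \<in> vect k" "x \<in> carrier (Ob X H)"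
    for V a q H x
    using linear_mapD(3)[OF \<eta>lin(1)[OF that(1)] that(2,3)] that(4,5)
    by (simp add: nat_module_def tensor_precomp_def)
  have \<eta>nat: "\<eta> W (Map Q V W f q) H x
      = Map Y (tensor k H V) (tensor k H W) (tensor_map k H H V W (id_map H) f) (\<eta> V q H x)"
    if "V \<in> vect k" "W \<in> vect k" "f \<in> lin_maps k V W" "q \<in> carrier (Ob Q V)" "H \<in> vect k"
      "x \<in> carrier (Ob X H)" for V W f q H x
  proof -
    have "\<eta> W (Map Q V W f q) = Map (inner_hom k X Y) V W f (\<eta> V q)"
      using \<eta> that(1-4) by (simp add: nat_transfs_def)
    then show ?thesis using \<eta>q[OF that(1,4)] that(5,6) by (simp add: inner_hom_def)
  qed
  \<comment> \<open>With \<open>H\<close>, \<open>x\<close> and \<phi> fixed and \<open>V\<close>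
    varying, the contracted values form a transformation \<zeta> from \<open>Q\<close> to
    \<open>Y\<close>, which freeness makes zero.\<close>
  have contr0: "Map Y (tensor k H V) V (contraction k H V \<phi>) (\<eta> V q H x) = \<zero>\<^bsub>Ob Y V\<^esub>"
    if V: "V \<in> vect k" and q: "q \<in> carrier (Ob Q V)" and H: "H \<in> vect k" and x: "x \<in> carrier (Ob X H)"
      and \<phi>: "\<phi> \<in> lin_maps k H (self_module k)" for V q H x \<phi>
  proof -
    define \<zeta> where "\<zeta> = (\<lambda>V\<in>vect k. \<lambda>q\<in>carrier (Ob Q V).
        Map Y (tensor k H V) V (contraction k H V \<phi>) (\<eta> V q H x))"
    have "\<zeta> \<in> nat_transfs k Q Y"
      unfolding nat_transfs_def
    proof (intro CollectI conjI ballI)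
      show "\<zeta> \<in> extensional (vect k)" by (simp add: \<zeta>_def)
      fix V assume V: "V \<in> vect k"
      note l = linear_mapD[OF lin_mapsD(1)[OF YD(3)[OF tv[OF H V] V contr(1)[OF H V \<phi>]]]]
      have "linear_map k (Ob Q V) (Ob Y V) (\<zeta> V)"
      proof (rule linear_mapI)
        show "\<zeta> V q \<in> carrier (Ob Y V)" if "q \<in> carrier (Ob Q V)" for q
          using that V by (simp add: \<zeta>_def H x \<eta>c l)
        show "\<zeta> V (q \<oplus>\<^bsub>Ob Q V\<^esub> q') = \<zeta> V q \<oplus>\<^bsub>Ob Y V\<^esub> \<zeta> V q'"
          if "q \<in> carrier (Ob Q V)" "q' \<in> carrier (Ob Q V)" for q q'
          using that V subfunctor.quotient_add_closed[OF Q V, folded Q_def]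
          by (simp add: \<zeta>_def H x \<eta>c \<eta>add l)
        show "\<zeta> V (a \<odot>\<^bsub>Ob Q V\<^esub> q) = a \<odot>\<^bsub>Ob Y V\<^esub> \<zeta> V q"
          if "a \<in> carrier k" "q \<in> carrier (Ob Q V)" for a q
          using that V subfunctor.quotient_smult_closed[OF Q V, folded Q_def]
          by (simp add: \<zeta>_def H x \<eta>c \<eta>smult l)
      qed
      then show "\<zeta> V \<in> lin_maps k (Ob Q V) (Ob Y V)"
        using V by (simp add: lin_maps_def) (simp add: \<zeta>_def)
      fix W f q assume W: "W \<in> vect k" and f: "f \<in> lin_maps k V W" and q: "q \<in> carrier (Ob Q V)"
      have Mq: "Map Q V W f q \<in> carrier (Ob Q W)"
        unfolding Q_def by (rule subfunctor.quotient_Map_closed[OF Q V W f q[unfolded Q_def]])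
      note tm = tensor_map_spec(1)[OF k H V H W id_map_lin[OF vect_module[OF H]] f]
      have "\<zeta> W (Map Q V W f q) = Map Y (tensor k H W) W (contraction k H W \<phi>)
          (Map Y (tensor k H V) (tensor k H W) (tensor_map k H H V W (id_map H) f) (\<eta> V q H x))"
        using W Mq by (simp add: \<zeta>_def \<eta>nat[OF V W f q H x])
      also have "\<dots> = Map Y (tensor k H V) W (compose (carrier (tensor k H V)) (contraction k H W \<phi>)
          (tensor_map k H H V W (id_map H) f)) (\<eta> V q H x)"
        by (rule YD(5)[OF tv[OF H V] tv[OF H W] W tm contr(1)[OF H W \<phi>] \<eta>c[OF V q H x], symmetric])
      also have "\<dots> = Map Y (tensor k H V) W
          (compose (carrier (tensor k H V)) f (contraction k H V \<phi>)) (\<eta> V q H x)"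
        by (simp only: contraction_natural[OF k H V W \<phi> f])
      also have "\<dots> = Map Y V W f (Map Y (tensor k H V) V (contraction k H V \<phi>) (\<eta> V q H x))"
        by (rule YD(5)[OF tv[OF H V] V W contr(1)[OF H V \<phi>] f \<eta>c[OF V q H x]])
      also have "\<dots> = Map Y V W f (\<zeta> V q)" using V q by (simp add: \<zeta>_def)
      finally show "\<zeta> W (Map Q V W f q) = Map Y V W f (\<zeta> V q)" .
    qed
    then have "\<zeta> = \<zero>\<^bsub>nat_module k Q Y\<^esub>" using free by (auto simp: Q_def)
    then have "\<zeta> V q = \<zero>\<^bsub>Ob Y V\<^esub>" using V q by (simp add: nat_module_def)
    then show ?thesis using V q by (simp add: \<zeta>_def)
  qed
  have \<eta>0: "\<eta> V q H x = \<zero>\<^bsub>Ob Y (tensor k H V)\<^esub>"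
    if V: "V \<in> vect k" and q: "q \<in> carrier (Ob Q V)" and H: "H \<in> vect k" and x: "x \<in> carrier (Ob X H)"
    for V q H x
  proof -
    let ?T = "tensor k H V"
    note T = tv[OF H V] and c = \<eta>c[OF V q H x]
    obtain U and I :: "'a set" and g \<chi> r s where U: "U \<in> vect k" and I: "small I"
      and b: "vbasis k U I g \<chi>" and r: "r \<in> lin_maps k ?T U" and s: "s \<in> lin_maps k U ?T"
      and sr: "compose (carrier ?T) s r = id_map ?T"
      and co: "\<forall>i\<in>I. \<exists>\<phi>\<in>lin_maps k H (self_module k). \<exists>\<psi>\<in>lin_maps k V (self_module k).
        compose (carrier ?T) (\<chi> i) r = compose (carrier ?T) \<psi> (contraction k H V \<phi>)"
      by (rule tensor_coordinates[OF k H V])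
    \<comment> \<open>The element is moved along \<open>r\<close> to the space \<open>U\<close> with
      a product basis, where separation applies, and \<open>s\<close> brings the resulting zero
      back.\<close>
    let ?z = "Map Y ?T U r (\<eta> V q H x)"
    have "Map Y U (self_module k) (\<chi> i) ?z = \<zero>\<^bsub>Ob Y (self_module k)\<^esub>" if i: "i \<in> I" for i
    proof -
      obtain \<phi> \<psi> where \<phi>: "\<phi> \<in> lin_maps k H (self_module k)" and \<psi>: "\<psi> \<in> lin_maps k V (self_module k)"
        and e: "compose (carrier ?T) (\<chi> i) r = compose (carrier ?T) \<psi> (contraction k H V \<phi>)"
        using co i by blast
      have "Map Y U (self_module k) (\<chi> i) ?z
          = Map Y ?T (self_module k) (compose (carrier ?T) (\<chi> i) r) (\<eta> V q H x)"
        by (rule YD(5)[OF T U sv r vbasisD(2)[OF b i] c, symmetric])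
      also have "\<dots> = Map Y V (self_module k) \<psi> (Map Y ?T V (contraction k H V \<phi>) (\<eta> V q H x))"
        unfolding e by (rule YD(5)[OF T V sv contr(1)[OF H V \<phi>] \<psi> c])
      also have "\<dots> = \<zero>\<^bsub>Ob Y (self_module k)\<^esub>"
        unfolding contr0[OF V q H x \<phi>]
        by (rule linear_map_zero[OF YD(1)[OF V] YD(1)[OF sv] lin_mapsD(1)[OF YD(3)[OF V sv \<psi>]]])
      finally show ?thesis .
    qed
    moreover have "?z \<in> carrier (Ob Y U)"
      by (rule linear_mapD(1)[OF lin_mapsD(1)[OF YD(3)[OF T U r]] c])
    ultimately have "killed_by_coordinates k Y U I \<chi> ?z" by (simp add: killed_by_coordinates_def)
    then have z: "?z = \<zero>\<^bsub>Ob Y U\<^esub>" using sep U I b unfolding separated_by_coordinates_def by blast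
    have "\<eta> V q H x = Map Y ?T ?T (compose (carrier ?T) s r) (\<eta> V q H x)"
      unfolding sr by (rule YD(4)[OF T c, symmetric])
    also have "\<dots> = Map Y U ?T s ?z" by (rule YD(5)[OF T U T r s c])
    also have "\<dots> = \<zero>\<^bsub>Ob Y ?T\<^esub>"
      unfolding z by (rule linear_map_zero[OF YD(1)[OF U] YD(1)[OF T] lin_mapsD(1)[OF YD(3)[OF U T s]]])
    finally show ?thesis .
  qed
  \<comment> \<open>From here on pointwise vanishing is lifted to equality with the zero
    transformation, one layer of extensional functions at a time.\<close>
  have "\<eta> V q = \<zero>\<^bsub>nat_module k X (tensor_precomp k Y V)\<^esub>" if V: "V \<in> vect k" and q: "q \<in> carrier (Ob Q V)" for V q
  proof -
    have "\<eta> V q \<in> extensional (vect k)" using \<eta>q[OF V q] by (simp add: nat_transfs_def)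
    moreover have "\<eta> V q H = (\<lambda>x\<in>carrier (Ob X H). \<zero>\<^bsub>Ob Y (tensor k H V)\<^esub>)" if H: "H \<in> vect k" for H
      using lin_mapsD(2)[OF \<eta>H[OF V q H]] \<eta>0[OF V q H] by (intro extensionalityI[of _ "carrier (Ob X H)"]) auto
    ultimately show ?thesis
      by (intro extensionalityI[of _ "vect k"]) (auto simp: nat_module_def tensor_precomp_def)
  qed
  then have e: "\<eta> V = (\<lambda>q\<in>carrier (Ob Q V). \<zero>\<^bsub>nat_module k X (tensor_precomp k Y V)\<^esub>)" if V: "V \<in> vect k" for V
    using \<eta>lin(2)[OF V] V by (intro extensionalityI[of _ "carrier (Ob Q V)"]) auto
  have "\<eta> \<in> extensional (vect k)" using \<eta> by (simp add: nat_transfs_def)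
  then have "\<eta> = (\<lambda>V\<in>vect k. \<lambda>q\<in>carrier (Ob Q V). \<zero>\<^bsub>nat_module k X (tensor_precomp k Y V)\<^esub>)"
    using e by (intro extensionalityI[of _ "vect k"]) auto
  also have "\<dots> = \<zero>\<^bsub>nat_module k Q (inner_hom k X Y)\<^esub>"
    by (simp add: nat_module_def inner_hom_def)
  finally show "\<eta> \<in> {\<zero>\<^bsub>nat_module k Q (inner_hom k X Y)\<^esub>}" by simp
qed

theorem proposition6p12:
  fixes k :: "'u::grothendieck_universe ring"
    and X Y :: "('u, 'u) vfunctor"
  assumes "field k" and "small (carrier k)"
    and "X \<in> ind_vect_op k" and "Y \<in> ind_vect_op k"
  shows "(Q_free k (Q3 k) Y \<longrightarrow> Q_free k (Q3 k) (inner_hom k X Y)) \<and>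
         (Q_free k (Q4 k) Y \<longrightarrow> Q_free k (Q4 k) (inner_hom k X Y))"
proof (intro conjI impI)
  interpret k: field k by fact
  have Y: "Y \<in> vect_endofunctors k" using assms(4) by (simp add: ind_vect_op_def)
  note k = k.is_cring assms(2)
  show "Q_free k (Q3 k) (inner_hom k X Y)" if free: "Q_free k (Q3 k) Y"
    unfolding Q_free_def
  proof
    fix Q assume Q: "Q \<in> Q3 k"
    then obtain I :: "'u set" where I: "Q = quotient_functor k (power_functor I (yoneda k (self_module k)))
        (\<lambda>V. direct_sum I (Ob (yoneda k (self_module k)) V))"
      unfolding Q3_def by blast
    have "nat_transfs k Q Y \<subseteq> {\<zero>\<^bsub>nat_module k Q Y\<^esub>}" using free Q by (simp add: Q_free_def)
    then show "nat_transfs k Q (inner_hom k X Y) \<subseteq> {\<zero>\<^bsub>nat_module k Q (inner_hom k X Y)\<^esub>}"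
      unfolding I
      by (rule inner_hom_transfs_zero[OF assms(1,2) Y Q3_subfunctor[OF k] _ Q3_free_separated[OF k Y free]])
  qed
  show "Q_free k (Q4 k) (inner_hom k X Y)" if free: "Q_free k (Q4 k) Y"
    unfolding Q_free_def
  proof
    fix Q assume Q: "Q \<in> Q4 k"
    then obtain V \<F> where V: "V \<in> vect k" "subspace_filter k V \<F>"
      "Q = quotient_functor k (yoneda k V) (\<lambda>W. \<Union>H\<in>\<F>. yoneda_vanishing k V H W)"
      unfolding Q4_def by blast
    have "nat_transfs k Q Y \<subseteq> {\<zero>\<^bsub>nat_module k Q Y\<^esub>}" using free Q by (simp add: Q_free_def)
    then show "nat_transfs k Q (inner_hom k X Y) \<subseteq> {\<zero>\<^bsub>nat_module k Q (inner_hom k X Y)\<^esub>}"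
      unfolding V(3)
      by (rule inner_hom_transfs_zero[OF assms(1,2) Y subfunctor_filter[OF V(1,2)] _
            Q4_free_separated[OF k Y free]])
  qed
qed

end
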